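(* Let $G$ be a second-countable, locally compact group. Let $(\alpha,\mathfrak u):G\curvearrowright A$ and $(\beta,\mathfrak v):G\curvearrowright B$ be two twisted actions on separable C*-algebras. Suppose that $(\phi,\mathsf u):(A,\alpha,\mathfrak u)\to(B,\beta,\mathfrak v)$ and $(\psi,\mathsf v):(B,\beta,\mathfrak v)\to(A,\alpha,\mathfrak u)$ are two cocycle morphisms such that $$\mathrm{id}_A\precapprox_{\mathrm u}(\psi,\mathsf v)\circ(\phi,\mathsf u)\quad\text{and}\quad\mathrm{id}_B\precapprox_{\mathrm u}(\phi,\mathsf u)\circ(\psi,\mathsf v).$$ Then there exist mutually inverse cocycle conjugacies $(\Phi,\mathsf U):(A,\alpha,\mathfrak u)\to(B,\beta,\mathfrak v)$ and $(\Psi,\mathsf V):(B,\beta,\mathfrak v)\to(A,\alpha,\mathfrak u)$ such that $$(\Phi,\mathsf U)\precapprox_{\mathrm u}(\phi,\mathsf u)\quad\text{and}\quad(\Psi,\mathsf V)\precapprox_{\mathrm u}(\psi,\mathsf v).$$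
   Context: $\mathcal M(A)$ denotes the multiplier algebra, $\mathcal U(\cdot)$ the unitary group, $\mathrm{Ad}(u)=u(\cdot)u^*$; automorphisms of $A$ are extended canonically to $\mathcal M(A)$. A twisted action $(\alpha,\mathfrak u):G\curvearrowright A$ consists of a point-norm continuous map $\alpha:G\to\mathrm{Aut}(A)$ and a strictly continuous map $\mathfrak u:G\times G\to\mathcal U(\mathcal M(A))$ with $\alpha_1=\mathrm{id}_A$, $\alpha_s\circ\alpha_t=\mathrm{Ad}(\mathfrak u_{s,t})\circ\alpha_{st}$, $\mathfrak u_{s,1}=\mathfrak u_{1,s}=\mathbf 1$ and $\alpha_r(\mathfrak u_{s,t})\mathfrak u_{r,st}=\mathfrak u_{r,s}\mathfrak u_{rs,t}$ for all $r,s,t\in G$. A $*$-homomorphism $\phi:A\to\mathcal M(B)$ is extendible if for any increasing approximate unit $(e_\lambda)$ of $A$ the net $\phi(e_\lambda)$ converges strictly to a projection $p\in\mathcal M(B)$. Then $\phi$ extends uniquely to a unital $*$-homomorphism $\phi_p:\mathcal M(A)\to p\mathcal M(B)p$ strictly continuous on the unit ball; put $\phi^+(u)=\phi_p(u)+(\mathbf 1-p)$ for $u\in\mathcal U(\mathcal M(A))$. A cocycle morphism $(\psi,\mathsf v):(A,\alpha,\mathfrak u)\to(B,\beta,\mathfrak v)$ is a pair of an extendible $*$-homomorphism $\psi:A\to B$ and a strictly continuous map $\mathsf v:G\to\mathcal U(\mathcal M(B))$ with $\mathrm{Ad}(\mathsf v_g)\circ\beta_g\circ\psi=\psi\circ\alpha_g$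 and $\psi^+(\mathfrak u_{g,h})=\mathsf v_g\beta_g(\mathsf v_h)\mathfrak v_{g,h}\mathsf v_{gh}^*$ for all $g,h\in G$. Composition is $(\psi,\mathsf v)\circ(\phi,\mathsf u)=(\psi\circ\phi,\psi^+(\mathsf u_\bullet)\mathsf v_\bullet)$; $\mathrm{id}_A$ abbreviates $(\mathrm{id}_A,\mathbf 1)$. A cocycle conjugacy is a cocycle morphism $(\phi,\mathsf u)$ with $\phi$ an isomorphism; its inverse is $(\phi^{-1},\phi^{-1}(\mathsf u_\bullet)^* )$. For cocycle morphisms $(\phi,\mathsf u),(\psi,\mathsf v):(A,\alpha,\mathfrak u)\to(B,\beta,\mathfrak v)$, write $(\psi,\mathsf v)\precapprox_{\mathrm u}(\phi,\mathsf u)$ if there is a net $v_\lambda\in\mathcal U(\mathcal M(B))$ with $v_\lambda\phi(a)v_\lambda^*\to\psi(a)$ for all $a\in A$ and $\max_{g\in K}\|b(\mathsf v_g-v_\lambda\mathsf u_g\beta_g(v_\lambda)^* )\|\to0$ for all $b\in B$ and compact $K\subseteq G$. *)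

theory Defs
  imports "HOL-Analysis.Analysis"
begin

section \<open>C*-algebras\<close>

text \<open>
  A C*-algebra is a complex Banach *-algebra, not necessarily unital (and possibly zero), which
  satisfies the C*-identity. The real scalar multiplication required by the library classes is the
  restriction of the complex one.
\<close>

class cstar_algebra = real_normed_algebra + banach +
  fixes scaleC :: "complex \<Rightarrow> 'a \<Rightarrow> 'a"  (infixr \<open>*\<^sub>C\<close> 75)
    and adj :: "'a \<Rightarrow> 'a"  (\<open>(_\<^sup>\<star>)\<close> [1000] 999)
  assumes scaleC_add_right: "c *\<^sub>C (x + y) = c *\<^sub>C x + c *\<^sub>C y"
    and scaleC_add_left: "(c + d) *\<^sub>C x = c *\<^sub>C x + d *\<^sub>C x"
    and scaleC_scaleC: "c *\<^sub>C (d *\<^sub>C x) = (c * d) *\<^sub>C x"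
    and scaleR_scaleC: "r *\<^sub>R x = complex_of_real r *\<^sub>C x"
    and norm_scaleC: "norm (c *\<^sub>C x) = cmod c * norm x"
    and mult_scaleC_left: "(c *\<^sub>C x) * y = c *\<^sub>C (x * y)"
    and mult_scaleC_right: "x * (c *\<^sub>C y) = c *\<^sub>C (x * y)"
    and adj_adj: "(x\<^sup>\<star>)\<^sup>\<star> = x"
    and adj_add: "(x + y)\<^sup>\<star> = x\<^sup>\<star> + y\<^sup>\<star>"
    and adj_scaleC: "(c *\<^sub>C x)\<^sup>\<star> = cnj c *\<^sub>C x\<^sup>\<star>"
    and adj_mult: "(x * y)\<^sup>\<star> = y\<^sup>\<star> * x\<^sup>\<star>"
    and cstar_identity: "norm (x\<^sup>\<star> * x) = (norm x)\<^sup>2"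

lemma norm_adj: "norm (x\<^sup>\<star>) = norm (x :: 'a::cstar_algebra)"
proof -
  have le: "norm y \<le> norm (y\<^sup>\<star>)" for y :: 'a
  proof (cases "norm y = 0")
    case False
    have "norm y * norm y \<le> norm (y\<^sup>\<star>) * norm y"
      using norm_mult_ineq[of "y\<^sup>\<star>" y] by (simp add: cstar_identity power2_eq_square)
    then show ?thesis using False by (simp add: mult_le_cancel_right)
  qed simp
  show ?thesis using le[of x] le[of "x\<^sup>\<star>"] by (simp add: adj_adj)
qed

lemma cstar_identity': "norm (x * x\<^sup>\<star>) = (norm (x :: 'a::cstar_algebra))\<^sup>2"
  using cstar_identity[of "x\<^sup>\<star>"] by (simp add: adj_adj norm_adj)

lemma adj_scaleR: "(r *\<^sub>R x)\<^sup>\<star> = r *\<^sub>R (x :: 'a::cstar_algebra)\<^sup>\<star>"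
  by (simp add: scaleR_scaleC adj_scaleC)

lemma bounded_linear_adj: "bounded_linear (adj :: 'a::cstar_algebra \<Rightarrow> 'a)"
  by (rule bounded_linear_intro[where K = 1]) (simp_all add: adj_add adj_scaleR norm_adj)

lemma bounded_linear_scaleC: "bounded_linear (\<lambda>x :: 'a::cstar_algebra. c *\<^sub>C x)"
  by (rule bounded_linear_intro[where K = "cmod c"])
     (simp_all add: scaleC_add_right scaleR_scaleC scaleC_scaleC norm_scaleC mult.commute)

lemma scaleC_one: "1 *\<^sub>C x = (x :: 'a::cstar_algebra)"
  using scaleR_scaleC[of 1 x] by simp

lemma scaleC_zero_right: "c *\<^sub>C 0 = (0 :: 'a::cstar_algebra)"
  using bounded_linear_scaleC[THEN bounded_linear.linear, THEN linear_0, of c] .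

lemma scaleC_minus_right: "c *\<^sub>C (- x) = - (c *\<^sub>C (x :: 'a::cstar_algebra))"
  using bounded_linear_scaleC[THEN bounded_linear.linear, THEN linear_neg, of c x] .

lemma scaleC_diff_right: "c *\<^sub>C (x - y) = c *\<^sub>C x - c *\<^sub>C (y :: 'a::cstar_algebra)"
  using bounded_linear_scaleC[THEN bounded_linear.linear, THEN linear_diff, of c x y] .

definition bounded_clinear :: "('a::cstar_algebra \<Rightarrow> 'b::cstar_algebra) \<Rightarrow> bool" where
  "bounded_clinear f \<longleftrightarrow> bounded_linear f \<and> (\<forall>c x. f (c *\<^sub>C x) = c *\<^sub>C f x)"

definition star_hom :: "('a::cstar_algebra \<Rightarrow> 'b::cstar_algebra) \<Rightarrow> bool" where
  "star_hom f \<longleftrightarrow>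
     (\<forall>x y. f (x + y) = f x + f y) \<and> (\<forall>c x. f (c *\<^sub>C x) = c *\<^sub>C f x) \<and>
     (\<forall>x y. f (x * y) = f x * f y) \<and> (\<forall>x. f (x\<^sup>\<star>) = (f x)\<^sup>\<star>)"

definition star_iso :: "('a::cstar_algebra \<Rightarrow> 'b::cstar_algebra) \<Rightarrow> bool" where
  "star_iso f \<longleftrightarrow> star_hom f \<and> bij f"

definition projection :: "'a::cstar_algebra \<Rightarrow> bool" where
  "projection p \<longleftrightarrow> p\<^sup>\<star> = p \<and> p * p = p"

definition unitary :: "'a::{cstar_algebra, monoid_mult} \<Rightarrow> bool" where
  "unitary u \<longleftrightarrow> u\<^sup>\<star> * u = 1 \<and> u * u\<^sup>\<star> = 1"

definition Ad :: "'a::cstar_algebra \<Rightarrow> 'a \<Rightarrow> 'a" where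
  "Ad u x = u * x * u\<^sup>\<star>"

definition positive :: "'a::cstar_algebra \<Rightarrow> bool" where
  "positive a \<longleftrightarrow> (\<exists>x. a = x\<^sup>\<star> * x)"

definition cstar_le :: "'a::cstar_algebra \<Rightarrow> 'a \<Rightarrow> bool"  (infix \<open>\<sqsubseteq>\<close> 50) where
  "a \<sqsubseteq> b \<longleftrightarrow> positive (b - a)"

text \<open>
  An increasing net of positive contractions is represented by its range, an upward directed set
  indexed by itself. This loses nothing: by monotonicity, the original net is an approximate unit
  iff its range is. Likewise, if the images of all upward directed approximate units under some
  map converge, then so do the images of all increasing nets that are approximate units, since
  such a net is cofinal in its range.
\<close>

definition tail_filter :: "'a::cstar_algebra set \<Rightarrow> 'a filter" where
  "tail_filter E = (INF x\<in>E. principal {y \<in> E. x \<sqsubseteq> y})"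

definition increasing_approx_unit :: "'a::cstar_algebra set \<Rightarrow> bool" where
  "increasing_approx_unit E \<longleftrightarrow>
     E \<noteq> {} \<and> (\<forall>e\<in>E. positive e \<and> norm e \<le> 1) \<and>
     (\<forall>x\<in>E. \<forall>y\<in>E. \<exists>z\<in>E. x \<sqsubseteq> z \<and> y \<sqsubseteq> z) \<and>
     (\<forall>a. ((\<lambda>e. e * a) \<longlongrightarrow> a) (tail_filter E) \<and> ((\<lambda>e. a * e) \<longlongrightarrow> a) (tail_filter E))"


section \<open>The multiplier algebra\<close>

text \<open>
  Multipliers are double centralizers \<open>(L, R)\<close>, where \<open>L\<close> and \<open>R\<close> are left and right multiplication
  by the multiplier.
\<close>

definition double_centralizers :: "(('a::cstar_algebra \<Rightarrow> 'a) \<times> ('a \<Rightarrow> 'a)) set" where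
  "double_centralizers = {(L, R). bounded_clinear L \<and> bounded_clinear R \<and>
     (\<forall>a b. L (a * b) = L a * b) \<and> (\<forall>a b. R (a * b) = a * R b) \<and>
     (\<forall>a b. R a * b = a * L b)}"

typedef (overloaded) 'a multiplier = "double_centralizers :: (('a::cstar_algebra \<Rightarrow> 'a) \<times> _) set"
  by (rule exI[of _ "(\<lambda>_. 0, \<lambda>_. 0)"])
     (auto simp: double_centralizers_def bounded_clinear_def bounded_linear_zero
        scaleC_zero_right)

setup_lifting type_definition_multiplier

lift_definition lmul :: "'a::cstar_algebra multiplier \<Rightarrow> 'a \<Rightarrow> 'a" is fst .
lift_definition rmul :: "'a::cstar_algebra multiplier \<Rightarrow> 'a \<Rightarrow> 'a" is snd .

lemma multiplier_eqI: "lmul m = lmul n \<Longrightarrow> rmul m = rmul n \<Longrightarrow> m = n"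
  by transfer (simp add: prod_eq_iff)

lemma bounded_clinear_lmul: "bounded_clinear (lmul m)"
  by transfer (auto simp: double_centralizers_def)

lemma bounded_clinear_rmul: "bounded_clinear (rmul m)"
  by transfer (auto simp: double_centralizers_def)

lemma bounded_linear_lmul: "bounded_linear (lmul m)"
  and lmul_scaleC: "lmul m (c *\<^sub>C a) = c *\<^sub>C lmul m a"
  using bounded_clinear_lmul[of m] by (auto simp: bounded_clinear_def)

lemma bounded_linear_rmul: "bounded_linear (rmul m)"
  and rmul_scaleC: "rmul m (c *\<^sub>C a) = c *\<^sub>C rmul m a"
  using bounded_clinear_rmul[of m] by (auto simp: bounded_clinear_def)

lemma lmul_mult: "lmul m (a * b) = lmul m a * b"
  by transfer (auto simp: double_centralizers_def)

lemma rmul_mult: "rmul m (a * b) = a * rmul m b"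
  by transfer (auto simp: double_centralizers_def)

lemma rmul_lmul: "rmul m a * b = a * lmul m b"
  by transfer (auto simp: double_centralizers_def)

lemma lmul_Abs: "(L, R) \<in> double_centralizers \<Longrightarrow> lmul (Abs_multiplier (L, R)) = L"
  by (simp add: lmul.rep_eq Abs_multiplier_inverse)

lemma rmul_Abs: "(L, R) \<in> double_centralizers \<Longrightarrow> rmul (Abs_multiplier (L, R)) = R"
  by (simp add: rmul.rep_eq Abs_multiplier_inverse)

lemma onorm_lmul_eq_rmul: "onorm (lmul m) = onorm (rmul m)"
proof (rule antisym; rule onorm_bound)
  fix a
  show "norm (lmul m a) \<le> onorm (rmul m) * norm a"
  proof (cases "norm (lmul m a) = 0")
    case True
    then show ?thesis by (simp add: onorm_pos_le[OF bounded_linear_rmul])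
  next
    case False
    have "norm (lmul m a) * norm (lmul m a) = norm (rmul m ((lmul m a)\<^sup>\<star>) * a)"
      by (simp add: rmul_lmul cstar_identity power2_eq_square)
    also have "\<dots> \<le> norm (rmul m ((lmul m a)\<^sup>\<star>)) * norm a"
      by (rule norm_mult_ineq)
    also have "\<dots> \<le> (onorm (rmul m) * norm (lmul m a)) * norm a"
      using onorm[OF bounded_linear_rmul, of m "(lmul m a)\<^sup>\<star>"]
      by (intro mult_right_mono) (simp_all add: norm_adj)
    finally have "norm (lmul m a) * norm (lmul m a) \<le> (onorm (rmul m) * norm a) * norm (lmul m a)"
      by (simp add: ac_simps)
    then show ?thesis using False by (simp add: mult_le_cancel_right)
  qed
  show "norm (rmul m a) \<le> onorm (lmul m) * norm a"
  proof (cases "norm (rmul m a) = 0")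
    case True
    then show ?thesis by (simp add: onorm_pos_le[OF bounded_linear_lmul])
  next
    case False
    have "norm (rmul m a) * norm (rmul m a) = norm (a * lmul m ((rmul m a)\<^sup>\<star>))"
      by (simp add: rmul_lmul[symmetric] cstar_identity' power2_eq_square)
    also have "\<dots> \<le> norm a * norm (lmul m ((rmul m a)\<^sup>\<star>))"
      by (rule norm_mult_ineq)
    also have "\<dots> \<le> norm a * (onorm (lmul m) * norm (rmul m a))"
      using onorm[OF bounded_linear_lmul, of m "(rmul m a)\<^sup>\<star>"]
      by (intro mult_left_mono) (simp_all add: norm_adj)
    finally have "norm (rmul m a) * norm (rmul m a) \<le> (onorm (lmul m) * norm a) * norm (rmul m a)"
      by (simp add: ac_simps)
    then show ?thesis using False by (simp add: mult_le_cancel_right)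
  qed
qed (simp_all add: onorm_pos_le bounded_linear_lmul bounded_linear_rmul)

instantiation multiplier :: (cstar_algebra)
  "{zero, one, plus, minus, uminus, times, scaleR, norm, dist, sgn, uniformity, open}"
begin

lift_definition zero_multiplier :: "'a multiplier" is "(\<lambda>_. 0, \<lambda>_. 0)"
  by (auto simp: double_centralizers_def bounded_clinear_def bounded_linear_zero
        scaleC_zero_right)

lift_definition one_multiplier :: "'a multiplier" is "(\<lambda>a. a, \<lambda>a. a)"
  by (auto simp: double_centralizers_def bounded_clinear_def bounded_linear_ident)

lift_definition plus_multiplier :: "'a multiplier \<Rightarrow> 'a multiplier \<Rightarrow> 'a multiplier"
  is "\<lambda>(L, R) (L', R'). (\<lambda>a. L a + L' a, \<lambda>a. R a + R' a)"
  by (auto simp: double_centralizers_def bounded_clinear_def scaleC_add_right algebra_simps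
        intro: bounded_linear_add)

lift_definition minus_multiplier :: "'a multiplier \<Rightarrow> 'a multiplier \<Rightarrow> 'a multiplier"
  is "\<lambda>(L, R) (L', R'). (\<lambda>a. L a - L' a, \<lambda>a. R a - R' a)"
  by (auto simp: double_centralizers_def bounded_clinear_def algebra_simps
        scaleC_diff_right intro: bounded_linear_sub)

lift_definition uminus_multiplier :: "'a multiplier \<Rightarrow> 'a multiplier"
  is "\<lambda>(L, R). (\<lambda>a. - L a, \<lambda>a. - R a)"
  by (auto simp: double_centralizers_def bounded_clinear_def
        scaleC_minus_right intro: bounded_linear_minus)

lift_definition times_multiplier :: "'a multiplier \<Rightarrow> 'a multiplier \<Rightarrow> 'a multiplier"
  is "\<lambda>(L, R) (L', R'). (\<lambda>a. L (L' a), \<lambda>a. R' (R a))"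
  by (auto simp: double_centralizers_def bounded_clinear_def intro: bounded_linear_compose)

lift_definition scaleR_multiplier :: "real \<Rightarrow> 'a multiplier \<Rightarrow> 'a multiplier"
  is "\<lambda>r (L, R). (\<lambda>a. r *\<^sub>R L a, \<lambda>a. r *\<^sub>R R a)"
  by (auto simp: double_centralizers_def bounded_clinear_def scaleR_scaleC scaleC_scaleC
        mult_scaleC_left mult_scaleC_right mult.commute
        intro: bounded_linear_compose[OF bounded_linear_scaleC])

definition "norm m = onorm (lmul m)" for m :: "'a multiplier"
definition "dist m n = norm (m - n)" for m n :: "'a multiplier"
definition "sgn m = scaleR (inverse (norm m)) m" for m :: "'a multiplier"
definition "(uniformity :: ('a multiplier \<times> 'a multiplier) filter) =
  (INF e\<in>{0<..}. principal {(x, y). dist x y < e})"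
definition "open (U :: 'a multiplier set) =
  (\<forall>x\<in>U. eventually (\<lambda>(x', y). x' = x \<longrightarrow> y \<in> U) uniformity)"

instance ..

end

lemma lmul_zero: "lmul 0 = (\<lambda>_. 0)" and rmul_zero: "rmul 0 = (\<lambda>_. 0)"
  by (transfer; simp)+

lemma lmul_one: "lmul 1 = (\<lambda>a. a)" and rmul_one: "rmul 1 = (\<lambda>a. a)"
  by (transfer; simp)+

lemma lmul_plus: "lmul (m + n) = (\<lambda>a. lmul m a + lmul n a)"
  and rmul_plus: "rmul (m + n) = (\<lambda>a. rmul m a + rmul n a)"
  by (transfer; simp add: case_prod_beta)+

lemma lmul_minus: "lmul (m - n) = (\<lambda>a. lmul m a - lmul n a)"
  and rmul_minus: "rmul (m - n) = (\<lambda>a. rmul m a - rmul n a)"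
  by (transfer; simp add: case_prod_beta)+

lemma lmul_uminus: "lmul (- m) = (\<lambda>a. - lmul m a)"
  and rmul_uminus: "rmul (- m) = (\<lambda>a. - rmul m a)"
  by (transfer; simp add: case_prod_beta)+

lemma lmul_times: "lmul (m * n) = (\<lambda>a. lmul m (lmul n a))"
  and rmul_times: "rmul (m * n) = (\<lambda>a. rmul n (rmul m a))"
  by (transfer; simp add: case_prod_beta)+

lemma lmul_scaleR: "lmul (r *\<^sub>R m) = (\<lambda>a. r *\<^sub>R lmul m a)"
  and rmul_scaleR: "rmul (r *\<^sub>R m) = (\<lambda>a. r *\<^sub>R rmul m a)"
  by (transfer; simp add: case_prod_beta)+

lemmas multiplier_ops =
  lmul_zero rmul_zero lmul_one rmul_one lmul_plus rmul_plus lmul_minus rmul_minus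
  lmul_uminus rmul_uminus lmul_times rmul_times lmul_scaleR rmul_scaleR

lemmas multiplier_linear =
  bounded_linear_lmul[THEN bounded_linear.linear, THEN linear_add]
  bounded_linear_rmul[THEN bounded_linear.linear, THEN linear_add]
  bounded_linear_lmul[THEN bounded_linear.linear, THEN linear_scale]
  bounded_linear_rmul[THEN bounded_linear.linear, THEN linear_scale]

lemma onorm_multiplier:
  fixes m n :: "'a::cstar_algebra multiplier" and r :: real
  shows "onorm (lmul m) = 0 \<longleftrightarrow> m = 0"
    and "onorm (lmul (m + n)) \<le> onorm (lmul m) + onorm (lmul n)"
    and "onorm (lmul (r *\<^sub>R m)) = \<bar>r\<bar> * onorm (lmul m)"
    and "onorm (lmul (m * n)) \<le> onorm (lmul m) * onorm (lmul n)"
proof -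
  show "onorm (lmul m) = 0 \<longleftrightarrow> m = 0"
  proof
    assume "onorm (lmul m) = 0"
    then have "onorm (lmul m) = 0" "onorm (rmul m) = 0"
      by (simp_all add: onorm_lmul_eq_rmul)
    then show "m = 0"
      by (intro multiplier_eqI)
         (simp_all add: fun_eq_iff multiplier_ops onorm_eq_0 bounded_linear_lmul bounded_linear_rmul)
  qed (simp add: lmul_zero onorm_zero)
  show "onorm (lmul (m + n)) \<le> onorm (lmul m) + onorm (lmul n)"
    by (simp add: lmul_plus onorm_triangle bounded_linear_lmul)
  show "onorm (lmul (r *\<^sub>R m)) = \<bar>r\<bar> * onorm (lmul m)"
    by (simp add: lmul_scaleR onorm_scaleR bounded_linear_lmul)
  show "onorm (lmul (m * n)) \<le> onorm (lmul m) * onorm (lmul n)"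
    using onorm_compose[OF bounded_linear_lmul bounded_linear_lmul, of m n]
    by (simp add: lmul_times comp_def)
qed

instance multiplier :: (cstar_algebra) real_normed_algebra
proof
  fix m n k :: "'a multiplier" and r s :: real
  show "m + n + k = m + (n + k)" "m + n = n + m" "0 + m = m" "- m + m = 0" "m - n = m + - n"
    by (rule multiplier_eqI; simp add: multiplier_ops fun_eq_iff ac_simps)+
  show "r *\<^sub>R (m + n) = r *\<^sub>R m + r *\<^sub>R n" "(r + s) *\<^sub>R m = r *\<^sub>R m + s *\<^sub>R m"
    "r *\<^sub>R s *\<^sub>R m = (r * s) *\<^sub>R m" "1 *\<^sub>R m = m"
    by (rule multiplier_eqI; simp add: multiplier_ops fun_eq_iff algebra_simps)+
  show "m * n * k = m * (n * k)" "(m + n) * k = m * k + n * k" "m * (n + k) = m * n + m * k"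
    "r *\<^sub>R m * n = r *\<^sub>R (m * n)" "m * r *\<^sub>R n = r *\<^sub>R (m * n)"
    by (rule multiplier_eqI; simp add: multiplier_ops multiplier_linear)+
qed ((rule dist_multiplier_def sgn_multiplier_def uniformity_multiplier_def open_multiplier_def) |
     rule onorm_multiplier | (unfold norm_multiplier_def, rule onorm_multiplier))+

instance multiplier :: (cstar_algebra) monoid_mult
  by intro_classes (rule multiplier_eqI; simp add: multiplier_ops)+

lemma norm_lmul: "norm (lmul m a) \<le> norm m * norm a"
  unfolding norm_multiplier_def by (rule onorm[OF bounded_linear_lmul])

lemma norm_rmul: "norm (rmul m a) \<le> norm m * norm a"
  unfolding norm_multiplier_def onorm_lmul_eq_rmul by (rule onorm[OF bounded_linear_rmul])

instance multiplier :: (cstar_algebra) banach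
proof
  fix X :: "nat \<Rightarrow> 'a multiplier"
  assume X: "Cauchy X"
  define LX where "LX n = Blinfun (lmul (X n))" for n
  define RX where "RX n = Blinfun (rmul (X n))" for n
  have LX: "blinfun_apply (LX n) = lmul (X n)" and RX: "blinfun_apply (RX n) = rmul (X n)" for n
    by (simp_all add: LX_def RX_def bounded_linear_Blinfun_apply bounded_linear_lmul bounded_linear_rmul)
  have dL: "dist (LX i) (LX j) = dist (X i) (X j)" for i j
    by (simp add: dist_norm norm_blinfun.rep_eq LX norm_multiplier_def lmul_minus
        minus_blinfun.rep_eq)
  have dR: "dist (RX i) (RX j) = dist (X i) (X j)" for i j
    by (simp add: dist_norm norm_blinfun.rep_eq RX norm_multiplier_def onorm_lmul_eq_rmul
        rmul_minus minus_blinfun.rep_eq)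
  have "Cauchy LX" "Cauchy RX"
    using X by (simp_all add: Cauchy_def dL dR)
  then obtain l r where l: "LX \<longlonglongrightarrow> l" and r: "RX \<longlonglongrightarrow> r"
    by (meson Cauchy_convergent_iff convergent_def)
  have tl: "(\<lambda>n. lmul (X n) a) \<longlonglongrightarrow> blinfun_apply l a" for a
    using blinfun.tendsto[OF l tendsto_const, of a] by (simp add: LX)
  have tr: "(\<lambda>n. rmul (X n) a) \<longlonglongrightarrow> blinfun_apply r a" for a
    using blinfun.tendsto[OF r tendsto_const, of a] by (simp add: RX)
  note scl = bounded_linear.tendsto[OF bounded_linear_scaleC]
  have "blinfun_apply l (c *\<^sub>C a) = c *\<^sub>C blinfun_apply l a" for c a
    by (rule LIMSEQ_unique[OF tl]) (simp add: lmul_scaleC scl[OF tl])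
  moreover have "blinfun_apply r (c *\<^sub>C a) = c *\<^sub>C blinfun_apply r a" for c a
    by (rule LIMSEQ_unique[OF tr]) (simp add: rmul_scaleC scl[OF tr])
  moreover have "blinfun_apply l (a * b) = blinfun_apply l a * b" for a b
    by (rule LIMSEQ_unique[OF tl]) (auto simp: lmul_mult intro!: tendsto_intros tl)
  moreover have "blinfun_apply r (a * b) = a * blinfun_apply r b" for a b
    by (rule LIMSEQ_unique[OF tr]) (auto simp: rmul_mult intro!: tendsto_intros tr)
  moreover have "blinfun_apply r a * b = a * blinfun_apply l b" for a b
  proof (rule LIMSEQ_unique)
    show "(\<lambda>n. rmul (X n) a * b) \<longlonglongrightarrow> blinfun_apply r a * b"
      by (intro tendsto_intros tr)
    show "(\<lambda>n. rmul (X n) a * b) \<longlonglongrightarrow> a * blinfun_apply l b"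
      unfolding rmul_lmul by (intro tendsto_intros tl)
  qed
  ultimately have "(blinfun_apply l, blinfun_apply r) \<in> double_centralizers"
    by (simp add: double_centralizers_def bounded_clinear_def blinfun.bounded_linear_right)
  then obtain m where m: "lmul m = blinfun_apply l"
    using lmul_Abs by blast
  have "dist (X n) m = dist (LX n) l" for n
    by (simp add: dist_norm norm_blinfun.rep_eq LX norm_multiplier_def lmul_minus m minus_blinfun.rep_eq)
  then have "X \<longlonglongrightarrow> m"
    using l by (simp add: tendsto_dist_iff[of X] tendsto_dist_iff[of LX])
  then show "convergent X"
    by (auto simp: convergent_def)
qed

instantiation multiplier :: (cstar_algebra) cstar_algebra
begin

lift_definition scaleC_multiplier :: "complex \<Rightarrow> 'a multiplier \<Rightarrow> 'a multiplier"
  is "\<lambda>c (L, R). (\<lambda>a. c *\<^sub>C L a, \<lambda>a. c *\<^sub>C R a)"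
  by (auto simp: double_centralizers_def bounded_clinear_def scaleC_scaleC
        mult_scaleC_left mult_scaleC_right mult.commute
        intro: bounded_linear_compose[OF bounded_linear_scaleC])

lift_definition adj_multiplier :: "'a multiplier \<Rightarrow> 'a multiplier"
  is "\<lambda>(L, R). (\<lambda>a. (R (a\<^sup>\<star>))\<^sup>\<star>, \<lambda>a. (L (a\<^sup>\<star>))\<^sup>\<star>)"
proof (clarsimp simp: double_centralizers_def bounded_clinear_def, intro conjI allI)
  fix L R :: "'a \<Rightarrow> 'a" and a b :: 'a and c
  assume *: "\<forall>a b. L (a * b) = L a * b" "\<forall>a b. R (a * b) = a * R b" "\<forall>a b. R a * b = a * L b"
    "\<forall>c x. L (c *\<^sub>C x) = c *\<^sub>C L x" "\<forall>c x. R (c *\<^sub>C x) = c *\<^sub>C R x"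
    "bounded_linear L" "bounded_linear R"
  show "bounded_linear (\<lambda>a. (R (a\<^sup>\<star>))\<^sup>\<star>)" "bounded_linear (\<lambda>a. (L (a\<^sup>\<star>))\<^sup>\<star>)"
    using * by (intro bounded_linear_compose[OF bounded_linear_adj]
        bounded_linear_compose[OF _ bounded_linear_adj]; simp)+
  show "(R ((c *\<^sub>C a)\<^sup>\<star>))\<^sup>\<star> = c *\<^sub>C (R (a\<^sup>\<star>))\<^sup>\<star>" "(L ((c *\<^sub>C a)\<^sup>\<star>))\<^sup>\<star> = c *\<^sub>C (L (a\<^sup>\<star>))\<^sup>\<star>"
    using * by (simp_all add: adj_scaleC)
  show "(R ((a * b)\<^sup>\<star>))\<^sup>\<star> = (R (a\<^sup>\<star>))\<^sup>\<star> * b" "(L ((a * b)\<^sup>\<star>))\<^sup>\<star> = a * (L (b\<^sup>\<star>))\<^sup>\<star>"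
    using * by (simp_all add: adj_mult adj_adj)
  have "((L (a\<^sup>\<star>))\<^sup>\<star> * b) = (b\<^sup>\<star> * L (a\<^sup>\<star>))\<^sup>\<star>"
    by (simp add: adj_mult adj_adj)
  also have "\<dots> = (R (b\<^sup>\<star>) * a\<^sup>\<star>)\<^sup>\<star>"
    using * by simp
  also have "\<dots> = a * (R (b\<^sup>\<star>))\<^sup>\<star>"
    by (simp add: adj_mult adj_adj)
  finally show "(L (a\<^sup>\<star>))\<^sup>\<star> * b = a * (R (b\<^sup>\<star>))\<^sup>\<star>" .
qed

lemma lmul_scaleC': "lmul (c *\<^sub>C m) = (\<lambda>a. c *\<^sub>C lmul m a)"
  and rmul_scaleC': "rmul (c *\<^sub>C m) = (\<lambda>a. c *\<^sub>C rmul m a)"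
  by (transfer; simp add: case_prod_beta)+

lemma lmul_adj: "lmul (m\<^sup>\<star>) = (\<lambda>a. (rmul m (a\<^sup>\<star>))\<^sup>\<star>)"
  and rmul_adj: "rmul (m\<^sup>\<star>) = (\<lambda>a. (lmul m (a\<^sup>\<star>))\<^sup>\<star>)"
  by (transfer; simp add: case_prod_beta)+

instance
proof
  fix c d :: complex and r :: real and m n :: "'a multiplier"
  show "c *\<^sub>C (m + n) = c *\<^sub>C m + c *\<^sub>C n" "(c + d) *\<^sub>C m = c *\<^sub>C m + d *\<^sub>C m"
    "c *\<^sub>C d *\<^sub>C m = (c * d) *\<^sub>C m" "r *\<^sub>R m = complex_of_real r *\<^sub>C m"
    "(c *\<^sub>C m) * n = c *\<^sub>C (m * n)" "m * (c *\<^sub>C n) = c *\<^sub>C (m * n)"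
    by (rule multiplier_eqI; simp add: multiplier_ops lmul_scaleC' rmul_scaleC' scaleC_add_right
        scaleC_add_left scaleC_scaleC scaleR_scaleC lmul_scaleC rmul_scaleC)+
  show "(m\<^sup>\<star>)\<^sup>\<star> = m" "(m + n)\<^sup>\<star> = m\<^sup>\<star> + n\<^sup>\<star>" "(c *\<^sub>C m)\<^sup>\<star> = cnj c *\<^sub>C m\<^sup>\<star>" "(m * n)\<^sup>\<star> = n\<^sup>\<star> * m\<^sup>\<star>"
    by (rule multiplier_eqI; simp add: multiplier_ops lmul_scaleC' rmul_scaleC' lmul_adj rmul_adj
        adj_adj adj_add adj_scaleC)+
  have le: "norm (c *\<^sub>C m) \<le> cmod c * norm m" for c and m :: "'a multiplier"
    unfolding norm_multiplier_def[of "c *\<^sub>C m"] lmul_scaleC'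
    by (rule onorm_bound) (simp_all add: norm_scaleC mult.assoc mult_left_mono norm_lmul)
  show "norm (c *\<^sub>C m) = cmod c * norm m"
  proof (cases "c = 0")
    case True
    then show ?thesis using le[of 0 m] by simp
  next
    case False
    have "inverse c *\<^sub>C c *\<^sub>C m = m"
      using False
      by (intro multiplier_eqI; simp add: lmul_scaleC' rmul_scaleC' scaleC_scaleC scaleC_one)
    then have "norm m \<le> norm (c *\<^sub>C m) / cmod c"
      using le[of "inverse c" "c *\<^sub>C m"] by (simp add: norm_inverse divide_inverse mult.commute)
    then show ?thesis using le[of c m] False by (simp add: field_simps)
  qed
  have adj_le: "norm (m\<^sup>\<star>) \<le> norm m" for m :: "'a multiplier"
    unfolding norm_multiplier_def[of "m\<^sup>\<star>"] lmul_adj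
    by (rule onorm_bound) (simp_all add: norm_adj norm_rmul[THEN order_trans])
  show "norm (m\<^sup>\<star> * m) = (norm m)\<^sup>2"
  proof (rule antisym)
    show "norm (m\<^sup>\<star> * m) \<le> (norm m)\<^sup>2"
      using norm_mult_ineq[of "m\<^sup>\<star>" m] mult_right_mono[OF adj_le[of m], of "norm m"]
      by (simp add: power2_eq_square)
    have "norm (lmul m a) \<le> sqrt (norm (m\<^sup>\<star> * m)) * norm a" for a
    proof (rule power2_le_imp_le)
      have "(norm (lmul m a))\<^sup>2 = norm ((lmul (m\<^sup>\<star> * m) a)\<^sup>\<star> * a)"
        by (simp add: lmul_times lmul_adj adj_adj rmul_lmul cstar_identity)
      also have "\<dots> \<le> norm (lmul (m\<^sup>\<star> * m) a) * norm a"
        using norm_mult_ineq[of "(lmul (m\<^sup>\<star> * m) a)\<^sup>\<star>" a] by (simp add: norm_adj)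
      also have "\<dots> \<le> (norm (m\<^sup>\<star> * m) * norm a) * norm a"
        by (intro mult_right_mono norm_lmul) simp
      finally show "(norm (lmul m a))\<^sup>2 \<le> (sqrt (norm (m\<^sup>\<star> * m)) * norm a)\<^sup>2"
        unfolding power_mult_distrib by (simp add: power2_eq_square mult.assoc)
    qed simp
    then have "norm m \<le> sqrt (norm (m\<^sup>\<star> * m))"
      unfolding norm_multiplier_def[of m] by (intro onorm_bound) simp_all
    then show "(norm m)\<^sup>2 \<le> norm (m\<^sup>\<star> * m)"
      using real_le_rsqrt real_sqrt_le_iff by (metis norm_ge_zero power_mono real_sqrt_pow2)
  qed
qed

end

lift_definition mult_of :: "'a::cstar_algebra \<Rightarrow> 'a multiplier" is "\<lambda>a. (\<lambda>b. a * b, \<lambda>b. b * a)"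
  by (auto simp: double_centralizers_def bounded_clinear_def mult.assoc mult_scaleC_left
        mult_scaleC_right bounded_linear_mult_left bounded_linear_mult_right)

lemma lmul_mult_of: "lmul (mult_of a) = (\<lambda>b. a * b)" and rmul_mult_of: "rmul (mult_of a) = (\<lambda>b. b * a)"
  by (transfer; simp)+

lemma mult_mult_of: "m * mult_of a = mult_of (lmul m a)"
  by (rule multiplier_eqI) (simp_all add: multiplier_ops lmul_mult_of rmul_mult_of lmul_mult rmul_lmul)

lemma mult_of_mult: "mult_of a * m = mult_of (rmul m a)"
  by (rule multiplier_eqI) (simp_all add: multiplier_ops lmul_mult_of rmul_mult_of rmul_mult rmul_lmul)

lemma star_hom_mult_of: "star_hom (mult_of :: 'a::cstar_algebra \<Rightarrow> 'a multiplier)"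
  unfolding star_hom_def
  by (intro conjI allI multiplier_eqI)
     (simp_all add: multiplier_ops lmul_scaleC' rmul_scaleC' lmul_adj rmul_adj lmul_mult_of rmul_mult_of
        algebra_simps mult_scaleC_left mult_scaleC_right adj_mult adj_adj)

lemma norm_mult_of: "norm (mult_of a) = norm (a :: 'a::cstar_algebra)"
proof (rule antisym)
  show "norm (mult_of a) \<le> norm a"
    unfolding norm_multiplier_def lmul_mult_of by (rule onorm_bound) (simp_all add: norm_mult_ineq)
  show "norm a \<le> norm (mult_of a)"
    using norm_lmul[of "mult_of a" "a\<^sup>\<star>"]
    by (cases "a = 0") (simp_all add: lmul_mult_of cstar_identity' norm_adj power2_eq_square)
qed

text \<open>
  The strict topology is the initial topology for the maps \<open>m \<mapsto> m * mult_of a\<close> and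
  \<open>m \<mapsto> mult_of a * m\<close>: the topology on the function type below is that of pointwise convergence.
\<close>

definition strict_topology :: "'a::cstar_algebra multiplier topology" where
  "strict_topology = pullback_topology UNIV
     (\<lambda>m. (\<lambda>a :: 'a. m * mult_of a, \<lambda>a :: 'a. mult_of a * m)) euclidean"

lemma topspace_strict: "topspace strict_topology = UNIV"
  by (simp add: strict_topology_def topspace_pullback_topology)

lemma tendsto_fun_iff:
  fixes f :: "'i \<Rightarrow> 'b \<Rightarrow> 'c::topological_space"
  shows "(f \<longlongrightarrow> l) F \<longleftrightarrow> (\<forall>a. ((\<lambda>x. f x a) \<longlongrightarrow> l a) F)"
  using limitin_componentwise[of "\<lambda>_. euclidean :: 'c topology" UNIV f l F]
  by (simp add: euclidean_product_topology)

lemma limitin_strict_iff: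
  "limitin strict_topology f m F \<longleftrightarrow>
     (\<forall>a. ((\<lambda>x. f x * mult_of a) \<longlongrightarrow> m * mult_of a) F) \<and>
     (\<forall>a. ((\<lambda>x. mult_of a * f x) \<longlongrightarrow> mult_of a * m) F)"
proof -
  define h where "h = (\<lambda>m :: 'a multiplier. (\<lambda>a :: 'a. m * mult_of a, \<lambda>a :: 'a. mult_of a * m))"
  have "limitin strict_topology f m F \<longleftrightarrow> ((\<lambda>x. h (f x)) \<longlongrightarrow> h m) F"
    unfolding limitin_def topspace_strict tendsto_def
    by (auto simp: strict_topology_def openin_pullback_topology h_def)
  also have "\<dots> \<longleftrightarrow> ((\<lambda>x. fst (h (f x))) \<longlongrightarrow> fst (h m)) F \<and> ((\<lambda>x. snd (h (f x))) \<longlongrightarrow> snd (h m)) F"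
    using tendsto_Pair[of "\<lambda>x. fst (h (f x))" "fst (h m)" F "\<lambda>x. snd (h (f x))" "snd (h m)"]
    by (auto intro: tendsto_fst tendsto_snd)
  also have "\<dots> \<longleftrightarrow> (\<forall>a. ((\<lambda>x. f x * mult_of a) \<longlongrightarrow> m * mult_of a) F) \<and>
      (\<forall>a. ((\<lambda>x. mult_of a * f x) \<longlongrightarrow> mult_of a * m) F)"
    by (simp add: h_def tendsto_fun_iff)
  finally show ?thesis .
qed

text \<open>The canonical extension of a *-isomorphism to multipliers, transporting double centralizers.\<close>

definition iso_ext :: "('a::cstar_algebra \<Rightarrow> 'b::cstar_algebra) \<Rightarrow> 'a multiplier \<Rightarrow> 'b multiplier" where
  "iso_ext f m = Abs_multiplier (f \<circ> lmul m \<circ> inv f, f \<circ> rmul m \<circ> inv f)"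


section \<open>Extendible homomorphisms\<close>

definition extendible :: "('a::cstar_algebra \<Rightarrow> 'b::cstar_algebra multiplier) \<Rightarrow> bool" where
  "extendible f \<longleftrightarrow> (\<forall>E. increasing_approx_unit E \<longrightarrow>
     (\<exists>p. projection p \<and> limitin strict_topology f p (tail_filter E)))"

text \<open>
  For extendible \<open>f\<close>, the strict limit \<open>p\<close> below does not depend on the approximate unit; it is
  \<open>unit_limit f\<close>. Then \<open>multiplier_ext f\<close> is the unique unital extension \<open>f\<^sub>p : M(A) \<rightarrow> p M(B) p\<close> which is
  strictly continuous on the unit ball, and \<open>unitary_ext f\<close> is \<open>f\<^sup>+\<close>.
\<close>

definition unit_limit :: "('a::cstar_algebra \<Rightarrow> 'b::cstar_algebra multiplier) \<Rightarrow> 'b multiplier" where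
  "unit_limit f = (THE p. projection p \<and>
     (\<forall>E. increasing_approx_unit E \<longrightarrow> limitin strict_topology f p (tail_filter E)))"

definition multiplier_ext ::
  "('a::cstar_algebra \<Rightarrow> 'b::cstar_algebra multiplier) \<Rightarrow> 'a multiplier \<Rightarrow> 'b multiplier" where
  "multiplier_ext f = (THE F. star_hom F \<and>
     (\<forall>m. unit_limit f * F m * unit_limit f = F m) \<and> F 1 = unit_limit f \<and>
     (\<forall>a. F (mult_of a) = f a) \<and>
     continuous_map (subtopology strict_topology (cball 0 1)) strict_topology F)"

definition unitary_ext ::
  "('a::cstar_algebra \<Rightarrow> 'b::cstar_algebra multiplier) \<Rightarrow> 'a multiplier \<Rightarrow> 'b multiplier" where
  "unitary_ext f u = multiplier_ext f u + (1 - unit_limit f)"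


section \<open>Twisted actions and cocycle morphisms\<close>

text \<open>
  The acting group is written additively, following the library class \<open>topological_group_add\<close>;
  it need not be commutative.
\<close>

definition twisted_action ::
  "('g::topological_group_add \<Rightarrow> 'a::cstar_algebra \<Rightarrow> 'a) \<Rightarrow> ('g \<Rightarrow> 'g \<Rightarrow> 'a multiplier) \<Rightarrow> bool" where
  "twisted_action \<alpha> \<uu> \<longleftrightarrow>
     (\<forall>g. star_iso (\<alpha> g)) \<and>
     (\<forall>a. continuous_on UNIV (\<lambda>g. \<alpha> g a)) \<and>
     (\<forall>s t. unitary (\<uu> s t)) \<and>
     continuous_map euclidean strict_topology (\<lambda>(s, t). \<uu> s t) \<and>
     \<alpha> 0 = id \<and>
     (\<forall>s t a. mult_of (\<alpha> s (\<alpha> t a)) = Ad (\<uu> s t) (mult_of (\<alpha> (s + t) a))) \<and>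
     (\<forall>s. \<uu> s 0 = 1 \<and> \<uu> 0 s = 1) \<and>
     (\<forall>r s t. iso_ext (\<alpha> r) (\<uu> s t) * \<uu> r (s + t) = \<uu> r s * \<uu> (r + s) t)"

definition cocycle_morphism ::
  "('g::topological_group_add \<Rightarrow> 'a::cstar_algebra \<Rightarrow> 'a) \<Rightarrow> ('g \<Rightarrow> 'g \<Rightarrow> 'a multiplier) \<Rightarrow>
   ('g \<Rightarrow> 'b::cstar_algebra \<Rightarrow> 'b) \<Rightarrow> ('g \<Rightarrow> 'g \<Rightarrow> 'b multiplier) \<Rightarrow>
   ('a \<Rightarrow> 'b) \<times> ('g \<Rightarrow> 'b multiplier) \<Rightarrow> bool" where
  "cocycle_morphism \<alpha> \<uu> \<beta> \<vv> = (\<lambda>(\<psi>, v).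
     star_hom \<psi> \<and> extendible (mult_of \<circ> \<psi>) \<and>
     (\<forall>g. unitary (v g)) \<and> continuous_map euclidean strict_topology v \<and>
     (\<forall>g a. Ad (v g) (mult_of (\<beta> g (\<psi> a))) = mult_of (\<psi> (\<alpha> g a))) \<and>
     (\<forall>g h. unitary_ext (mult_of \<circ> \<psi>) (\<uu> g h) =
        v g * iso_ext (\<beta> g) (v h) * \<vv> g h * (v (g + h))\<^sup>\<star>))"

definition cocycle_comp ::
  "('b::cstar_algebra \<Rightarrow> 'c::cstar_algebra) \<times> ('g \<Rightarrow> 'c multiplier) \<Rightarrow>
   ('a::cstar_algebra \<Rightarrow> 'b) \<times> ('g \<Rightarrow> 'b multiplier) \<Rightarrow> ('a \<Rightarrow> 'c) \<times> ('g \<Rightarrow> 'c multiplier)"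
   (infixl \<open>\<circ>\<^sub>c\<close> 55) where
  "cocycle_comp = (\<lambda>(\<psi>, v) (\<phi>, u). (\<psi> \<circ> \<phi>, \<lambda>g. unitary_ext (mult_of \<circ> \<psi>) (u g) * v g))"

definition cocycle_id :: "('a::cstar_algebra \<Rightarrow> 'a) \<times> ('g \<Rightarrow> 'a multiplier)" where
  "cocycle_id = (id, \<lambda>_. 1)"

definition cocycle_conjugacy ::
  "('g::topological_group_add \<Rightarrow> 'a::cstar_algebra \<Rightarrow> 'a) \<Rightarrow> ('g \<Rightarrow> 'g \<Rightarrow> 'a multiplier) \<Rightarrow>
   ('g \<Rightarrow> 'b::cstar_algebra \<Rightarrow> 'b) \<Rightarrow> ('g \<Rightarrow> 'g \<Rightarrow> 'b multiplier) \<Rightarrow>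
   ('a \<Rightarrow> 'b) \<times> ('g \<Rightarrow> 'b multiplier) \<Rightarrow> bool" where
  "cocycle_conjugacy \<alpha> \<uu> \<beta> \<vv> X \<longleftrightarrow> cocycle_morphism \<alpha> \<uu> \<beta> \<vv> X \<and> star_iso (fst X)"

definition cocycle_inverse ::
  "('a::cstar_algebra \<Rightarrow> 'b::cstar_algebra) \<times> ('g \<Rightarrow> 'b multiplier) \<Rightarrow>
   ('b \<Rightarrow> 'a) \<times> ('g \<Rightarrow> 'a multiplier)" where
  "cocycle_inverse = (\<lambda>(\<phi>, u). (inv \<phi>, \<lambda>g. (iso_ext (inv \<phi>) (u g))\<^sup>\<star>))"

text \<open>
  \<open>approx_le \<beta> (\<psi>, v) (\<phi>, u)\<close> is the relation written with a curly less-or-approximately-equal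
  sign and subscript u; \<open>\<beta>\<close> is the action on the codomain. The net of unitaries is rendered by a
  proper filter containing the unitary group: a net is pushed forward to the filter it generates,
  and a filter \<open>F\<close> gives the net \<open>(S, w) \<mapsto> w\<close>, where \<open>w \<in> S \<in> F\<close> and \<open>S\<close> consists of unitaries.
  Convergence to 0 of the maximum over a compact set is uniform convergence on that set.
\<close>

definition approx_le ::
  "('g::topological_group_add \<Rightarrow> 'b::cstar_algebra \<Rightarrow> 'b) \<Rightarrow>
   ('a::cstar_algebra \<Rightarrow> 'b) \<times> ('g \<Rightarrow> 'b multiplier) \<Rightarrow>
   ('a \<Rightarrow> 'b) \<times> ('g \<Rightarrow> 'b multiplier) \<Rightarrow> bool" where
  "approx_le \<beta> = (\<lambda>(\<psi>, v) (\<phi>, u). \<exists>F :: 'b multiplier filter.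
     F \<noteq> bot \<and> (\<forall>\<^sub>F w in F. unitary w) \<and>
     (\<forall>a. ((\<lambda>w. w * mult_of (\<phi> a) * w\<^sup>\<star>) \<longlongrightarrow> mult_of (\<psi> a)) F) \<and>
     (\<forall>b K. compact K \<longrightarrow>
        uniform_limit K (\<lambda>w g. mult_of b * (v g - w * u g * (iso_ext (\<beta> g) w)\<^sup>\<star>)) (\<lambda>_. 0) F))"

end

theory Submission
  imports Defs
begin

text \<open>
  A two-sided Elliott intertwining in the category of cocycle morphisms. Perturb \<open>(\<phi>, u)\<close> and
  \<open>(\<psi>, v)\<close> alternately by unitaries \<open>w\<^sub>n\<close> and \<open>z\<^sub>n\<close>. Since \<open>\<psi>\<^sup>+\<close> carries a perturbation of \<open>(\<phi>, u)\<close> by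
  \<open>w\<^sub>n\<close> to a perturbation of the composition, choosing \<open>z\<^sub>n = s\<^sub>n \<psi>\<^sup>+(w\<^sub>n)\<^sup>\<star>\<close> with \<open>s\<^sub>n\<close> far along the net for
  \<open>id\<^sub>A\<close> makes the composition of the perturbed morphisms nearly the identity, and likewise for
  \<open>id\<^sub>B\<close>. Hence consecutive perturbations are close to each other. The homomorphisms converge to
  mutually inverse isomorphisms \<open>\<Phi>\<close>, \<open>\<Psi>\<close>. For the cocycles one first gets convergence of \<open>b u\<^sub>n(g)\<close>;
  convergence of \<open>u\<^sub>n(g) b\<close> follows because the adjoint of each cocycle is asymptotically the image
  of the other one.

  The operator algebra this needs is obtained without spectral theory. A square root of \<open>1 - x\<close> is one minus the limit
  of the iteration \<open>y \<mapsto> (x + y\<^sup>2) / 2\<close>, it writes self-adjoint contractions as averages of two unitaries, which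
  makes *-homomorphisms contractive, and it yields positive square roots and approximate units.
\<close>

section \<open>Square roots and contractivity of *-homomorphisms\<close>

text \<open>The values of \<open>unit_limit\<close> and \<open>multiplier_ext\<close> are definite
  descriptions, and \<open>extendible\<close> speaks only about increasing approximate units. To
  compute with the extension of a homomorphism to multipliers one must therefore first exhibit such
  an approximate unit of the domain, increasing for the order whose positive elements have the form
  \<open>x\<^sup>\<star> * x\<close>. This is what the theory of positivity is for, including
  antisymmetry of that order.

  The relation \<open>approx_le\<close> controls a cocycle only after multiplication by an element
  from the left, that is, through \<open>rmul\<close>. Estimates are therefore made for
  \<open>rmul\<close>. If the limit is known to be a unitary multiplier, the other side follows from
  isometry; it is the existence of the limit that forces the two cocycles to be treated together.

  The step estimates compare consecutive cocycles on moving elements, the images of a dense sequence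
  under the perturbed homomorphisms, not on fixed ones. A fixed element is reached at the end,
  because the limit homomorphism is onto. The tolerances \<open>(1/2) ^ n\<close> make the steps
  summable.\<close>

lemma
  assumes "star_hom f"
  shows star_hom_add: "f (x + y) = f x + f y"
    and star_hom_scaleC: "f (c *\<^sub>C x) = c *\<^sub>C f x"
    and star_hom_mult: "f (x * y) = f x * f y"
    and star_hom_adj: "f (x\<^sup>\<star>) = (f x)\<^sup>\<star>"
  using assms by (auto simp: star_hom_def)

lemma star_hom_scaleR: "star_hom f \<Longrightarrow> f (r *\<^sub>R x) = r *\<^sub>R f x"
  by (simp add: scaleR_scaleC star_hom_scaleC)

lemma star_hom_linear: "star_hom f \<Longrightarrow> linear f"
  by (intro linearI) (simp_all add: star_hom_add star_hom_scaleR)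

lemma star_hom_diff: "star_hom f \<Longrightarrow> f (x - y) = f x - f y"
  by (simp add: linear_diff star_hom_linear)

lemma star_hom_zero: "star_hom f \<Longrightarrow> f 0 = 0"
  by (simp add: linear_0 star_hom_linear)

lemma scaleC_minus_left: "(- c) *\<^sub>C x = - (c *\<^sub>C x)" for x :: "'a::cstar_algebra"
  using scaleR_scaleC[of "-1" "c *\<^sub>C x"] by (simp add: scaleC_scaleC)

lemma adj_linear: "linear (adj :: 'a::cstar_algebra \<Rightarrow> 'a)"
  by (rule bounded_linear.linear[OF bounded_linear_adj])

lemma adj_minus: "(- x)\<^sup>\<star> = - (x\<^sup>\<star>)" for x :: "'a::cstar_algebra"
  by (rule linear_neg[OF adj_linear])

lemma adj_diff: "(x - y)\<^sup>\<star> = x\<^sup>\<star> - y\<^sup>\<star>" for x :: "'a::cstar_algebra"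
  by (rule linear_diff[OF adj_linear])

lemma adj_zero: "0\<^sup>\<star> = (0 :: 'a::cstar_algebra)"
  by (rule linear_0[OF adj_linear])

lemma adj_sum: "(\<Sum>i\<in>I. f i)\<^sup>\<star> = (\<Sum>i\<in>I. (f i)\<^sup>\<star>)" for f :: "'i \<Rightarrow> 'a::cstar_algebra"
  by (rule linear_sum[OF adj_linear])

lemma tendsto_adj: "(f \<longlongrightarrow> l) F \<Longrightarrow> ((\<lambda>i. (f i)\<^sup>\<star>) \<longlongrightarrow> l\<^sup>\<star>) F"
  for l :: "'a::cstar_algebra"
  by (rule bounded_linear.tendsto[OF bounded_linear_adj])

lemma adj_one: "1\<^sup>\<star> = (1 :: 'a::{cstar_algebra, monoid_mult})"
proof -
  have "1\<^sup>\<star> = (1\<^sup>\<star> * 1 :: 'a)" by simp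
  also have "\<dots> = (1\<^sup>\<star> * 1)\<^sup>\<star>" by (simp only: adj_mult adj_adj)
  also have "\<dots> = 1" by (simp add: adj_adj)
  finally show ?thesis .
qed

lemma norm_one_le: "norm (1 :: 'a::{cstar_algebra, monoid_mult}) \<le> 1"
proof -
  have "norm (1::'a) = (norm (1::'a))\<^sup>2"
    using cstar_identity[of "1::'a"] by (simp add: adj_one)
  then have "norm (1::'a) = 0 \<or> norm (1::'a) = 1" by (simp add: power2_eq_square)
  then show ?thesis by linarith
qed

lemma norm_unitary_le: "unitary u \<Longrightarrow> norm (u :: 'a::{cstar_algebra, monoid_mult}) \<le> 1"
  using cstar_identity[of u] norm_one_le[where 'a = 'a] power2_le_imp_le[of "norm u" 1]
  by (simp add: unitary_def)

section \<open>Iterative square roots of one minus a contraction\<close>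

primrec sqrt_iter :: "'a::real_normed_algebra \<Rightarrow> nat \<Rightarrow> 'a" where
  "sqrt_iter x 0 = 0"
| "sqrt_iter x (Suc n) = (1/2) *\<^sub>R (x + sqrt_iter x n * sqrt_iter x n)"

lemma sqrt_iter_one:
  "0 \<le> sqrt_iter (1::real) n" "sqrt_iter (1::real) n \<le> 1" "sqrt_iter (1::real) n \<le> sqrt_iter 1 (Suc n)"
proof -
  show nn: "0 \<le> sqrt_iter (1::real) n" for n by (induction n) auto
  show le: "sqrt_iter (1::real) n \<le> 1" for n
  proof (induction n)
    case (Suc n)
    then show ?case using mult_mono[OF Suc Suc] nn[of n] by simp
  qed simp
  show "sqrt_iter (1::real) n \<le> sqrt_iter 1 (Suc n)"
    using zero_le_square[of "1 - sqrt_iter (1::real) n"] by (simp add: algebra_simps)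
qed

lemma norm_sqrt_iter:
  assumes "norm x \<le> 1"
  shows "norm (sqrt_iter x n) \<le> sqrt_iter 1 n"
proof (induction n)
  case (Suc n)
  have "norm (sqrt_iter x n * sqrt_iter x n) \<le> sqrt_iter 1 n * sqrt_iter 1 n"
    by (rule norm_mult_ineq[THEN order_trans]) (intro mult_mono Suc sqrt_iter_one norm_ge_zero)
  with assms norm_triangle_ineq[of x "sqrt_iter x n * sqrt_iter x n"] show ?case by simp
qed simp

text \<open>The scalar iteration at 1 is a majorant: writing \<open>y * y - z * z\<close> as
  \<open>y * (y - z) + (y - z) * z\<close> bounds it by the same expression in the scalars, where it
  is again a difference of squares. The bounded increasing scalar sequence thus makes every
  iteration with a contraction Cauchy.\<close>

lemma norm_sqrt_iter_diff:
  assumes "norm x \<le> 1"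
  shows "norm (sqrt_iter x (n + k) - sqrt_iter x n) \<le> sqrt_iter 1 (n + k) - sqrt_iter 1 n"
proof (induction n)
  case 0
  then show ?case using norm_sqrt_iter[OF assms, of k] by simp
next
  case (Suc n)
  let ?y = "sqrt_iter x (n + k)" and ?z = "sqrt_iter x n"
  let ?p = "sqrt_iter (1::real) (n + k)" and ?q = "sqrt_iter (1::real) n"
  have "norm (?y * ?y - ?z * ?z) = norm (?y * (?y - ?z) + (?y - ?z) * ?z)"
    by (simp add: algebra_simps)
  also have "\<dots> \<le> norm ?y * norm (?y - ?z) + norm (?y - ?z) * norm ?z"
    by (intro norm_triangle_le add_mono norm_mult_ineq)
  also have "\<dots> \<le> ?p * (?p - ?q) + (?p - ?q) * ?q"
    using Suc norm_ge_zero[of "?y - ?z"]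
    by (intro add_mono mult_mono norm_sqrt_iter assms sqrt_iter_one norm_ge_zero Suc) linarith+
  also have "\<dots> = ?p * ?p - ?q * ?q" by (simp add: algebra_simps)
  finally have "norm (?y * ?y - ?z * ?z) \<le> ?p * ?p - ?q * ?q" .
  moreover have "sqrt_iter x (Suc n + k) - sqrt_iter x (Suc n) = (1/2) *\<^sub>R (?y * ?y - ?z * ?z)"
    by (simp add: algebra_simps)
  ultimately show ?case by (simp only: sqrt_iter.simps add_Suc norm_scaleR) (simp add: field_simps)
qed

text \<open>The element \<open>1 - y\<close> is a square root of \<open>1 - x\<close>, but no unit is needed to speak about \<open>y\<close>.\<close>

lemma one_minus_sqrt:
  fixes x :: "'a::cstar_algebra"
  assumes sa: "x\<^sup>\<star> = x" and le: "norm x \<le> 1"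
  obtains y where "y\<^sup>\<star> = y" "2 *\<^sub>R y - y * y = x" "\<And>c. c * x = x * c \<Longrightarrow> c * y = y * c"
proof -
  let ?y = "sqrt_iter x"
  have "convergent (sqrt_iter (1::real))"
    by (intro Bseq_monoseq_convergent BseqI'[of _ 1] incseq_imp_monoseq incseq_SucI sqrt_iter_one)
       (use sqrt_iter_one in auto)
  then have q: "Cauchy (sqrt_iter (1::real))" by (rule convergent_Cauchy)
  have "Cauchy ?y"
  proof (rule CauchyI')
    fix e :: real assume "0 < e"
    then obtain M where M: "\<And>m n. m \<ge> M \<Longrightarrow> n \<ge> M \<Longrightarrow> norm (sqrt_iter (1::real) m - sqrt_iter 1 n) < e"
      using q by (meson CauchyD)
    have "dist (?y m) (?y n) < e" if "M \<le> m" "m < n" for m n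
      using norm_sqrt_iter_diff[OF le, of m "n - m"] M[of n m] that
      by (simp add: dist_norm norm_minus_commute)
    then show "\<exists>M. \<forall>m\<ge>M. \<forall>n>m. dist (?y m) (?y n) < e" by blast
  qed
  then obtain y where y: "?y \<longlonglongrightarrow> y" by (auto simp: Cauchy_convergent_iff convergent_def)
  have "(\<lambda>n. ?y (Suc n)) \<longlonglongrightarrow> (1/2) *\<^sub>R (x + y * y)"
    by (auto intro!: tendsto_intros y)
  then have "y = (1/2) *\<^sub>R (x + y * y)"
    using LIMSEQ_unique LIMSEQ_Suc[OF y] by blast
  then have "2 *\<^sub>R y = x + y * y"
    by (metis (no_types) scaleR_half_double scaleR_2 scaleR_right_distrib)
  then have "2 *\<^sub>R y - y * y = x" by simp
  moreover have "(?y n)\<^sup>\<star> = ?y n" for n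
    by (induction n) (simp_all add: adj_zero adj_add adj_scaleR adj_mult sa)
  then have "y\<^sup>\<star> = y" using LIMSEQ_unique[OF tendsto_adj[OF y]] y by simp
  moreover have "c * y = y * c" if c: "c * x = x * c" for c
  proof -
    have "c * ?y n = ?y n * c" for n
    proof (induction n)
      case (Suc n)
      have "c * (?y n * ?y n) = ?y n * ?y n * c"
        by (metis Suc mult.assoc)
      then show ?case by (simp add: distrib_left distrib_right c)
    qed simp
    then show ?thesis
      using tendsto_mult_left[OF y, of c] tendsto_mult_right[OF y, of c] LIMSEQ_unique by simp
  qed
  ultimately show ?thesis using that by blast
qed

text \<open>The element \<open>U\<close> with real part \<open>h\<close> and imaginary part
  \<open>k\<close> is unitary, and \<open>h\<close> is the average of \<open>U\<close> and its
  adjoint. The hypotheses are algebraic identities, so they can be carried through a homomorphism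
  not yet known to be continuous.\<close>

lemma norm_le_of_sum_squares:
  fixes h k :: "'a::{cstar_algebra, monoid_mult}"
  assumes "h\<^sup>\<star> = h" "k\<^sup>\<star> = k" "h * k = k * h" "h * h + k * k = 1"
  shows "norm h \<le> 1"
proof -
  define U where "U = h + \<i> *\<^sub>C k"
  have U: "U\<^sup>\<star> = h + (-\<i>) *\<^sub>C k" by (simp add: U_def adj_add adj_scaleC assms)
  have [simp]: "\<i> *\<^sub>C x + (-\<i>) *\<^sub>C x = 0" "\<i> *\<^sub>C (-\<i>) *\<^sub>C x = x" "(-\<i>) *\<^sub>C \<i> *\<^sub>C x = x" for x :: 'a
    using scaleC_add_left[of \<i> "-\<i>" x] scaleR_scaleC[of 0 x]
    by (simp_all add: scaleC_scaleC scaleC_one)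
  have "U\<^sup>\<star> * U = h * h + k * k + (\<i> *\<^sub>C (h * k) + (-\<i>) *\<^sub>C (h * k))"
    "U * U\<^sup>\<star> = h * h + k * k + (\<i> *\<^sub>C (h * k) + (-\<i>) *\<^sub>C (h * k))"
    unfolding U unfolding U_def
    by (simp_all only: distrib_left distrib_right mult_scaleC_left mult_scaleC_right scaleC_add_right assms(3))
      (simp_all add: ac_simps)
  then have "unitary U" by (simp add: unitary_def assms)
  then have "norm U \<le> 1" "norm (U\<^sup>\<star>) \<le> 1" by (simp_all add: norm_unitary_le norm_adj)
  moreover have "h = (1/2) *\<^sub>R (U + U\<^sup>\<star>)"
  proof -
    have "U + U\<^sup>\<star> = h + h + (\<i> *\<^sub>C k + (-\<i>) *\<^sub>C k)"
      unfolding U unfolding U_def by (simp only: ac_simps)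
    then show ?thesis by (simp flip: scaleR_2)
  qed
  ultimately show ?thesis using norm_triangle_ineq[of U "U\<^sup>\<star>"] by simp
qed

text \<open>For a self-adjoint contraction \<open>h\<close> take \<open>1 - y\<close> as a square
  root of \<open>1 - h * h\<close>. The resulting identity can be written with \<open>h\<close> and
  \<open>y\<close> alone, so \<open>f\<close> preserves it although there is no unit to respect; a
  unit is available again among the multipliers of the codomain. General elements are reduced to the
  self-adjoint \<open>a\<^sup>\<star> * a\<close> by the C*-identity.\<close>

lemma star_hom_norm_le:
  assumes f: "star_hom f"
  shows "norm (f a) \<le> norm a"
proof -
  have unit_ball: "norm (f h) \<le> 1" if h: "h\<^sup>\<star> = h" "norm h \<le> 1" for h
  proof -
    have "norm (h * h) \<le> 1" using norm_mult_ineq[of h h] h mult_le_one[of "norm h" "norm h"] by simp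
    then obtain y where y: "y\<^sup>\<star> = y" "2 *\<^sub>R y - y * y = h * h" "h * y = y * h"
      using one_minus_sqrt[of "h * h"] h by (metis adj_mult mult.assoc)
    let ?M = "\<lambda>x. mult_of (f x)"
    have M: "star_hom ?M"
      using f star_hom_mult_of by (auto simp: star_hom_def)
    have "norm (?M h) \<le> 1"
    proof (rule norm_le_of_sum_squares)
      show "(?M h)\<^sup>\<star> = ?M h" "(1 - ?M y)\<^sup>\<star> = 1 - ?M y"
        by (simp_all add: star_hom_adj[OF M, symmetric] adj_diff adj_one h y)
      show "?M h * (1 - ?M y) = (1 - ?M y) * ?M h"
        by (simp add: algebra_simps star_hom_mult[OF M, symmetric] y)
      have "?M h * ?M h = 2 *\<^sub>R ?M y - ?M y * ?M y"
        by (simp only: star_hom_mult[OF M, symmetric] star_hom_scaleR[OF M, symmetric]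
            star_hom_diff[OF M, symmetric] y)
      then show "?M h * ?M h + (1 - ?M y) * (1 - ?M y) = 1"
        by (simp add: algebra_simps scaleR_2)
    qed
    then show ?thesis by (simp add: norm_mult_of)
  qed
  have sa: "norm (f h) \<le> norm h" if h: "h\<^sup>\<star> = h" for h
  proof (cases "h = 0")
    case False
    then show ?thesis using unit_ball[of "(1 / norm h) *\<^sub>R h"] h
      by (simp add: star_hom_scaleR[OF f] adj_scaleR field_simps)
  qed (simp add: star_hom_zero[OF f])
  have "(norm (f a))\<^sup>2 \<le> (norm a)\<^sup>2"
    using sa[of "a\<^sup>\<star> * a"]
    by (simp add: star_hom_mult[OF f] star_hom_adj[OF f] cstar_identity adj_mult adj_adj)
  then show ?thesis by (rule power2_le_imp_le) simp
qed

lemma star_hom_bounded_linear: "star_hom f \<Longrightarrow> bounded_linear f"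
  by (rule bounded_linear_intro[where K = 1])
     (simp_all add: star_hom_add star_hom_scaleR star_hom_norm_le)

lemmas star_hom_tendsto = bounded_linear.tendsto[OF star_hom_bounded_linear]

section \<open>Positive elements of unital C*-algebras\<close>

text \<open>For self-adjoint \<open>x\<close> the spectrum is nonnegative iff \<open>norm (t - x) \<le> t\<close> for some \<open>t\<close>; in this
  form positivity can be handled without spectral theory.\<close>

definition cpos :: "'a::{cstar_algebra, monoid_mult} \<Rightarrow> bool" where
  "cpos x \<longleftrightarrow> x\<^sup>\<star> = x \<and> (\<exists>t. norm (t *\<^sub>R 1 - x) \<le> t)"

lemma cpos_adj: "cpos x \<Longrightarrow> x\<^sup>\<star> = x"
  by (simp add: cpos_def)

text \<open>The square root \<open>1 - y\<close> of \<open>1 - h * h\<close> has norm at most one by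
  the sum-of-squares bound with the roles of the two summands exchanged. Squaring it gives the bound
  for \<open>t = 1\<close>, and scaling gives the rest.\<close>

lemma norm_diff_square_le:
  fixes k :: "'a::{cstar_algebra, monoid_mult}"
  assumes k: "k\<^sup>\<star> = k" and t: "norm (k * k) \<le> t"
  shows "norm (t *\<^sub>R 1 - k * k) \<le> t"
proof -
  have unit_ball: "norm (1 - h * h) \<le> 1" if h: "h\<^sup>\<star> = h" "norm (h * h) \<le> 1" for h :: 'a
  proof -
    obtain y where y: "y\<^sup>\<star> = y" "2 *\<^sub>R y - y * y = h * h" "h * y = y * h"
      using one_minus_sqrt[of "h * h"] h by (metis adj_mult mult.assoc)
    have eq: "(1 - y) * (1 - y) = 1 - h * h"
      unfolding y(2)[symmetric] by (simp add: algebra_simps scaleR_2)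
    have "norm (1 - y) \<le> 1"
    proof (rule norm_le_of_sum_squares)
      show "(1 - y) * (1 - y) + h * h = 1" by (simp only: eq) simp
      show "(1 - y) * h = h * (1 - y)" by (simp add: algebra_simps y(3))
    qed (simp_all add: adj_diff adj_one y(1) h(1))
    then show ?thesis
      using norm_mult_ineq[of "1 - y" "1 - y"] mult_le_one[of "norm (1 - y)" "norm (1 - y)"]
      by (simp add: eq)
  qed
  show ?thesis
  proof (cases "t = 0")
    case True
    then show ?thesis using t by simp
  next
    case False
    then have pos: "t > 0" using t norm_ge_zero[of "k * k"] by linarith
    let ?h = "(1 / sqrt t) *\<^sub>R k"
    have h: "?h * ?h = (1 / t) *\<^sub>R (k * k)" using pos by simp
    have "norm (1 - (1 / t) *\<^sub>R (k * k)) \<le> 1"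
      using unit_ball[of ?h] pos t unfolding h by (simp add: adj_scaleR k)
    moreover have "t *\<^sub>R 1 - k * k = t *\<^sub>R (1 - (1 / t) *\<^sub>R (k * k))"
      using pos by (simp add: scaleR_diff_right)
    ultimately show ?thesis using pos by (simp only: norm_scaleR) simp
  qed
qed

lemma cpos_square: "k\<^sup>\<star> = k \<Longrightarrow> cpos (k * k)"
  unfolding cpos_def using norm_diff_square_le[of k, OF _ order.refl] by (auto simp: adj_mult)

text \<open>For \<open>t > 0\<close> the condition in \<open>cpos\<close> says that
  \<open>x / t\<close> is one minus a self-adjoint contraction, which is what
  \<open>one_minus_sqrt\<close> handles. For \<open>t = 0\<close> it forces
  \<open>x = 0\<close>.\<close>

lemma cpos_sqrt:
  assumes "cpos x"
  obtains k where "k\<^sup>\<star> = k" "k * k = x" "\<And>c. c * x = x * c \<Longrightarrow> c * k = k * c"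
proof -
  obtain t where x: "x\<^sup>\<star> = x" and t: "norm (t *\<^sub>R 1 - x) \<le> t" using assms by (auto simp: cpos_def)
  show ?thesis
  proof (cases "t = 0")
    case True
    then show ?thesis using t that[of 0] by (simp add: adj_zero)
  next
    case False
    then have pos: "t > 0" using t norm_ge_zero[of "t *\<^sub>R 1 - x"] by linarith
    let ?z = "1 - (1 / t) *\<^sub>R x"
    have z: "t *\<^sub>R 1 - x = t *\<^sub>R ?z"
      using pos by (simp add: scaleR_diff_right)
    have nz: "norm ?z \<le> 1" using t pos unfolding z by simp
    have "?z\<^sup>\<star> = ?z" by (simp add: adj_diff adj_one adj_scaleR x)
    then obtain y where y: "y\<^sup>\<star> = y" "2 *\<^sub>R y - y * y = ?z" "\<And>c. c * ?z = ?z * c \<Longrightarrow> c * y = y * c"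
      using one_minus_sqrt nz by blast
    let ?k = "sqrt t *\<^sub>R (1 - y)"
    have "(1 - y) * (1 - y) = 1 - ?z" unfolding y(2)[symmetric] by (simp add: algebra_simps scaleR_2)
    then have "?k * ?k = x" using pos by simp
    moreover have "c * ?k = ?k * c" if "c * x = x * c" for c
      using y(3)[of c] that by (simp add: algebra_simps)
    moreover have "?k\<^sup>\<star> = ?k" by (simp add: adj_scaleR adj_diff adj_one y)
    ultimately show ?thesis using that by blast
  qed
qed

text \<open>The definition of \<open>cpos\<close> supplies only some \<open>t\<close>; a square root
  upgrades this to every \<open>t\<close> bounding the norm. One \<open>t\<close> can then be chosen
  uniformly, for instance along a convergent sequence.\<close>

lemma cpos_norm_diff: "cpos x \<Longrightarrow> norm x \<le> t \<Longrightarrow> norm (t *\<^sub>R 1 - x) \<le> t"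
  by (metis cpos_sqrt norm_diff_square_le)

lemma cpos_add: "cpos x \<Longrightarrow> cpos y \<Longrightarrow> cpos (x + y)"
  unfolding cpos_def
proof (elim conjE exE, intro conjI exI)
  fix s t assume "norm (s *\<^sub>R 1 - x) \<le> s" "norm (t *\<^sub>R 1 - y) \<le> t"
  then show "norm ((s + t) *\<^sub>R 1 - (x + y)) \<le> s + t"
    using norm_triangle_ineq[of "s *\<^sub>R 1 - x" "t *\<^sub>R 1 - y"] by (simp add: algebra_simps)
qed (simp add: adj_add)

lemma cpos_scaleR: "cpos x \<Longrightarrow> r \<ge> 0 \<Longrightarrow> cpos (r *\<^sub>R x)"
  unfolding cpos_def
proof (elim conjE exE, intro conjI exI)
  fix t assume "r \<ge> 0" "norm (t *\<^sub>R 1 - x) \<le> t"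
  then show "norm ((r * t) *\<^sub>R 1 - r *\<^sub>R x) \<le> r * t"
    by (simp add: mult_left_mono flip: scaleR_scaleR scaleR_diff_right)
qed (simp add: adj_scaleR)

lemma cpos_zero: "cpos 0"
  using cpos_square[of 0] by (simp add: adj_zero)

lemma cpos_one: "cpos 1"
  using cpos_square[of 1] by (simp add: adj_one)

lemma cpos_const: "r \<ge> 0 \<Longrightarrow> cpos (r *\<^sub>R 1)"
  by (intro cpos_scaleR cpos_one)

lemma cpos_sum: "(\<And>i. i \<in> I \<Longrightarrow> cpos (f i)) \<Longrightarrow> cpos (sum f I)"
  by (induction I rule: infinite_finite_induct) (simp_all add: cpos_zero cpos_add)

lemma cpos_const_diff: "x\<^sup>\<star> = x \<Longrightarrow> norm x \<le> t \<Longrightarrow> cpos (t *\<^sub>R 1 - x)"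
  unfolding cpos_def by (intro conjI exI[of _ t]) (simp_all add: adj_diff adj_scaleR adj_one)

lemma cpos_mult:
  assumes "cpos x" "cpos y" "x * y = y * x"
  shows "cpos (x * y)"
proof -
  obtain k where k: "k\<^sup>\<star> = k" "k * k = x" "\<And>c. c * x = x * c \<Longrightarrow> c * k = k * c"
    using cpos_sqrt[OF assms(1)] by blast
  obtain l where l: "l\<^sup>\<star> = l" "l * l = y" "\<And>c. c * y = y * c \<Longrightarrow> c * l = l * c"
    using cpos_sqrt[OF assms(2)] by blast
  have "k * l = l * k" using k(3)[of y] l(3)[of k] assms(3) by simp
  then have "x * y = (k * l) * (k * l)" "(k * l)\<^sup>\<star> = k * l"
    by (metis k(2) l(2) mult.assoc, simp add: adj_mult k l)
  then show ?thesis using cpos_square[of "k * l"] by simp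
qed

lemma cpos_power: "cpos x \<Longrightarrow> cpos (x ^ n)"
  by (induction n) (simp_all add: cpos_one cpos_mult power_commutes)

text \<open>Commuting roots \<open>k\<close> of \<open>x\<close> and \<open>l\<close> of
  \<open>t - x\<close> have squares adding up to \<open>t\<close>, so after rescaling the
  sum-of-squares bound gives \<open>norm k \<le> sqrt t\<close>.\<close>

lemma cpos_norm_le_pos:
  assumes x: "cpos x" and tx: "cpos (t *\<^sub>R 1 - x)" and t: "t > 0"
  shows "norm x \<le> t"
proof -
  obtain k where k: "k\<^sup>\<star> = k" "k * k = x" using cpos_sqrt[OF x] by blast
  obtain l where l: "l\<^sup>\<star> = l" "l * l = t *\<^sub>R 1 - x"
      "\<And>c. c * (t *\<^sub>R 1 - x) = (t *\<^sub>R 1 - x) * c \<Longrightarrow> c * l = l * c"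
    using cpos_sqrt[OF tx] by blast
  have "k * x = x * k" by (simp add: k(2)[symmetric] mult.assoc)
  then have kl: "k * l = l * k" using l(3)[of k] by (simp add: algebra_simps)
  define r where "r = 1 / sqrt t"
  have r: "r * r = 1 / t" using t by (simp add: r_def)
  have "norm (r *\<^sub>R k) \<le> 1"
  proof (rule norm_le_of_sum_squares)
    have "r *\<^sub>R k * r *\<^sub>R k + r *\<^sub>R l * r *\<^sub>R l = (r * r) *\<^sub>R (k * k + l * l)"
      by (simp add: scaleR_add_right)
    also have "\<dots> = 1" using t by (simp add: k(2) l(2) r)
    finally show "r *\<^sub>R k * r *\<^sub>R k + r *\<^sub>R l * r *\<^sub>R l = 1" .
  qed (simp_all add: adj_scaleR k(1) l(1) kl)
  then have "norm k * norm k \<le> t"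
    using t mult_mono[of "norm k" "sqrt t" "norm k" "sqrt t"] by (simp add: r_def field_simps)
  then show ?thesis using norm_mult_ineq[of k k] by (simp add: k)
qed

lemma cpos_norm_le:
  assumes x: "cpos x" and tx: "cpos (t *\<^sub>R 1 - x)" and t: "t \<ge> 0"
  shows "norm x \<le> t"
proof (rule field_le_epsilon)
  fix e :: real assume "e > 0"
  then show "norm x \<le> t + e"
    using cpos_norm_le_pos[OF x, of "t + e"] cpos_add[OF tx cpos_const[of e]] t
    by (simp add: algebra_simps)
qed

lemma cpos_mono:
  assumes "cpos x" "cpos (y - x)"
  shows "norm x \<le> norm y"
proof (rule cpos_norm_le[OF assms(1)])
  have "y\<^sup>\<star> = y" using cpos_adj[OF cpos_add[OF assms]] by simp
  then show "cpos (norm y *\<^sub>R 1 - x)"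
    using cpos_add[OF cpos_const_diff[of y "norm y"] assms(2)] by simp
qed simp

lemma cpos_antisym: "cpos x \<Longrightarrow> cpos (- x) \<Longrightarrow> x = 0"
  using cpos_norm_le[of x 0] by simp

lemma cpos_limit:
  fixes x :: "nat \<Rightarrow> 'a::{cstar_algebra, monoid_mult}"
  assumes x: "\<And>n. cpos (x n)" and lim: "x \<longlonglongrightarrow> l"
  shows "cpos l"
proof -
  obtain t where t: "\<And>n. norm (x n) \<le> t"
    using convergent_imp_Bseq[of x] lim by (auto simp: convergent_def Bseq_def)
  have "l\<^sup>\<star> = l"
    using LIMSEQ_unique[OF tendsto_adj[OF lim]] lim x by (simp add: cpos_adj)
  moreover have "norm (t *\<^sub>R 1 - l) \<le> t"
    by (rule LIMSEQ_le_const2[where X = "\<lambda>n. norm (t *\<^sub>R 1 - x n)"])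
       (auto intro!: tendsto_intros lim cpos_norm_diff[OF x t])
  ultimately show ?thesis by (auto simp: cpos_def)
qed

section \<open>Inverses of positive elements\<close>

lemma inverse_near_one:
  fixes a :: "'a::{cstar_algebra, monoid_mult}"
  assumes a: "norm (1 - a) < 1"
  obtains b where "a * b = 1" "b * a = 1"
proof -
  \<comment> \<open>The fixed point of a contraction with factor \<open>norm (1 - a)\<close>
    replaces the Neumann series: it solves \<open>a * b = 1\<close>.\<close>
  have "\<exists>!b. 1 + (1 - a) * b = b"
    by (rule banach_fix_type[of "norm (1 - a)"])
       (use a in \<open>auto simp: dist_norm norm_mult_ineq simp flip: right_diff_distrib\<close>)
  then obtain b where "1 + (1 - a) * b = b" by blast
  then have b: "a * b = 1" by (simp add: algebra_simps)
  have "\<exists>!b. 1 + b * (1 - a) = b"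
    by (rule banach_fix_type[of "norm (1 - a)"])
       (use a in \<open>auto simp: dist_norm norm_mult_ineq mult.commute[of "norm (1 - a)"] simp flip: left_diff_distrib\<close>)
  then obtain c where "1 + c * (1 - a) = c" by blast
  then have c: "c * a = 1" by (simp add: algebra_simps)
  have "c = b" using b c by (metis mult.assoc mult_1_left mult_1_right)
  then show ?thesis using that b c by blast
qed

lemma cpos_inverse_add:
  fixes y :: "'a::{cstar_algebra, monoid_mult}"
  assumes y: "cpos y" and e: "\<epsilon> > 0"
  obtains b where "(y + \<epsilon> *\<^sub>R 1) * b = 1" "b * (y + \<epsilon> *\<^sub>R 1) = 1"
proof -
  \<comment> \<open>Dividing by this number puts \<open>y + \<epsilon>\<close> at distance at most
    \<open>norm y / ?s\<close> from 1, which is less than 1.\<close>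
  let ?s = "norm y + \<epsilon>"
  let ?a = "(1 / ?s) *\<^sub>R (y + \<epsilon> *\<^sub>R 1)"
  have s: "?s > 0" using e norm_ge_zero[of y] by linarith
  have "1 - ?a = (1 / ?s) *\<^sub>R (?s *\<^sub>R 1 - (y + \<epsilon> *\<^sub>R 1))"
    using s by (simp add: scaleR_diff_right)
  also have "\<dots> = (1 / ?s) *\<^sub>R (norm y *\<^sub>R 1 - y)" by (simp add: algebra_simps)
  finally have "norm (1 - ?a) = norm (norm y *\<^sub>R 1 - y) / ?s" using s by simp
  also have "\<dots> \<le> norm y / ?s" using s by (intro divide_right_mono cpos_norm_diff y) auto
  also have "\<dots> < 1" using s e by simp
  finally obtain b where "?a * b = 1" "b * ?a = 1" by (rule inverse_near_one)
  then show ?thesis using that[of "(1 / ?s) *\<^sub>R b"] by simp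
qed

text \<open>If \<open>m\<close> is at least the norm of the inverse \<open>b\<close>, then
  \<open>m - b\<close> is positive and commutes with \<open>y\<close>, so the product
  \<open>y * (m - b)\<close>, which is \<open>m * y - 1\<close>, is positive. This yields the lower
  bound \<open>1 / m\<close>. The choice \<open>m = norm b + 1\<close> is positive also in the zero
  algebra.\<close>

lemma cpos_invertible_lower_bound:
  fixes y :: "'a::{cstar_algebra, monoid_mult}"
  assumes y: "cpos y" and b: "y * b = 1" "b * y = 1"
  obtains \<delta> where "\<delta> > 0" "cpos (y - \<delta> *\<^sub>R 1)"
proof -
  have "b\<^sup>\<star> = b\<^sup>\<star> * (y * b)" by (simp add: b)
  also have "\<dots> = (y * b)\<^sup>\<star> * b" by (simp add: adj_mult cpos_adj[OF y] mult.assoc)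
  finally have bsa: "b\<^sup>\<star> = b" by (simp add: b adj_one)
  let ?m = "norm b + 1"
  have "cpos (?m *\<^sub>R 1 - b)" by (rule cpos_const_diff) (simp_all add: bsa)
  then have "cpos (y * (?m *\<^sub>R 1 - b))" by (rule cpos_mult[OF y]) (simp add: algebra_simps b)
  then have "cpos ((1 / ?m) *\<^sub>R (y * (?m *\<^sub>R 1 - b)))" by (rule cpos_scaleR) simp
  also have "y * (?m *\<^sub>R 1 - b) = ?m *\<^sub>R y - 1" by (simp add: right_diff_distrib b)
  also have "(1 / ?m) *\<^sub>R (?m *\<^sub>R y - 1) = ((1 / ?m) * ?m) *\<^sub>R y - (1 / ?m) *\<^sub>R 1"
    by (simp only: scaleR_diff_right scaleR_scaleR)
  also have "(1 / ?m) * ?m = 1" using norm_ge_zero[of b] by (simp add: add_nonneg_eq_0_iff)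
  finally show ?thesis using that[of "1 / ?m"] norm_ge_zero[of b] by (simp add: add_nonneg_pos)
qed

text \<open>The set of \<open>t \<ge> 0\<close> for which \<open>x + t\<close> is positive is closed, and its least element can only
  be zero because invertible positive elements are bounded below.\<close>

lemma cpos_of_resolvent:
  fixes x :: "'a::{cstar_algebra, monoid_mult}"
  assumes x: "x\<^sup>\<star> = x" and inv: "\<And>t. t > 0 \<Longrightarrow> \<exists>b. (x + t *\<^sub>R 1) * b = 1 \<and> b * (x + t *\<^sub>R 1) = 1"
  shows "cpos x"
proof -
  define T where "T = {t \<in> {0..norm x}. cpos (x + t *\<^sub>R 1)}"
  have "closed T"
    unfolding closed_sequential_limits
  proof (intro allI impI, elim conjE)
    fix f l assume f: "\<forall>n. f n \<in> T" and l: "f \<longlonglongrightarrow> l"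
    have "l \<in> {0..norm x}"
      by (rule closed_sequentially[OF closed_atLeastAtMost _ l]) (use f in \<open>simp add: T_def\<close>)
    moreover have "cpos (x + l *\<^sub>R 1)"
    proof (rule cpos_limit)
      show "cpos (x + f n *\<^sub>R 1)" for n using f by (simp add: T_def)
      show "(\<lambda>n. x + f n *\<^sub>R 1) \<longlonglongrightarrow> x + l *\<^sub>R 1" by (intro tendsto_intros l)
    qed
    ultimately show "l \<in> T" by (simp add: T_def)
  qed
  moreover have "bounded T"
    by (rule bounded_subset[OF bounded_closed_interval[of 0 "norm x"]]) (auto simp: T_def)
  ultimately have "compact T" by (simp add: compact_eq_bounded_closed)
  moreover have "norm x \<in> T"
    using cpos_const_diff[of "- x" "norm x"] by (simp add: T_def adj_minus x add.commute)
  ultimately obtain m where m: "m \<in> T" "\<And>t. t \<in> T \<Longrightarrow> m \<le> t"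
    using compact_attains_inf[of T] by blast
  have "m = 0"
  proof (rule ccontr)
    assume "m \<noteq> 0"
    then have pos: "m > 0" using m by (simp add: T_def)
    have cm: "cpos (x + m *\<^sub>R 1)" using m by (simp add: T_def)
    obtain \<delta> where d: "\<delta> > 0" "cpos (x + m *\<^sub>R 1 - \<delta> *\<^sub>R 1)"
      using cpos_invertible_lower_bound[OF cm] inv[OF pos] by metis
    let ?t = "max 0 (m - \<delta>)"
    have "cpos (x + m *\<^sub>R 1 - \<delta> *\<^sub>R 1 + (?t - (m - \<delta>)) *\<^sub>R 1)"
      by (intro cpos_add d cpos_const) simp
    then have "cpos (x + ?t *\<^sub>R 1)" by (simp only: algebra_simps) simp
    then have "?t \<in> T" using m pos d(1) by (auto simp: T_def)
    then show False using m(2)[of ?t] pos d(1) by auto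
  qed
  then show ?thesis using m by (simp add: T_def)
qed

text \<open>With \<open>w\<close> the inverse of \<open>z\<close>, the element
  \<open>z * p * z + t\<close> equals \<open>z * (p + t * w * w) * z\<close>, and the middle factor
  is invertible because \<open>w * w\<close> is bounded below by a positive constant. So the
  resolvent criterion applies, and inequalities can be conjugated by invertible self-adjoint
  elements.\<close>

lemma cpos_conjugate:
  fixes z :: "'a::{cstar_algebra, monoid_mult}"
  assumes z: "z\<^sup>\<star> = z" "z * w = 1" "w * z = 1" and p: "cpos p"
  shows "cpos (z * p * z)"
proof (rule cpos_of_resolvent)
  have w: "w\<^sup>\<star> = w" by (metis adj_mult adj_one mult.assoc mult_1_left mult_1_right z)
  show "(z * p * z)\<^sup>\<star> = z * p * z" by (simp add: adj_mult z cpos_adj[OF p] mult.assoc)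
  fix t :: real assume t: "t > 0"
  obtain \<delta> where d: "\<delta> > 0" "cpos (w * w - \<delta> *\<^sub>R 1)"
  proof (rule cpos_invertible_lower_bound[OF cpos_square[OF w]])
    show "w * w * (z * z) = 1" "z * z * (w * w) = 1"
      by (metis mult.assoc mult_1_left z(2,3))+
  qed
  obtain q where "(p + t *\<^sub>R (w * w - \<delta> *\<^sub>R 1) + (t * \<delta>) *\<^sub>R 1) * q = 1"
      "q * (p + t *\<^sub>R (w * w - \<delta> *\<^sub>R 1) + (t * \<delta>) *\<^sub>R 1) = 1"
    using cpos_inverse_add[OF cpos_add[OF p cpos_scaleR[OF d(2)]] mult_pos_pos[OF t d(1)]] t
    by (metis less_imp_le)
  then have q: "(p + t *\<^sub>R (w * w)) * q = 1" "q * (p + t *\<^sub>R (w * w)) = 1"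
    by (simp_all add: scaleR_diff_right)
  have eq: "z * p * z + t *\<^sub>R 1 = z * (p + t *\<^sub>R (w * w)) * z"
    by (simp add: distrib_left distrib_right mult.assoc z)
  have [simp]: "z * (w * c) = c" "w * (z * c) = c" for c
    using z by (simp_all flip: mult.assoc)
  have [simp]: "(p + t *\<^sub>R (w * w)) * (q * c) = c" "q * ((p + t *\<^sub>R (w * w)) * c) = c" for c
    using q by (simp_all flip: mult.assoc)
  have "z * (p + t *\<^sub>R (w * w)) * z * (w * q * w) = 1" "w * q * w * (z * (p + t *\<^sub>R (w * w)) * z) = 1"
    by (simp_all only: mult.assoc) (simp_all add: z)
  then show "\<exists>b. (z * p * z + t *\<^sub>R 1) * b = 1 \<and> b * (z * p * z + t *\<^sub>R 1) = 1"
    unfolding eq by blast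
qed

text \<open>The nonzero spectra of \<open>w\<^sup>\<star> * w\<close> and \<open>w * w\<^sup>\<star>\<close> agree, and
  \<open>w\<^sup>\<star> * w + w * w\<^sup>\<star>\<close> is a sum of squares of self-adjoint elements.\<close>

lemma adj_mult_self_not_negative:
  fixes w :: "'a::{cstar_algebra, monoid_mult}"
  assumes neg: "cpos (- (w\<^sup>\<star> * w))"
  shows "w\<^sup>\<star> * w = 0"
proof (rule cpos_antisym[OF _ neg])
  define a where "a = w + w\<^sup>\<star>"
  define b where "b = \<i> *\<^sub>C (w - w\<^sup>\<star>)"
  have sa: "a\<^sup>\<star> = a" "b\<^sup>\<star> = b"
    by (simp_all add: a_def b_def adj_add adj_adj adj_scaleC adj_diff add.commute scaleC_minus_left scaleC_diff_right)
  have "b * b = - ((w - w\<^sup>\<star>) * (w - w\<^sup>\<star>))"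
    by (simp add: b_def mult_scaleC_left mult_scaleC_right scaleC_scaleC scaleC_minus_left scaleC_one)
  then have "a * a + b * b = 2 *\<^sub>R (w\<^sup>\<star> * w + w * w\<^sup>\<star>)"
    by (simp add: a_def algebra_simps scaleR_2)
  then have "cpos (2 *\<^sub>R (w\<^sup>\<star> * w + w * w\<^sup>\<star>))"
    using cpos_add[OF cpos_square cpos_square] sa by metis
  then have "cpos (w\<^sup>\<star> * w + w * w\<^sup>\<star>)" using cpos_scaleR[of "2 *\<^sub>R (w\<^sup>\<star> * w + w * w\<^sup>\<star>)" "1/2"] by simp
  from cpos_add[OF this neg] have p: "cpos (w * w\<^sup>\<star>)" by simp
  show "cpos (w\<^sup>\<star> * w)"
  proof (rule cpos_of_resolvent)
    fix t :: real assume t: "t > 0"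
    obtain q where q: "(w * w\<^sup>\<star> + t *\<^sub>R 1) * q = 1" "q * (w * w\<^sup>\<star> + t *\<^sub>R 1) = 1"
      using cpos_inverse_add[OF p t] by blast
    have q1: "w * w\<^sup>\<star> * q = 1 - t *\<^sub>R q" and q2: "q * (w * w\<^sup>\<star>) = 1 - t *\<^sub>R q"
      using q by (simp_all add: algebra_simps)
    \<comment> \<open>With \<open>q\<close> the inverse of \<open>w * w\<^sup>\<star> + t\<close>,
      the inverse of \<open>w\<^sup>\<star> * w + t\<close> is \<open>?b / t\<close>.\<close>
    let ?b = "1 - w\<^sup>\<star> * q * w"
    have "w\<^sup>\<star> * w * (w\<^sup>\<star> * q * w) = w\<^sup>\<star> * (w * w\<^sup>\<star> * q) * w" by (simp only: mult.assoc)
    also have "\<dots> = w\<^sup>\<star> * w - t *\<^sub>R (w\<^sup>\<star> * q * w)" by (simp only: q1) (simp add: algebra_simps)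
    finally have 1: "(w\<^sup>\<star> * w + t *\<^sub>R 1) * ?b = t *\<^sub>R 1" by (simp add: algebra_simps)
    have "w\<^sup>\<star> * q * w * (w\<^sup>\<star> * w) = w\<^sup>\<star> * (q * (w * w\<^sup>\<star>)) * w" by (simp only: mult.assoc)
    also have "\<dots> = w\<^sup>\<star> * w - t *\<^sub>R (w\<^sup>\<star> * q * w)" by (simp only: q2) (simp add: algebra_simps)
    finally have 2: "?b * (w\<^sup>\<star> * w + t *\<^sub>R 1) = t *\<^sub>R 1" by (simp add: algebra_simps)
    show "\<exists>b. (w\<^sup>\<star> * w + t *\<^sub>R 1) * b = 1 \<and> b * (w\<^sup>\<star> * w + t *\<^sub>R 1) = 1"
      using t by (intro exI[of _ "(1 / t) *\<^sub>R ?b"]) (simp add: 1 2)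
  qed (simp add: adj_mult adj_adj)
qed

section \<open>Approximate units of separable C*-algebras\<close>

lemma mult_of_diff: "mult_of (a - b) = mult_of a - mult_of b"
  by (rule star_hom_diff[OF star_hom_mult_of])

lemma mult_of_add: "mult_of (a + b) = mult_of a + mult_of b"
  by (rule star_hom_add[OF star_hom_mult_of])

lemma mult_of_times: "mult_of (a * b) = mult_of a * mult_of b"
  by (rule star_hom_mult[OF star_hom_mult_of])

lemma mult_of_adj: "mult_of (a\<^sup>\<star>) = (mult_of a)\<^sup>\<star>"
  by (rule star_hom_adj[OF star_hom_mult_of])

lemma mult_of_scaleR: "mult_of (r *\<^sub>R a) = r *\<^sub>R mult_of a"
  by (rule star_hom_scaleR[OF star_hom_mult_of])

lemma mult_of_scaleC: "mult_of (r *\<^sub>C a) = r *\<^sub>C mult_of a"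
  by (rule star_hom_scaleC[OF star_hom_mult_of])

lemma mult_of_zero: "mult_of 0 = 0"
  by (rule star_hom_zero[OF star_hom_mult_of])

lemma mult_of_sum: "mult_of (sum f I) = (\<Sum>i\<in>I. mult_of (f i))"
  by (rule linear_sum[OF star_hom_linear[OF star_hom_mult_of]])

lemma mult_of_inject: "mult_of a = mult_of b \<longleftrightarrow> a = b"
  using norm_mult_of[of "a - b"] by (auto simp: mult_of_diff)

lemmas tendsto_mult_of = star_hom_tendsto[OF star_hom_mult_of]

section \<open>Approximate units from strictly positive elements\<close>

lemma separable_dense_sequence:
  assumes "separable_space (euclidean :: 'a::metric_space topology)"
  obtains s :: "nat \<Rightarrow> 'a::metric_space" where "\<And>a \<epsilon>. \<epsilon> > 0 \<Longrightarrow> \<exists>n. dist (s n) a < \<epsilon>"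
proof -
  obtain C :: "'a set" where C: "countable C" "closure C = UNIV"
    using assms by (auto simp: separable_space_def)
  then have "C \<noteq> {}" by auto
  then have "range (from_nat_into C) = C" using C(1) by (rule range_from_nat_into)
  then show ?thesis
    using that[of "from_nat_into C"] C(2) closure_approachable[of _ C]
    by (metis UNIV_I rangeE)
qed

lemma self_adjoint_decomp:
  fixes a :: "'a::cstar_algebra"
  obtains r i where "r\<^sup>\<star> = r" "i\<^sup>\<star> = i" "a = r + \<i> *\<^sub>C i"
proof -
  let ?r = "(1/2) *\<^sub>R (a + a\<^sup>\<star>)" and ?i = "(1/2) *\<^sub>R (\<i> *\<^sub>C (a\<^sup>\<star> - a))"
  have "\<i> *\<^sub>C ?i = (1/2) *\<^sub>R (\<i> *\<^sub>C (\<i> *\<^sub>C (a\<^sup>\<star> - a)))"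
    by (simp only: scaleR_scaleC scaleC_scaleC mult_ac)
  also have "\<dots> = (1/2) *\<^sub>R (a - a\<^sup>\<star>)"
    by (simp only: scaleC_scaleC) (simp add: scaleC_minus_left scaleC_one)
  finally have "?r + \<i> *\<^sub>C ?i = (1/2) *\<^sub>R (a + a)"
    by (simp add: algebra_simps)
  then have "a = ?r + \<i> *\<^sub>C ?i" by simp
  moreover have "?r\<^sup>\<star> = ?r" "?i\<^sup>\<star> = ?i"
    by (simp_all add: adj_scaleR adj_add adj_adj add.commute adj_scaleC adj_diff scaleC_minus_left scaleC_diff_right)
  ultimately show ?thesis using that by blast
qed

text \<open>If \<open>c\<close> is strictly positive of norm less than one, then \<open>1 - (1 - c\<^sup>2)\<^sup>n\<close> is an increasing
  approximate unit.\<close>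

lemma strictly_positive_powers:
  fixes C :: "'a::{cstar_algebra, monoid_mult}"
  defines "x \<equiv> 1 - C * C"
  assumes C: "C\<^sup>\<star> = C" and nC: "norm C \<le> 1/2"
  shows "cpos (x ^ n)" "norm (x ^ n) \<le> 1" "norm (1 - x ^ n) \<le> 1"
    and "C * x ^ n = x ^ n * C" "(\<lambda>n. x ^ n * C) \<longlonglongrightarrow> 0"
    and "\<exists>y. x ^ n * y = 1 \<and> y * x ^ n = 1"
    and "m \<le> n \<Longrightarrow> \<exists>q. cpos q \<and> x ^ m - x ^ n = C * q * C"
proof -
  let ?h = "C * C"
  have nh: "norm ?h \<le> 1/4"
    using norm_mult_ineq[of C C] mult_mono[OF nC nC] by simp
  have h: "cpos ?h" by (rule cpos_square[OF C])
  have x: "cpos x"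
    using cpos_const_diff[of ?h 1] nh by (simp add: x_def adj_mult C)
  show xn: "cpos (x ^ n)" for n by (rule cpos_power[OF x])
  have "norm x \<le> 1" by (rule cpos_norm_le[OF x]) (simp_all add: x_def h)
  then have nx: "norm (x ^ n) \<le> 1" for n
  proof (induction n)
    case (Suc n)
    then show ?case using norm_mult_ineq[of x "x ^ n"] mult_le_one[of "norm x" "norm (x ^ n)"] by simp
  qed (simp add: norm_one_le)
  then show "norm (x ^ n) \<le> 1" .
  have c1: "cpos (1 - x ^ n)" for n
    using cpos_const_diff[OF cpos_adj[OF xn] nx] by simp
  show n1: "norm (1 - x ^ n) \<le> 1" for n
    by (rule cpos_norm_le[OF c1]) (simp_all add: xn)
  show Cx: "C * x ^ n = x ^ n * C" for n
  proof (induction n)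
    case (Suc n)
    have "C * x = x * C" by (simp add: x_def algebra_simps)
    then show ?case using Suc by (metis mult.assoc power_Suc)
  qed simp
  \<comment> \<open>Here \<open>norm (1 - x)\<close> is at most 1/4. Invertibility is recorded for
    conjugating inequalities by the powers of \<open>x\<close>.\<close>
  obtain y where y: "x * y = 1" "y * x = 1"
    using inverse_near_one[of x] nh by (auto simp: x_def)
  then show "\<exists>y. x ^ n * y = 1 \<and> y * x ^ n = 1"
    by (metis left_right_inverse_power power_commutes mult_1_left mult_1_right power_one)
  \<comment> \<open>The witness is the sum of the powers with exponents from \<open>m\<close> to
    \<open>n - 1\<close>. Having \<open>C\<close> on both sides lets a root of \<open>q\<close>,
    found only among the multipliers, be absorbed into the algebra later.\<close>
  show "\<exists>q. cpos q \<and> x ^ m - x ^ n = C * q * C" if "m \<le> n" for m n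
    using that
  proof (induction n rule: dec_induct)
    case base
    then show ?case using cpos_zero by (intro exI[of _ 0]) simp
  next
    case (step n)
    then obtain q where q: "cpos q" "x ^ m - x ^ n = C * q * C" by blast
    have "x ^ n - x ^ Suc n = x ^ n * (1 - x)" by (simp add: algebra_simps power_commutes)
    also have "\<dots> = x ^ n * C * C" by (simp add: x_def mult.assoc)
    also have "\<dots> = C * x ^ n * C" by (simp only: Cx)
    finally have "x ^ m - x ^ Suc n = C * (q + x ^ n) * C"
      using q(2) by (simp add: distrib_left distrib_right) (metis add.commute diff_add_cancel add_diff_eq)
    then show ?case using cpos_add[OF q(1) xn] by blast
  qed
  have decr: "cpos (x ^ k * ?h - x ^ n * ?h)" if "k \<le> n" for k n
    using that
  proof (induction n rule: dec_induct)
    case base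
    then show ?case by (simp add: cpos_zero)
  next
    case (step n)
    have xh: "x ^ n * ?h = ?h * x ^ n" for n by (metis Cx mult.assoc)
    have "x ^ n * ?h - x ^ Suc n * ?h = x ^ n * (?h * ?h)"
    proof -
      have "x ^ Suc n = x ^ n - x ^ n * ?h"
        by (simp only: power_Suc2) (simp add: x_def algebra_simps)
      then show ?thesis by (simp only: left_diff_distrib) (simp add: mult.assoc)
    qed
    moreover have "cpos (x ^ n * (?h * ?h))"
      by (rule cpos_mult[OF xn cpos_mult[OF h h refl]]) (metis xh mult.assoc)
    ultimately show ?case using cpos_add[OF step.IH] by (metis diff_add_cancel add_diff_eq)
  qed
  \<comment> \<open>Since \<open>1 - x = C * C\<close>, the sum of \<open>x ^ k * (C * C)\<close>
    over \<open>k < n\<close> telescopes to \<open>1 - x ^ n\<close>, of norm at most one. Each of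
    its \<open>n\<close> summands dominates \<open>x ^ n * (C * C)\<close>, whence the rate
    \<open>1 / n\<close>.\<close>
  have xh_bound: "real n * norm (x ^ n * ?h) \<le> 1" for n
  proof -
    have telescope: "(\<Sum>k<n. x ^ k * ?h) = 1 - x ^ n" for n
    proof (induction n)
      case (Suc n)
      have "x ^ Suc n = x ^ n - x ^ n * ?h"
        by (simp only: power_Suc2) (simp add: x_def algebra_simps)
      then show ?case using Suc by simp
    qed simp
    have "cpos ((\<Sum>k<n. x ^ k * ?h - x ^ n * ?h))"
      by (intro cpos_sum decr) simp
    also have "(\<Sum>k<n. x ^ k * ?h - x ^ n * ?h) = (1 - x ^ n) - real n *\<^sub>R (x ^ n * ?h)"
      by (simp add: sum_subtractf telescope sum_constant_scaleR)
    finally have diff: "cpos ((1 - x ^ n) - real n *\<^sub>R (x ^ n * ?h))" .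
    have "x ^ n * ?h = ?h * x ^ n" by (metis Cx mult.assoc)
    then have "cpos (real n *\<^sub>R (x ^ n * ?h))" by (intro cpos_scaleR cpos_mult xn h) simp_all
    from cpos_mono[OF this diff] have "norm (real n *\<^sub>R (x ^ n * ?h)) \<le> norm (1 - x ^ n)" .
    then show ?thesis using n1[of n] by simp
  qed
  \<comment> \<open>Adding the trivial bound 1 on the norm of \<open>x ^ n * ?h\<close> to the
    previous one turns the rate into \<open>2 / (n + 1)\<close>, valid from \<open>n = 0\<close>
    on.\<close>
  have bound: "(norm (x ^ n * C))\<^sup>2 \<le> inverse (real (Suc n)) * 2" for n
  proof -
    have "(norm (x ^ n * C))\<^sup>2 = norm (x ^ n * ?h * x ^ n)"
      using cstar_identity'[of "x ^ n * C"] by (simp add: adj_mult C cpos_adj[OF xn] mult.assoc)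
    also have "\<dots> \<le> norm (x ^ n * ?h) * 1"
      by (rule norm_mult_ineq[THEN order_trans]) (intro mult_left_mono nx norm_ge_zero)
    also have "\<dots> \<le> inverse (real (Suc n)) * 2"
    proof -
      have "norm (x ^ n * ?h) \<le> norm (x ^ n) * norm ?h" by (rule norm_mult_ineq)
      also have "\<dots> \<le> 1 * 1" using nx nh by (intro mult_mono) (auto intro: order_trans)
      finally show ?thesis using xh_bound[of n] by (simp add: field_simps)
    qed
    finally show ?thesis .
  qed
  have "(\<lambda>n. (norm (x ^ n * C))\<^sup>2) \<longlonglongrightarrow> 0"
    by (rule tendsto_sandwich[OF _ _ tendsto_const tendsto_mult_left_zero[OF LIMSEQ_inverse_real_of_nat, of 2]])
       (auto simp del: of_nat_Suc intro!: always_eventually bound)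
  then show "(\<lambda>n. x ^ n * C) \<longlonglongrightarrow> 0"
    by (simp add: power_tendsto_0_iff tendsto_norm_zero_iff)
qed

text \<open>The element \<open>c\<close> is a weighted sum of squares built from the self-adjoint
  parts of a dense sequence, hence strictly positive: it dominates every summand \<open>t n\<close>.
  Conjugating this inequality by \<open>x ^ N\<close>, and using that \<open>x ^ N * C\<close> tends
  to zero, shows that \<open>1 - x ^ N\<close> acts as an approximate unit on each
  \<open>d n\<close> and by density everywhere.\<close>

lemma separable_approx_unit:
  assumes "separable_space (euclidean :: 'a::cstar_algebra topology)"
  obtains e :: "nat \<Rightarrow> 'a::cstar_algebra"
  where "increasing_approx_unit (range e)" "filterlim e (tail_filter (range e)) sequentially"
proof -
  obtain s :: "nat \<Rightarrow> 'a" where s: "\<And>a \<epsilon>. \<epsilon> > 0 \<Longrightarrow> \<exists>n. dist (s n) a < \<epsilon>"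
    by (rule separable_dense_sequence[OF assms]) blast
  define re where "re a = (1/2) *\<^sub>R (a + a\<^sup>\<star>)" for a :: 'a
  have re_sa: "(re a)\<^sup>\<star> = re a" for a
    by (simp add: re_def adj_scaleR adj_add adj_adj add.commute)
  have re_norm: "norm (re a) \<le> norm a" for a
    using norm_triangle_ineq[of a "a\<^sup>\<star>"] by (simp add: re_def norm_adj)
  have re_diff: "re (a - b) = re a - re b" for a b
    by (simp add: re_def adj_diff algebra_simps)
  define d where "d n = (1 / (1 + norm (re (s n)))) *\<^sub>R re (s n)" for n
  have d_sa: "(d n)\<^sup>\<star> = d n" for n by (simp add: d_def adj_scaleR re_sa)
  have d_norm: "norm (d n) \<le> 1" for n
    using add_pos_nonneg[of 1 "norm (re (s n))"] by (simp add: d_def divide_le_eq_1)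
  have re_d: "re (s n) = (1 + norm (re (s n))) *\<^sub>R d n" for n
    using norm_ge_zero[of "re (s n)"] by (simp add: d_def add_nonneg_eq_0_iff)
  \<comment> \<open>The weights add up to 1/2, which gives the bound on \<open>norm c\<close>
    required by \<open>strictly_positive_powers\<close>.\<close>
  define t where "t n = (1/2) ^ (n + 2) *\<^sub>R (d n * d n)" for n
  have t_norm: "norm (t n) \<le> (1/4) * (1/2) ^ n" for n
  proof -
    have "norm (d n * d n) \<le> 1"
      using norm_mult_ineq[of "d n" "d n"] mult_le_one[of "norm (d n)" "norm (d n)"] d_norm[of n] by simp
    then show ?thesis
      using mult_left_mono[of "norm (d n * d n)" 1 "(1/4) * (1/2) ^ n :: real"] by (simp add: t_def)
  qed
  have geo: "(\<lambda>n. (1/4) * (1/2) ^ n :: real) sums (1/2)"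
    using sums_mult[OF geometric_sums[of "1/2::real"], of "1/4"] by simp
  have t_summable: "summable t"
    by (rule summable_comparison_test'[OF sums_summable[OF geo]]) (rule t_norm)
  define c where "c = suminf t"
  have c_lim: "(\<lambda>N. sum t {..<N}) \<longlonglongrightarrow> c"
    unfolding c_def by (rule summable_LIMSEQ[OF t_summable])
  have c_norm: "norm c \<le> 1/2"
    unfolding c_def using norm_suminf_le[OF t_norm sums_summable[OF geo]]
    by (simp only: sums_unique[OF geo, symmetric])
  have c_sa: "c\<^sup>\<star> = c"
    using LIMSEQ_unique[OF tendsto_adj[OF c_lim]] c_lim
    by (simp add: adj_sum t_def adj_scaleR adj_mult d_sa)
  define C where "C = mult_of c"
  define x where "x = 1 - C * C"
  have C: "C\<^sup>\<star> = C" "norm C \<le> 1/2"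
    using c_norm by (simp_all add: C_def norm_mult_of c_sa flip: mult_of_adj)
  note pw = strictly_positive_powers[OF C, folded x_def]
  have t_pos: "cpos (mult_of (t n))" for n
    unfolding t_def mult_of_scaleR mult_of_times
    by (intro cpos_scaleR cpos_square) (simp_all add: d_sa flip: mult_of_adj)
  have c_ge: "cpos (C - mult_of (t n))" for n
  proof (rule cpos_limit)
    show "cpos (\<Sum>k\<in>{..<N + Suc n} - {n}. mult_of (t k))" for N by (intro cpos_sum t_pos)
    have "(\<lambda>N. mult_of (sum t {..<N + Suc n}) - mult_of (t n)) \<longlonglongrightarrow> C - mult_of (t n)"
      unfolding C_def by (intro tendsto_intros tendsto_mult_of LIMSEQ_ignore_initial_segment[OF c_lim])
    moreover have "mult_of (sum t {..<N + Suc n}) - mult_of (t n) = (\<Sum>k\<in>{..<N + Suc n} - {n}. mult_of (t k))" for N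
      by (subst sum.remove[of "{..<N + Suc n}" n]) (simp_all add: mult_of_add mult_of_sum)
    ultimately show "(\<lambda>N. \<Sum>k\<in>{..<N + Suc n} - {n}. mult_of (t k)) \<longlonglongrightarrow> C - mult_of (t n)" by simp
  qed
  have xd: "(\<lambda>N. x ^ N * mult_of (d n)) \<longlonglongrightarrow> 0" for n
  proof -
    let ?D = "mult_of (d n)" and ?\<kappa> = "(1/2) ^ (n + 2) :: real"
    have D: "?D\<^sup>\<star> = ?D" by (simp add: d_sa flip: mult_of_adj)
    have bound: "?\<kappa> * (norm (x ^ N * ?D))\<^sup>2 \<le> norm (x ^ N * C)" for N
    proof -
      obtain y where y: "x ^ N * y = 1" "y * x ^ N = 1" using pw(6) by blast
      note conj = cpos_conjugate[OF cpos_adj[OF pw(1)] y]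
      have "?\<kappa> * (norm (x ^ N * ?D))\<^sup>2 = norm (x ^ N * mult_of (t n) * x ^ N)"
        using cstar_identity'[of "x ^ N * ?D"]
        by (simp add: adj_mult D cpos_adj[OF pw(1)] mult.assoc t_def mult_of_scaleR mult_of_times)
      also have "\<dots> \<le> norm (x ^ N * C * x ^ N)"
        using conj[OF t_pos[of n]] conj[OF c_ge[of n]]
        by (intro cpos_mono) (simp_all add: algebra_simps)
      also have "\<dots> \<le> norm (x ^ N * C) * 1"
        by (rule norm_mult_ineq[THEN order_trans]) (intro mult_left_mono pw norm_ge_zero)
      finally show ?thesis by simp
    qed
    have "(\<lambda>N. ?\<kappa> * (norm (x ^ N * ?D))\<^sup>2) \<longlonglongrightarrow> 0"
      by (rule tendsto_sandwich[OF _ always_eventually[OF allI[OF bound]] tendsto_const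
            tendsto_norm_zero[OF pw(5)]]) simp
    then have "(\<lambda>N. (norm (x ^ N * ?D))\<^sup>2) \<longlonglongrightarrow> 0"
      using tendsto_mult_left[of _ 0 sequentially "1 / ?\<kappa>"] by fastforce
    then show ?thesis by (simp add: power_tendsto_0_iff tendsto_norm_zero_iff)
  qed
  have x_sa: "(\<lambda>N. x ^ N * mult_of a) \<longlonglongrightarrow> 0" if a: "a\<^sup>\<star> = a" for a
    unfolding lim_sequentially
  proof (intro allI impI)
    fix \<epsilon> :: real assume e: "\<epsilon> > 0"
    then obtain n where n: "dist (s n) a < \<epsilon> / 2" using s[of "\<epsilon> / 2"] by auto
    have "re a = a" by (simp add: re_def a flip: scaleR_2)
    then have "norm (a - re (s n)) < \<epsilon> / 2"
      using re_norm[of "a - s n"] n by (simp add: re_diff dist_norm norm_minus_commute)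
    then have near: "norm (x ^ N * mult_of (a - re (s n))) < \<epsilon> / 2" for N
      using norm_mult_ineq[of "x ^ N" "mult_of (a - re (s n))"] pw(2)[of N]
        mult_right_mono[of "norm (x ^ N)" 1 "norm (a - re (s n))"] by (simp add: norm_mult_of)
    have "(\<lambda>N. x ^ N * mult_of (re (s n))) \<longlonglongrightarrow> 0"
      using tendsto_scaleR[OF tendsto_const[of "1 + norm (re (s n))"] xd[of n]]
      by (subst re_d) (simp add: mult_of_scaleR)
    then obtain N0 where N0: "\<And>N. N \<ge> N0 \<Longrightarrow> norm (x ^ N * mult_of (re (s n))) < \<epsilon> / 2"
      using e by (metis half_gt_zero LIMSEQ_iff diff_zero)
    have "norm (x ^ N * mult_of a) < \<epsilon>" if "N \<ge> N0" for N
    proof -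
      have "x ^ N * mult_of a = x ^ N * mult_of (a - re (s n)) + x ^ N * mult_of (re (s n))"
        by (simp add: mult_of_diff algebra_simps)
      then show ?thesis
        using norm_triangle_lt[OF field_sum_of_halves[THEN ord_less_eq_trans[OF add_strict_mono[OF near N0[OF that]]]]]
        by simp
    qed
    then show "\<exists>N0. \<forall>N\<ge>N0. dist (x ^ N * mult_of a) 0 < \<epsilon>" by auto
  qed
  have x_lim: "(\<lambda>N. x ^ N * mult_of a) \<longlonglongrightarrow> 0" for a
  proof -
    obtain r i where a: "r\<^sup>\<star> = r" "i\<^sup>\<star> = i" "a = r + \<i> *\<^sub>C i" by (rule self_adjoint_decomp)
    have "(\<lambda>N. x ^ N * mult_of r + \<i> *\<^sub>C (x ^ N * mult_of i)) \<longlonglongrightarrow> 0 + \<i> *\<^sub>C 0"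
      by (intro tendsto_add x_sa a bounded_linear.tendsto[OF bounded_linear_scaleC])
    then show ?thesis by (simp add: a(3) mult_of_add mult_of_scaleC distrib_left mult_scaleC_right scaleC_zero_right)
  qed
  \<comment> \<open>This sum telescopes to \<open>1 - x ^ n\<close> without leaving the algebra,
    since the powers only act on \<open>c * c\<close>.\<close>
  define e where "e n = (\<Sum>k<n. lmul (x ^ k) (c * c))" for n
  have e: "mult_of (e n) = 1 - x ^ n" for n
  proof (induction n)
    case (Suc n)
    have "x ^ Suc n = x ^ n - x ^ n * (C * C)"
      by (simp only: power_Suc2) (simp add: x_def algebra_simps)
    then show ?case using Suc
      by (simp add: e_def mult_of_add C_def mult_of_times flip: mult_mult_of)
  qed (simp add: e_def mult_of_zero)
  have e_pos: "positive (e n - e m)" if mn: "m \<le> n" for m n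
  proof -
    obtain q where q: "cpos q" "x ^ m - x ^ n = C * q * C" using pw(7)[OF mn] by blast
    obtain k where k: "k\<^sup>\<star> = k" "k * k = q" using cpos_sqrt[OF q(1)] by blast
    have "mult_of (e n - e m) = (k * C)\<^sup>\<star> * (k * C)"
      using q(2) by (simp add: mult_of_diff e adj_mult C k(1) mult.assoc flip: k(2))
    also have "\<dots> = mult_of ((lmul k c)\<^sup>\<star> * lmul k c)"
      by (simp add: C_def mult_of_times mult_of_adj flip: mult_mult_of)
    finally show ?thesis unfolding positive_def mult_of_inject by blast
  qed
  have e_sa: "(e n)\<^sup>\<star> = e n" for n
  proof -
    have "mult_of ((e n)\<^sup>\<star>) = mult_of (e n)"
      using cpos_adj[OF pw(1)[of n]] by (simp add: mult_of_adj e adj_diff adj_one)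
    then show ?thesis by (simp only: mult_of_inject)
  qed
  \<comment> \<open>Tails in \<open>tail_filter\<close> are taken with respect to the order, not the
    index. If an element of smaller index lies above \<open>e N\<close>, antisymmetry shows that it
    equals \<open>e N\<close>, so limits along the index are limits along the filter.\<close>
  have e_anti: "e m = e n" if mn: "m \<le> n" and em: "positive (e m - e n)" for m n
  proof -
    obtain w where w: "e m - e n = w\<^sup>\<star> * w" using em by (auto simp: positive_def)
    have "cpos (x ^ m - x ^ n)"
    proof -
      have "x ^ m - x ^ n = x ^ m * (1 - x ^ (n - m))"
        using mn by (simp add: right_diff_distrib flip: power_add)
      moreover have "cpos (1 - x ^ (n - m))"
        using cpos_const_diff[OF cpos_adj[OF pw(1)] pw(2)] by simp
      moreover have "x ^ m * (1 - x ^ (n - m)) = (1 - x ^ (n - m)) * x ^ m"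
        by (simp add: left_diff_distrib right_diff_distrib add.commute flip: power_add)
      ultimately show ?thesis using cpos_mult[OF pw(1)] by simp
    qed
    moreover have "(mult_of w)\<^sup>\<star> * mult_of w = mult_of (e m - e n)"
      by (simp add: w mult_of_times mult_of_adj)
    ultimately have "(mult_of w)\<^sup>\<star> * mult_of w = 0"
      by (intro adj_mult_self_not_negative) (simp add: mult_of_diff e)
    then have "mult_of (e m - e n) = mult_of 0"
      by (simp add: w mult_of_times mult_of_adj mult_of_zero)
    then show ?thesis unfolding mult_of_inject by simp
  qed
  have e_left: "(\<lambda>n. e n * a) \<longlonglongrightarrow> a" for a
  proof -
    have "norm (e n * a - a) = norm (x ^ n * mult_of a)" for n
      using norm_mult_of[of "e n * a - a"] by (simp add: mult_of_diff mult_of_times e algebra_simps)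
    then have "(\<lambda>n. norm (e n * a - a)) \<longlonglongrightarrow> 0"
      using tendsto_norm_zero[OF x_lim[of a]] by simp
    then show ?thesis by (simp add: tendsto_norm_zero_iff LIM_zero_iff)
  qed
  have e_right: "(\<lambda>n. a * e n) \<longlonglongrightarrow> a" for a
    using tendsto_adj[OF e_left[of "a\<^sup>\<star>"]] by (simp add: adj_mult adj_adj e_sa)
  have tail: "eventually (\<lambda>y. dist (f y) l < \<epsilon>) (tail_filter (range e))"
    if lim: "(\<lambda>n. f (e n)) \<longlonglongrightarrow> l" and pos: "\<epsilon> > 0" for f :: "'a \<Rightarrow> 'a" and l \<epsilon>
  proof -
    obtain N where N: "\<And>n. n \<ge> N \<Longrightarrow> dist (f (e n)) l < \<epsilon>"
      using lim pos by (auto simp: lim_sequentially)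
    have "dist (f (e n)) l < \<epsilon>" if le: "e N \<sqsubseteq> e n" for n
    proof (cases "N \<le> n")
      case False
      then have "e n = e N" using le e_anti[of n N] by (simp add: cstar_le_def)
      then show ?thesis using N[of N] by simp
    qed (rule N)
    then have "eventually (\<lambda>y. dist (f y) l < \<epsilon>) (principal {y \<in> range e. e N \<sqsubseteq> y})"
      by (auto simp: eventually_principal)
    then show ?thesis
      unfolding tail_filter_def by (rule filter_leD[OF INF_lower, rotated]) simp
  qed
  have "increasing_approx_unit (range e)"
    unfolding increasing_approx_unit_def
  proof (intro conjI allI ballI)
    fix y assume "y \<in> range e"
    then obtain n where y: "y = e n" by blast
    show "positive y" using e_pos[of 0 n] by (simp add: y e_def)
    show "norm y \<le> 1" using pw(3)[of n] norm_mult_of[of "e n"] by (simp add: y e)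
  next
    fix y z assume "y \<in> range e" "z \<in> range e"
    then obtain m n where "y = e m" "z = e n" by blast
    then show "\<exists>z'\<in>range e. y \<sqsubseteq> z' \<and> z \<sqsubseteq> z'"
      by (intro bexI[of _ "e (max m n)"]) (auto simp: cstar_le_def e_pos)
  qed (auto simp: tendsto_iff intro: tail[OF e_left] tail[OF e_right])
  moreover have "filterlim e (tail_filter (range e)) sequentially"
    unfolding tail_filter_def filterlim_INF filterlim_principal
    by (auto simp: cstar_le_def eventually_sequentially intro: e_pos)
  ultimately show ?thesis using that by blast
qed

section \<open>Strict convergence\<close>

lemma mult_divide_succ_le: "0 \<le> c \<Longrightarrow> 0 \<le> \<epsilon> \<Longrightarrow> c * (\<epsilon> / (c + 1)) \<le> \<epsilon>" for c \<epsilon> :: real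
  by (simp add: pos_divide_le_eq add_nonneg_pos algebra_simps)

lemma filterlim_sequentially_not_bot: "filterlim f F sequentially \<Longrightarrow> F \<noteq> bot"
  by (auto simp: filterlim_def bot_unique filtermap_bot_iff)

lemma tendsto_approx:
  fixes f :: "'i \<Rightarrow> 'm::metric_space"
  assumes "\<And>\<epsilon>. \<epsilon> > 0 \<Longrightarrow> \<exists>h l'. (h \<longlongrightarrow> l') F \<and> (\<forall>\<^sub>F x in F. dist (h x) (f x) \<le> \<epsilon>) \<and> dist l' l \<le> \<epsilon>"
  shows "(f \<longlongrightarrow> l) F"
proof (rule tendstoI)
  fix \<epsilon> :: real assume "\<epsilon> > 0"
  then obtain h l' where h: "(h \<longlongrightarrow> l') F" "\<forall>\<^sub>F x in F. dist (h x) (f x) \<le> \<epsilon> / 4" "dist l' l \<le> \<epsilon> / 4"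
    using assms[of "\<epsilon> / 4"] by auto
  have "\<forall>\<^sub>F x in F. dist (h x) l' < \<epsilon> / 4" using h(1) \<open>\<epsilon> > 0\<close> by (intro tendstoD) auto
  with h(2) show "\<forall>\<^sub>F x in F. dist (f x) l < \<epsilon>"
  proof eventually_elim
    case (elim x)
    then show ?case
      using h(3) dist_triangle2[of "f x" l' "h x"] dist_triangle[of "f x" l l'] \<open>\<epsilon> > 0\<close>
      by (simp add: dist_commute)
  qed
qed

lemma convergent_approx:
  fixes f :: "nat \<Rightarrow> 'm::complete_space"
  assumes "\<And>\<epsilon>. \<epsilon> > 0 \<Longrightarrow> \<exists>h. convergent h \<and> (\<forall>n. dist (h n) (f n) \<le> \<epsilon>)"
  shows "convergent f"
proof -
  have "Cauchy f"
  proof (rule metric_CauchyI)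
    fix \<epsilon> :: real assume "\<epsilon> > 0"
    then obtain h where h: "convergent h" "\<And>n. dist (h n) (f n) \<le> \<epsilon> / 4"
      using assms[of "\<epsilon> / 4"] by auto
    obtain N where N: "\<And>m n. m \<ge> N \<Longrightarrow> n \<ge> N \<Longrightarrow> dist (h m) (h n) < \<epsilon> / 4"
      using metric_CauchyD[OF convergent_Cauchy[OF h(1)], of "\<epsilon> / 4"] \<open>\<epsilon> > 0\<close> by auto
    have "dist (f m) (f n) < \<epsilon>" if "m \<ge> N" "n \<ge> N" for m n
      using h(2)[of m] h(2)[of n] N[OF that] \<open>\<epsilon> > 0\<close>
        dist_triangle2[of "f m" "h n" "h m"] dist_triangle[of "f m" "f n" "h n"]
      by (simp add: dist_commute)
    then show "\<exists>N. \<forall>m\<ge>N. \<forall>n\<ge>N. dist (f m) (f n) < \<epsilon>" by blast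
  qed
  then show ?thesis by (rule Cauchy_convergent)
qed

section \<open>Multipliers and strict limits\<close>

lemma mult_left_cancel_all:
  fixes x y :: "'a::cstar_algebra"
  assumes "\<And>b. x * b = y * b"
  shows "x = y"
proof -
  have "(x - y) * (x - y)\<^sup>\<star> = 0" by (simp only: left_diff_distrib assms) simp
  then show ?thesis using cstar_identity'[of "x - y"] by simp
qed

lemma multiplier_eqI_lmul:
  assumes "\<And>a. lmul m a = lmul n a"
  shows "m = n"
proof (rule multiplier_eqI)
  show "rmul m = rmul n"
    by (rule ext, rule mult_left_cancel_all) (simp add: rmul_lmul assms)
qed (use assms in auto)

lemma multiplier_eqI_rmul:
  assumes "\<And>a. rmul m a = rmul n a"
  shows "m = n"
proof -
  have "m\<^sup>\<star> = n\<^sup>\<star>" by (rule multiplier_eqI_lmul) (simp add: lmul_adj assms)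
  then show ?thesis by (metis adj_adj)
qed

lemma lmul_add: "lmul m (a + b) = lmul m a + lmul m b"
  and rmul_add: "rmul m (a + b) = rmul m a + rmul m b"
  by (rule multiplier_linear)+

lemma lmul_diff: "lmul m (a - b) = lmul m a - lmul m b"
  by (rule linear_diff[OF bounded_linear.linear[OF bounded_linear_lmul]])

lemma rmul_diff: "rmul m (a - b) = rmul m a - rmul m b"
  by (rule linear_diff[OF bounded_linear.linear[OF bounded_linear_rmul]])

lemmas tendsto_lmul = bounded_linear.tendsto[OF bounded_linear_lmul]

lemma tendsto_mult_of_iff: "((\<lambda>x. mult_of (f x)) \<longlongrightarrow> mult_of l) F \<longleftrightarrow> (f \<longlongrightarrow> l) F"
  unfolding tendsto_dist_iff[of "\<lambda>x. mult_of (f x)"] tendsto_dist_iff[of f]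
  by (simp add: dist_norm norm_mult_of flip: mult_of_diff)

lemma limitin_strict:
  "limitin strict_topology f m F \<longleftrightarrow>
     (\<forall>a. ((\<lambda>x. lmul (f x) a) \<longlongrightarrow> lmul m a) F) \<and> (\<forall>a. ((\<lambda>x. rmul (f x) a) \<longlongrightarrow> rmul m a) F)"
  by (simp add: limitin_strict_iff mult_mult_of mult_of_mult tendsto_mult_of_iff)

text \<open>In general, multiplication is not jointly continuous in the strict topology, but it is
  on norm-bounded sets; hence the eventual bound here and in the lemmas built on this one.\<close>

lemma strict_lmul:
  assumes "limitin strict_topology f m F" "\<forall>\<^sub>F x in F. norm (f x) \<le> C" "(b \<longlongrightarrow> c) F"
  shows "((\<lambda>x. lmul (f x) (b x)) \<longlongrightarrow> lmul m c) F"
proof -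
  have "((\<lambda>x. norm (lmul (f x) (b x - c))) \<longlongrightarrow> 0) F"
  proof (rule tendsto_sandwich[OF _ _ tendsto_const])
    show "\<forall>\<^sub>F x in F. norm (lmul (f x) (b x - c)) \<le> C * norm (b x - c)"
      using assms(2) by eventually_elim (rule order_trans[OF norm_lmul], simp add: mult_right_mono)
    show "((\<lambda>x. C * norm (b x - c)) \<longlongrightarrow> 0) F"
      using assms(3) by (intro tendsto_mult_right_zero tendsto_norm_zero) (simp add: LIM_zero_iff)
  qed simp
  then have "((\<lambda>x. lmul (f x) (b x - c)) \<longlongrightarrow> 0) F" by (simp add: tendsto_norm_zero_iff)
  moreover have "((\<lambda>x. lmul (f x) c) \<longlongrightarrow> lmul m c) F" using assms(1) by (simp add: limitin_strict)
  ultimately show ?thesis using tendsto_add[of _ 0 F _ "lmul m c"] by (fastforce simp: lmul_diff)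
qed

lemma strict_adj: "limitin strict_topology f m F \<Longrightarrow> limitin strict_topology (\<lambda>x. (f x)\<^sup>\<star>) (m\<^sup>\<star>) F"
  by (auto simp: limitin_strict lmul_adj rmul_adj intro!: tendsto_adj)

lemma strict_rmul:
  assumes "limitin strict_topology f m F" "\<forall>\<^sub>F x in F. norm (f x) \<le> C" "(b \<longlongrightarrow> c) F"
  shows "((\<lambda>x. rmul (f x) (b x)) \<longlongrightarrow> rmul m c) F"
  using tendsto_adj[OF strict_lmul[OF strict_adj[OF assms(1)] _ tendsto_adj[OF assms(3)]]] assms(2)
  by (simp add: norm_adj lmul_adj adj_adj)

lemma strict_mult:
  assumes "limitin strict_topology f m F" "\<forall>\<^sub>F x in F. norm (f x) \<le> C"
    and "limitin strict_topology g n F" "\<forall>\<^sub>F x in F. norm (g x) \<le> D"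
  shows "limitin strict_topology (\<lambda>x. f x * g x) (m * n) F"
  unfolding limitin_strict lmul_times rmul_times
proof (intro conjI allI)
  fix a
  show "((\<lambda>x. lmul (f x) (lmul (g x) a)) \<longlongrightarrow> lmul m (lmul n a)) F"
    using assms(3) by (intro strict_lmul[OF assms(1,2)]) (simp add: limitin_strict)
  show "((\<lambda>x. rmul (g x) (rmul (f x) a)) \<longlongrightarrow> rmul n (rmul m a)) F"
    using assms(1) by (intro strict_rmul[OF assms(3,4)]) (simp add: limitin_strict)
qed

lemma strict_const: "limitin strict_topology (\<lambda>_. m) m F"
  by (simp add: limitin_strict topspace_strict)

lemma strict_unique:
  assumes "limitin strict_topology f m F" "limitin strict_topology f n F" "F \<noteq> bot"
  shows "m = n"
  using assms by (intro multiplier_eqI_lmul) (auto simp: limitin_strict intro: tendsto_unique)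

section \<open>Unitary multipliers\<close>

lemma unitary_adj: "unitary u \<Longrightarrow> unitary (u\<^sup>\<star>)"
  by (simp add: unitary_def adj_adj)

lemma unitary_one: "unitary 1"
  by (simp add: unitary_def adj_one)

lemma unitary_times: "unitary u \<Longrightarrow> unitary v \<Longrightarrow> unitary (u * v)"
  unfolding unitary_def adj_mult by (metis mult.assoc mult_1_left)

lemma unitary_cancel:
  assumes "unitary u"
  shows "u\<^sup>\<star> * (u * x) = x" "u * (u\<^sup>\<star> * x) = x" "u\<^sup>\<star> * u = 1" "u * u\<^sup>\<star> = 1"
  using assms by (simp_all add: unitary_def flip: mult.assoc)

lemma unitary_lmul_cancel:
  assumes "unitary u"
  shows "lmul (u\<^sup>\<star>) (lmul u b) = b" "lmul u (lmul (u\<^sup>\<star>) b) = b"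
    and "rmul (u\<^sup>\<star>) (rmul u b) = b" "rmul u (rmul (u\<^sup>\<star>) b) = b"
  using assms
  by (simp_all add: unitary_def flip: lmul_times rmul_times fun_cong[OF lmul_times] fun_cong[OF rmul_times])
     (simp_all add: multiplier_ops)

lemma norm_lmul_unitary:
  assumes "unitary u"
  shows "norm (lmul u b) = norm b"
proof (rule antisym)
  have le: "norm (lmul w c) \<le> norm c" if "unitary w" for w :: "'a multiplier" and c
    using norm_lmul[of w c] mult_right_mono[OF norm_unitary_le[OF that] norm_ge_zero[of c]] by simp
  show "norm (lmul u b) \<le> norm b" by (rule le[OF assms])
  show "norm b \<le> norm (lmul u b)"
    using le[OF unitary_adj[OF assms], of "lmul u b"] by (simp add: unitary_lmul_cancel[OF assms])
qed

lemma norm_rmul_unitary: "unitary u \<Longrightarrow> norm (rmul u b) = norm b"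
  using norm_lmul_unitary[OF unitary_adj, of u "b\<^sup>\<star>"] by (simp add: lmul_adj norm_adj adj_adj)

text \<open>For unitaries, \<open>norm (lmul u b - c) = norm (b - lmul (u\<^sup>\<star>) c)\<close>.\<close>

lemma unitary_strict_of_rmul:
  assumes u: "\<forall>\<^sub>F x in F. unitary (f x)" and m: "unitary m"
    and lim: "\<And>a. ((\<lambda>x. rmul (f x) a) \<longlongrightarrow> rmul m a) F"
  shows "limitin strict_topology f m F"
  unfolding limitin_strict
proof (intro conjI allI lim)
  fix b
  define c where "c = lmul m b"
  have "((\<lambda>x. lmul ((f x)\<^sup>\<star>) c) \<longlongrightarrow> lmul (m\<^sup>\<star>) c) F"
    unfolding lmul_adj by (intro tendsto_adj lim)
  then have "((\<lambda>x. norm (lmul ((f x)\<^sup>\<star>) c - b)) \<longlongrightarrow> 0) F"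
    by (simp add: c_def unitary_lmul_cancel[OF m] tendsto_norm_zero_iff LIM_zero_iff)
  moreover have "\<forall>\<^sub>F x in F. norm (lmul ((f x)\<^sup>\<star>) c - b) = norm (lmul (f x) b - c)"
    using u
  proof eventually_elim
    case (elim x)
    have "norm (lmul ((f x)\<^sup>\<star>) c - b) = norm (lmul (f x) (lmul ((f x)\<^sup>\<star>) c - b))"
      by (simp add: norm_lmul_unitary[OF elim])
    then show ?case by (simp add: lmul_diff unitary_lmul_cancel[OF elim] norm_minus_commute)
  qed
  ultimately have "((\<lambda>x. norm (lmul (f x) b - c)) \<longlongrightarrow> 0) F"
    by (rule Lim_transform_eventually)
  then show "((\<lambda>x. lmul (f x) b) \<longlongrightarrow> lmul m b) F"
    by (simp add: c_def tendsto_norm_zero_iff LIM_zero_iff)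
qed

text \<open>Convergence of one action does not imply convergence of the other, even for unitaries: a
  proper isometry may appear as the limit. This is why the intertwining has to control the adjoints
  of the cocycles as well.\<close>

lemma strict_limit_exists:
  fixes f :: "nat \<Rightarrow> 'a::cstar_algebra multiplier"
  assumes bound: "\<And>n. norm (f n) \<le> C"
    and l: "\<And>a. convergent (\<lambda>n. lmul (f n) a)" and r: "\<And>a. convergent (\<lambda>n. rmul (f n) a)"
  obtains m where "limitin strict_topology f m sequentially"
proof -
  define L where "L a = lim (\<lambda>n. lmul (f n) a)" for a
  define R where "R a = lim (\<lambda>n. rmul (f n) a)" for a
  have L: "(\<lambda>n. lmul (f n) a) \<longlonglongrightarrow> L a" and R: "(\<lambda>n. rmul (f n) a) \<longlonglongrightarrow> R a" for a
    using l r by (simp_all add: L_def R_def convergent_LIMSEQ_iff)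
  note scl = bounded_linear.tendsto[OF bounded_linear_scaleC]
  have "L (a + b) = L a + L b" "R (a + b) = R a + R b" for a b
    by (rule LIMSEQ_unique[OF L], simp add: lmul_add tendsto_add L)
       (rule LIMSEQ_unique[OF R], simp add: rmul_add tendsto_add R)
  moreover have "L (c *\<^sub>C a) = c *\<^sub>C L a" "R (c *\<^sub>C a) = c *\<^sub>C R a" for c a
    by (rule LIMSEQ_unique[OF L], simp add: lmul_scaleC scl L)
       (rule LIMSEQ_unique[OF R], simp add: rmul_scaleC scl R)
  moreover have "norm (L a) \<le> norm a * C" for a
    using norm_lmul[THEN order_trans, OF mult_right_mono[OF bound norm_ge_zero]]
    by (intro LIMSEQ_le_const2[OF tendsto_norm[OF L]]) (auto simp: mult.commute)
  moreover have "norm (R a) \<le> norm a * C" for a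
    using norm_rmul[THEN order_trans, OF mult_right_mono[OF bound norm_ge_zero]]
    by (intro LIMSEQ_le_const2[OF tendsto_norm[OF R]]) (auto simp: mult.commute)
  ultimately have "bounded_clinear L" "bounded_clinear R"
    unfolding bounded_clinear_def
    by (auto intro!: bounded_linear_intro[where K = C] simp: scaleR_scaleC)
  moreover have "L (a * b) = L a * b" for a b
    by (rule LIMSEQ_unique[OF L]) (auto simp: lmul_mult intro!: tendsto_intros L)
  moreover have "R (a * b) = a * R b" for a b
    by (rule LIMSEQ_unique[OF R]) (auto simp: rmul_mult intro!: tendsto_intros R)
  moreover have "R a * b = a * L b" for a b
    by (rule LIMSEQ_unique[of "\<lambda>n. rmul (f n) a * b"])
       (intro tendsto_intros R, simp add: rmul_lmul tendsto_mult_left L)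
  ultimately have "(L, R) \<in> double_centralizers" by (simp add: double_centralizers_def)
  then have "limitin strict_topology f (Abs_multiplier (L, R)) sequentially"
    by (simp add: limitin_strict lmul_Abs rmul_Abs L R)
  then show ?thesis by (rule that)
qed

lemma unitary_strict_limit:
  assumes f: "limitin strict_topology f m F" and u: "\<forall>\<^sub>F x in F. unitary (f x)" and F: "F \<noteq> bot"
  shows "unitary m"
proof -
  have n: "\<forall>\<^sub>F x in F. norm (f x) \<le> 1" "\<forall>\<^sub>F x in F. norm ((f x)\<^sup>\<star>) \<le> 1"
    using u by (eventually_elim, simp add: norm_unitary_le norm_adj)+
  have "limitin strict_topology (\<lambda>x. (f x)\<^sup>\<star> * f x) 1 F" "limitin strict_topology (\<lambda>x. f x * (f x)\<^sup>\<star>) 1 F"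
    using u by (auto simp: unitary_def elim!: eventually_mono
        intro!: limitin_transform_eventually[OF _ strict_const[of 1]])
  then show ?thesis
    unfolding unitary_def
    using strict_unique[OF strict_mult[OF strict_adj[OF f] n(2) f n(1)] _ F]
      strict_unique[OF strict_mult[OF f n(1) strict_adj[OF f] n(2)] _ F] by blast
qed

section \<open>Extension of homomorphisms to multipliers\<close>

lemma star_iso_inv:
  assumes "star_iso f"
  shows "star_iso (inv f)" "inv f (f a) = a" "f (inv f b) = b" "inv (inv f) = f" "star_hom f"
proof -
  have b: "bij f" and f: "star_hom f" using assms by (auto simp: star_iso_def)
  then show i: "inv f (f a) = a" "f (inv f b) = b" for a b
    by (simp_all add: bij_is_inj bij_is_surj surj_f_inv_f)
  have "star_hom (inv f)"
    unfolding star_hom_def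
    by (intro conjI allI injD[OF bij_is_inj[OF b]])
       (simp_all add: i star_hom_add[OF f] star_hom_scaleC[OF f] star_hom_mult[OF f] star_hom_adj[OF f])
  then show "star_iso (inv f)" by (simp add: star_iso_def b bij_imp_bij_inv)
  show "inv (inv f) = f" by (rule inv_inv_eq[OF b])
qed (use assms in \<open>simp add: star_iso_def\<close>)

lemma star_hom_bounded_clinear: "star_hom f \<Longrightarrow> bounded_clinear f"
  by (simp add: bounded_clinear_def star_hom_bounded_linear star_hom_scaleC)

lemma bounded_clinear_compose: "bounded_clinear f \<Longrightarrow> bounded_clinear g \<Longrightarrow> bounded_clinear (f \<circ> g)"
  unfolding bounded_clinear_def by (auto simp: comp_def intro: bounded_linear_compose)

lemma
  assumes "star_iso f"
  shows lmul_iso_ext: "lmul (iso_ext f m) a = f (lmul m (inv f a))"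
    and rmul_iso_ext: "rmul (iso_ext f m) a = f (rmul m (inv f a))"
proof -
  note i = star_iso_inv[OF assms]
  have g: "star_hom (inv f)" using i(1) by (simp add: star_iso_def)
  have "(f \<circ> lmul m \<circ> inv f, f \<circ> rmul m \<circ> inv f) \<in> double_centralizers"
    unfolding double_centralizers_def mem_Collect_eq prod.case
  proof (intro conjI allI)
    show "bounded_clinear (f \<circ> lmul m \<circ> inv f)" "bounded_clinear (f \<circ> rmul m \<circ> inv f)"
      by (intro bounded_clinear_compose star_hom_bounded_clinear bounded_clinear_lmul bounded_clinear_rmul i(5) g)+
    fix a b
    show "(f \<circ> lmul m \<circ> inv f) (a * b) = (f \<circ> lmul m \<circ> inv f) a * b"
      "(f \<circ> rmul m \<circ> inv f) (a * b) = a * (f \<circ> rmul m \<circ> inv f) b"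
      by (simp_all add: star_hom_mult[OF g] lmul_mult rmul_mult star_hom_mult[OF i(5)] i(3))
    have "f (rmul m (inv f a)) * f (inv f b) = f (inv f a) * f (lmul m (inv f b))"
      by (simp only: rmul_lmul flip: star_hom_mult[OF i(5)])
    then show "(f \<circ> rmul m \<circ> inv f) a * b = a * (f \<circ> lmul m \<circ> inv f) b"
      by (simp add: i(3))
  qed
  then show "lmul (iso_ext f m) a = f (lmul m (inv f a))" "rmul (iso_ext f m) a = f (rmul m (inv f a))"
    by (simp_all add: iso_ext_def lmul_Abs rmul_Abs)
qed

lemma
  assumes f: "star_iso f"
  shows lmul_iso_ext_apply: "lmul (iso_ext f m) (f a) = f (lmul m a)"
    and rmul_iso_ext_apply: "rmul (iso_ext f m) (f a) = f (rmul m a)"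
  by (simp_all add: lmul_iso_ext rmul_iso_ext f star_iso_inv[OF f])

lemma iso_ext_eqI:
  assumes f: "star_iso f" and "\<And>a. lmul m (f a) = f (lmul n a)"
  shows "m = iso_ext f n"
  by (rule multiplier_eqI_lmul) (metis assms lmul_iso_ext star_iso_inv(3))

lemma
  assumes f: "star_iso f"
  shows iso_ext_mult: "iso_ext f (m * n) = iso_ext f m * iso_ext f n"
    and iso_ext_one: "iso_ext f 1 = 1"
    and iso_ext_adj: "iso_ext f (m\<^sup>\<star>) = (iso_ext f m)\<^sup>\<star>"
    and iso_ext_diff: "iso_ext f (m - n) = iso_ext f m - iso_ext f n"
proof -
  note h = star_iso_inv(5)[OF f]
  note ap = lmul_iso_ext_apply[OF f] rmul_iso_ext_apply[OF f]
  show "iso_ext f (m * n) = iso_ext f m * iso_ext f n" "iso_ext f 1 = 1"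
    "iso_ext f (m\<^sup>\<star>) = (iso_ext f m)\<^sup>\<star>"
    "iso_ext f (m - n) = iso_ext f m - iso_ext f n"
    by (rule iso_ext_eqI[OF f, symmetric];
        simp add: multiplier_ops ap lmul_adj lmul_mult_of star_hom_mult[OF h] star_hom_diff[OF h]
          star_hom_adj[OF h, symmetric])+
qed

lemma iso_ext_unitary: "star_iso f \<Longrightarrow> unitary u \<Longrightarrow> unitary (iso_ext f u)"
  unfolding unitary_def by (metis iso_ext_adj iso_ext_mult iso_ext_one)

lemma iso_ext_inverse:
  assumes f: "star_iso f"
  shows "iso_ext (inv f) (iso_ext f m) = m" "iso_ext f (iso_ext (inv f) n) = n"
  by (rule multiplier_eqI_lmul, simp add: lmul_iso_ext star_iso_inv[OF f] f)+

lemma iso_ext_strict: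
  assumes f: "star_iso f" and g: "limitin strict_topology g m F"
  shows "limitin strict_topology (\<lambda>x. iso_ext f (g x)) (iso_ext f m) F"
  using g unfolding limitin_strict
  by (auto simp: lmul_iso_ext rmul_iso_ext f intro!: star_hom_tendsto[OF star_iso_inv(5)[OF f]])

text \<open>Separability supplies the approximate unit to which the hypothesis \<open>ext\<close> is
  applied; it turns the definite descriptions \<open>P\<close> and \<open>mext\<close> into limits
  along a sequence.\<close>

locale extendible_star_hom =
  fixes \<phi> :: "'a::cstar_algebra \<Rightarrow> 'b::cstar_algebra"
  assumes hom: "star_hom \<phi>" and ext: "extendible (mult_of \<circ> \<phi>)"
    and sep: "separable_space (euclidean :: 'a topology)"
begin

abbreviation P where "P \<equiv> unit_limit (mult_of \<circ> \<phi>)"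
abbreviation mext where "mext \<equiv> multiplier_ext (mult_of \<circ> \<phi>)"
abbreviation uext where "uext \<equiv> unitary_ext (mult_of \<circ> \<phi>)"

lemma approx_unit_limit_absorb:
  assumes E: "increasing_approx_unit E" "tail_filter E \<noteq> bot"
    and q: "limitin strict_topology (mult_of \<circ> \<phi>) q (tail_filter E)"
  shows "lmul q (\<phi> a) = \<phi> a" "rmul q (\<phi> a) = \<phi> a"
proof -
  have lim: "((\<lambda>e. e * a) \<longlongrightarrow> a) (tail_filter E)" "((\<lambda>e. a * e) \<longlongrightarrow> a) (tail_filter E)"
    using E by (auto simp: increasing_approx_unit_def)
  have "((\<lambda>e. \<phi> e * \<phi> a) \<longlongrightarrow> lmul q (\<phi> a)) (tail_filter E)"
    "((\<lambda>e. \<phi> a * \<phi> e) \<longlongrightarrow> rmul q (\<phi> a)) (tail_filter E)"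
    using q by (auto simp: limitin_strict lmul_mult_of rmul_mult_of)
  moreover have "((\<lambda>e. \<phi> e * \<phi> a) \<longlongrightarrow> \<phi> a) (tail_filter E)" "((\<lambda>e. \<phi> a * \<phi> e) \<longlongrightarrow> \<phi> a) (tail_filter E)"
    using star_hom_tendsto[OF hom lim(1)] star_hom_tendsto[OF hom lim(2)] by (simp_all add: star_hom_mult[OF hom])
  ultimately show "lmul q (\<phi> a) = \<phi> a" "rmul q (\<phi> a) = \<phi> a"
    using tendsto_unique[OF E(2)] by blast+
qed

text \<open>A limit \<open>q\<close> fixes all \<open>\<phi> e\<close>, hence also their limit:
  \<open>q * p = p\<close>, and symmetrically \<open>p * q = q\<close>. Taking adjoints identifies
  the two projections.\<close>

lemma approx_unit_limit_unique:
  assumes "increasing_approx_unit E" "tail_filter E \<noteq> bot"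
    and "limitin strict_topology (mult_of \<circ> \<phi>) p (tail_filter E)" "projection p"
    and "increasing_approx_unit E'" "tail_filter E' \<noteq> bot"
    and "limitin strict_topology (mult_of \<circ> \<phi>) q (tail_filter E')" "projection q"
  shows "p = q"
proof -
  have *: "q * p = p" if E: "increasing_approx_unit E" "tail_filter E \<noteq> bot"
    and p: "limitin strict_topology (mult_of \<circ> \<phi>) p (tail_filter E)"
    and E': "increasing_approx_unit E'" "tail_filter E' \<noteq> bot"
    and q: "limitin strict_topology (mult_of \<circ> \<phi>) q (tail_filter E')" for p q E E'
  proof (rule multiplier_eqI_lmul)
    fix b
    have "((\<lambda>e. \<phi> e * b) \<longlongrightarrow> lmul p b) (tail_filter E)"
      using p by (auto simp: limitin_strict lmul_mult_of)
    moreover from tendsto_lmul[OF this, of q]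
    have "((\<lambda>e. \<phi> e * b) \<longlongrightarrow> lmul q (lmul p b)) (tail_filter E)"
      by (simp add: lmul_mult approx_unit_limit_absorb[OF E' q])
    ultimately show "lmul (q * p) b = lmul p b"
      unfolding lmul_times using tendsto_unique[OF E(2)] by blast
  qed
  have "q * p = p" "p * q = q" using assms * by blast+
  moreover have "(q * p)\<^sup>\<star> = p * q" using assms by (simp add: adj_mult projection_def)
  ultimately show ?thesis using assms by (simp add: projection_def)
qed

lemma unit_limit_spec:
  "projection P" "increasing_approx_unit E \<Longrightarrow> limitin strict_topology (mult_of \<circ> \<phi>) P (tail_filter E)"
proof -
  obtain e :: "nat \<Rightarrow> 'a" where e: "increasing_approx_unit (range e)"
    "filterlim e (tail_filter (range e)) sequentially"
    by (rule separable_approx_unit[OF sep]) blast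
  have nb: "tail_filter (range e) \<noteq> bot"
    using e(2) by (rule filterlim_sequentially_not_bot)
  obtain p where p: "projection p" "limitin strict_topology (mult_of \<circ> \<phi>) p (tail_filter (range e))"
    using ext e(1) unfolding extendible_def by blast
  have "limitin strict_topology (mult_of \<circ> \<phi>) p (tail_filter E)" if E: "increasing_approx_unit E" for E
  \<comment> \<open>Along the trivial filter everything converges; otherwise limits are unique and
    can be compared with \<open>p\<close>.\<close>
  proof (cases "tail_filter E = bot")
    case True
    then show ?thesis by (simp add: limitin_strict)
  next
    case False
    obtain q where "projection q" "limitin strict_topology (mult_of \<circ> \<phi>) q (tail_filter E)"
      using ext E unfolding extendible_def by blast
    then show ?thesis using approx_unit_limit_unique[OF e(1) nb p(2,1) E False] by blast
  qed
  note p_lim = this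
  have "projection P \<and> (\<forall>E. increasing_approx_unit E \<longrightarrow> limitin strict_topology (mult_of \<circ> \<phi>) P (tail_filter E))"
    unfolding unit_limit_def
  proof (rule theI[of "\<lambda>p. projection p \<and> (\<forall>E. increasing_approx_unit E \<longrightarrow>
        limitin strict_topology (mult_of \<circ> \<phi>) p (tail_filter E))" p])
    fix p' assume "projection p' \<and> (\<forall>E. increasing_approx_unit E \<longrightarrow> limitin strict_topology (mult_of \<circ> \<phi>) p' (tail_filter E))"
    then show "p' = p"
      using approx_unit_limit_unique[OF e(1) nb _ _ e(1) nb p(2,1)] e(1) by blast
  qed (use p p_lim in blast)
  then show "projection P" "increasing_approx_unit E \<Longrightarrow> limitin strict_topology (mult_of \<circ> \<phi>) P (tail_filter E)"
    by blast+
qed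

lemma approx_sequence:
  obtains e :: "nat \<Rightarrow> 'a" where "\<And>n. norm (e n) \<le> 1" "\<And>a. (\<lambda>n. e n * a) \<longlonglongrightarrow> a" "\<And>a. (\<lambda>n. a * e n) \<longlonglongrightarrow> a"
    "\<And>b. (\<lambda>n. \<phi> (e n) * b) \<longlonglongrightarrow> lmul P b" "\<And>b. (\<lambda>n. b * \<phi> (e n)) \<longlonglongrightarrow> rmul P b"
proof -
  obtain e :: "nat \<Rightarrow> 'a" where e: "increasing_approx_unit (range e)"
    and lim: "filterlim e (tail_filter (range e)) sequentially"
    by (rule separable_approx_unit[OF sep]) blast
  have "norm (e n) \<le> 1" for n using e by (auto simp: increasing_approx_unit_def)
  moreover have "(\<lambda>n. e n * a) \<longlonglongrightarrow> a" "(\<lambda>n. a * e n) \<longlonglongrightarrow> a" for a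
    using e by (auto simp: increasing_approx_unit_def intro: filterlim_compose[OF _ lim])
  moreover have "(\<lambda>n. \<phi> (e n) * b) \<longlonglongrightarrow> lmul P b" "(\<lambda>n. b * \<phi> (e n)) \<longlonglongrightarrow> rmul P b" for b
    using unit_limit_spec(2)[OF e]
    by (auto simp: limitin_strict lmul_mult_of rmul_mult_of intro: filterlim_compose[OF _ lim])
  ultimately show ?thesis by (rule that)
qed

lemma P_absorb: "lmul P (\<phi> a) = \<phi> a" "rmul P (\<phi> a) = \<phi> a"
proof -
  obtain e :: "nat \<Rightarrow> 'a" where e: "increasing_approx_unit (range e)"
    "filterlim e (tail_filter (range e)) sequentially"
    by (rule separable_approx_unit[OF sep]) blast
  have "tail_filter (range e) \<noteq> bot"
    using e(2) by (rule filterlim_sequentially_not_bot)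
  from approx_unit_limit_absorb[OF e(1) this unit_limit_spec(2)[OF e(1)]]
  show "lmul P (\<phi> a) = \<phi> a" "rmul P (\<phi> a) = \<phi> a" .
qed

lemma P_projection: "P\<^sup>\<star> = P" "P * P = P"
  using unit_limit_spec(1) by (auto simp: projection_def)

text \<open>Since \<open>\<phi> (e n) * b\<close> tends to \<open>lmul P b\<close>, a multiplier
  supported on \<open>P\<close> is determined by its values on the range of \<open>\<phi>\<close>.
  This is the uniqueness principle behind the identities for extensions.\<close>

lemma eqI_on_range:
  assumes "X * P = X" "Y * P = Y" "\<And>a. lmul X (\<phi> a) = lmul Y (\<phi> a)"
  shows "X = Y"
proof (rule multiplier_eqI_lmul)
  fix b
  obtain e where e: "\<And>b. (\<lambda>n. \<phi> (e n) * b) \<longlonglongrightarrow> lmul P b" by (rule approx_sequence) blast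
  have "lmul X (lmul P b) = lmul Y (lmul P b)"
    using tendsto_lmul[OF e, of X b] tendsto_lmul[OF e, of Y b] by (simp add: lmul_mult assms(3) LIMSEQ_unique)
  then show "lmul X b = lmul Y b" using assms(1,2) by (metis lmul_times)
qed

text \<open>The lift is the strict limit of \<open>\<phi> (lmul m (e n))\<close>. For convergence,
  \<open>b\<close> is first replaced by \<open>lmul P b\<close> and that by
  \<open>\<phi> (e k) * b\<close>. With \<open>k\<close> fixed the product is
  \<open>\<phi> (lmul m (e n * e k)) * b\<close>, which converges in \<open>n\<close>, and the error
  is uniform in \<open>n\<close> because the approximants are bounded by
  \<open>norm m\<close>.\<close>

lemma multiplier_lift:
  obtains M where "P * M = M" "M * P = M"
    "\<And>a. lmul M (\<phi> a) = \<phi> (lmul m a)" "\<And>a. rmul M (\<phi> a) = \<phi> (rmul m a)"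
proof -
  obtain e :: "nat \<Rightarrow> 'a" where ne: "\<And>n. norm (e n) \<le> 1"
    and e: "\<And>a. (\<lambda>n. e n * a) \<longlonglongrightarrow> a" "\<And>a. (\<lambda>n. a * e n) \<longlonglongrightarrow> a"
    and eP: "\<And>b. (\<lambda>n. \<phi> (e n) * b) \<longlonglongrightarrow> lmul P b" "\<And>b. (\<lambda>n. b * \<phi> (e n)) \<longlonglongrightarrow> rmul P b"
    by (rule approx_sequence) blast
  define f where "f n = \<phi> (lmul m (e n))" for n
  have nf: "norm (f n) \<le> norm m" for n
    using star_hom_norm_le[OF hom, of "lmul m (e n)"] norm_lmul[of m "e n"]
      mult_left_mono[OF ne[of n] norm_ge_zero[of m]] by (simp add: f_def)
  have fP: "f n * lmul P b = f n * b" "rmul P b * f n = b * f n" for n b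
    by (simp_all add: f_def rmul_lmul[symmetric] P_absorb) (simp add: rmul_lmul P_absorb)
  have "convergent (\<lambda>n. lmul (mult_of (f n)) b)" for b
  proof (rule convergent_approx)
    fix \<epsilon> :: real assume "\<epsilon> > 0"
    then have "\<epsilon> / (norm m + 1) > 0" by (simp add: add_nonneg_pos)
    then obtain k where k: "norm (\<phi> (e k) * b - lmul P b) < \<epsilon> / (norm m + 1)"
      using eP(1)[of b] by (meson LIMSEQ_iff order.refl)
    have "(\<lambda>n. \<phi> (lmul m (e n * e k)) * b) \<longlonglongrightarrow> \<phi> (lmul m (e k)) * b"
      by (intro tendsto_intros star_hom_tendsto[OF hom] tendsto_lmul e)
    moreover have "dist (\<phi> (lmul m (e n * e k)) * b) (lmul (mult_of (f n)) b) \<le> \<epsilon>" for n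
    proof -
      have "\<phi> (lmul m (e n * e k)) * b - f n * b = f n * (\<phi> (e k) * b - lmul P b)"
        by (simp add: f_def lmul_mult star_hom_mult[OF hom] right_diff_distrib mult.assoc fP(1)[unfolded f_def])
      also have "norm \<dots> \<le> norm m * (\<epsilon> / (norm m + 1))"
        by (rule norm_mult_ineq[THEN order_trans]) (intro mult_mono nf less_imp_le[OF k] norm_ge_zero)
      also have "\<dots> \<le> \<epsilon>" using \<open>\<epsilon> > 0\<close> by (intro mult_divide_succ_le) simp_all
      finally show ?thesis by (simp add: dist_norm lmul_mult_of)
    qed
    ultimately show "\<exists>h. convergent h \<and> (\<forall>n. dist (h n) (lmul (mult_of (f n)) b) \<le> \<epsilon>)"
      by (auto simp: convergent_def)
  qed
  moreover have "convergent (\<lambda>n. rmul (mult_of (f n)) b)" for b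
  proof (rule convergent_approx)
    fix \<epsilon> :: real assume "\<epsilon> > 0"
    then have "\<epsilon> / (norm m + 1) > 0" by (simp add: add_nonneg_pos)
    then obtain k where k: "norm (b * \<phi> (e k) - rmul P b) < \<epsilon> / (norm m + 1)"
      using eP(2)[of b] by (meson LIMSEQ_iff order.refl)
    have "(\<lambda>n. b * \<phi> (rmul m (e k) * e n)) \<longlonglongrightarrow> b * \<phi> (rmul m (e k))"
      by (intro tendsto_intros star_hom_tendsto[OF hom] e)
    moreover have "dist (b * \<phi> (rmul m (e k) * e n)) (rmul (mult_of (f n)) b) \<le> \<epsilon>" for n
    proof -
      have "b * \<phi> (rmul m (e k) * e n) - b * f n = (b * \<phi> (e k) - rmul P b) * f n"
        by (simp add: f_def rmul_lmul star_hom_mult[OF hom] left_diff_distrib mult.assoc P_absorb)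
      also have "norm \<dots> \<le> (\<epsilon> / (norm m + 1)) * norm m"
        by (rule norm_mult_ineq[THEN order_trans])
           (use \<open>\<epsilon> / (norm m + 1) > 0\<close> in \<open>intro mult_mono nf less_imp_le[OF k] norm_ge_zero; simp\<close>)
      also have "\<dots> \<le> \<epsilon>"
        using \<open>\<epsilon> > 0\<close> mult_divide_succ_le[of "norm m" \<epsilon>] by (simp add: mult.commute)
      finally show ?thesis by (simp add: dist_norm rmul_mult_of)
    qed
    ultimately show "\<exists>h. convergent h \<and> (\<forall>n. dist (h n) (rmul (mult_of (f n)) b) \<le> \<epsilon>)"
      by (auto simp: convergent_def)
  qed
  ultimately obtain M where "limitin strict_topology (\<lambda>n. mult_of (f n)) M sequentially"
    using strict_limit_exists[of "\<lambda>n. mult_of (f n)" "norm m"] nf by (auto simp: norm_mult_of)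
  then have M: "(\<lambda>n. f n * b) \<longlonglongrightarrow> lmul M b" "(\<lambda>n. b * f n) \<longlonglongrightarrow> rmul M b" for b
    by (auto simp: limitin_strict lmul_mult_of rmul_mult_of)
  have "lmul M (lmul P b) = lmul M b" for b
    using M(1)[of "lmul P b"] M(1)[of b] by (simp add: fP LIMSEQ_unique)
  then have "M * P = M" by (intro multiplier_eqI_lmul) (simp add: lmul_times)
  moreover have "rmul M (rmul P b) = rmul M b" for b
    using M(2)[of "rmul P b"] M(2)[of b] by (simp add: fP LIMSEQ_unique)
  then have "P * M = M" by (intro multiplier_eqI_rmul) (simp add: rmul_times)
  moreover have "lmul M (\<phi> a) = \<phi> (lmul m a)" for a
  proof (rule LIMSEQ_unique[OF M(1)])
    have "(\<lambda>n. \<phi> (lmul m (e n * a))) \<longlonglongrightarrow> \<phi> (lmul m a)"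
      by (intro star_hom_tendsto[OF hom] tendsto_lmul e)
    then show "(\<lambda>n. f n * \<phi> a) \<longlonglongrightarrow> \<phi> (lmul m a)"
      by (simp add: f_def star_hom_mult[OF hom, symmetric] lmul_mult)
  qed
  moreover have "rmul M (\<phi> a) = \<phi> (rmul m a)" for a
  proof (rule LIMSEQ_unique[OF M(2)])
    have "(\<lambda>n. \<phi> (rmul m a * e n)) \<longlonglongrightarrow> \<phi> (rmul m a)"
      by (intro star_hom_tendsto[OF hom] e)
    then show "(\<lambda>n. \<phi> a * f n) \<longlonglongrightarrow> \<phi> (rmul m a)"
      by (simp add: f_def star_hom_mult[OF hom, symmetric] rmul_lmul)
  qed
  ultimately show ?thesis using that by blast
qed

text \<open>The map \<open>F\<close> assembled from lifts satisfies the description of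
  \<open>multiplier_ext\<close>. It is unique because multiplying \<open>F' m\<close> by
  \<open>F' (mult_of a)\<close> determines \<open>F' m\<close> on the range of
  \<open>\<phi>\<close>. For strict continuity \<open>b\<close> is again replaced by
  \<open>\<phi> (e k) * b\<close>.\<close>

lemma
  shows multiplier_ext_hom: "star_hom mext"
    and P_ext: "P * mext m = mext m" "mext m * P = mext m"
    and ext_one: "mext 1 = P"
    and lmul_ext: "lmul (mext m) (\<phi> a) = \<phi> (lmul m a)"
    and rmul_ext: "rmul (mext m) (\<phi> a) = \<phi> (rmul m a)"
proof -
  have "\<exists>F. \<forall>m. P * F m = F m \<and> F m * P = F m \<and>
      (\<forall>a. lmul (F m) (\<phi> a) = \<phi> (lmul m a)) \<and> (\<forall>a. rmul (F m) (\<phi> a) = \<phi> (rmul m a))"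
    by (rule choice) (metis multiplier_lift)
  then obtain F where F: "\<And>m. P * F m = F m" "\<And>m. F m * P = F m"
    "\<And>m a. lmul (F m) (\<phi> a) = \<phi> (lmul m a)" "\<And>m a. rmul (F m) (\<phi> a) = \<phi> (rmul m a)" by blast
  have hF: "star_hom F"
    unfolding star_hom_def
  proof (intro conjI allI)
    show "F (m + n) = F m + F n" for m n
      by (rule eqI_on_range) (simp_all add: F distrib_right multiplier_ops star_hom_add[OF hom])
    show "F (c *\<^sub>C m) = c *\<^sub>C F m" for c m
      by (rule eqI_on_range) (simp_all add: F mult_scaleC_left lmul_scaleC' star_hom_scaleC[OF hom])
    show "F (m * n) = F m * F n" for m n
      by (rule eqI_on_range) (simp_all add: F mult.assoc multiplier_ops)
    show "F (m\<^sup>\<star>) = (F m)\<^sup>\<star>" for m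
    proof (rule eqI_on_range)
      show "(F m)\<^sup>\<star> * P = (F m)\<^sup>\<star>" using F(1)[of m] by (metis adj_mult P_projection(1))
    qed (simp_all add: F lmul_adj flip: star_hom_adj[OF hom])
  qed
  have F1: "F 1 = P" by (rule eqI_on_range) (simp_all add: F P_projection P_absorb multiplier_ops)
  have Fm: "F (mult_of a) = mult_of (\<phi> a)" for a
    by (rule eqI_on_range)
       (simp_all add: F mult_of_mult P_absorb lmul_mult_of star_hom_mult[OF hom])
  have cont: "limitin strict_topology (\<lambda>x. F (g x)) (F m) G"
    if g: "limitin strict_topology g m G" "\<forall>\<^sub>F x in G. norm (g x) \<le> 1" for g m and G :: "'a multiplier filter"
  proof -
    have left: "((\<lambda>x. lmul (F (g x)) b) \<longlongrightarrow> lmul (F m) b) G"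
      if g: "limitin strict_topology g m G" "\<forall>\<^sub>F x in G. norm (g x) \<le> 1" for g m b
    proof (rule tendsto_approx)
      fix \<epsilon> :: real assume e0: "\<epsilon> > 0"
      obtain e :: "nat \<Rightarrow> 'a" where e: "\<And>b. (\<lambda>n. \<phi> (e n) * b) \<longlonglongrightarrow> lmul P b"
        by (rule approx_sequence) blast
      have "\<epsilon> / (norm (F m) + 1) > 0" using e0 by (simp add: add_nonneg_pos)
      \<comment> \<open>Two tolerances: \<open>\<epsilon>\<close> suffices for
        \<open>F (g x)\<close>, which is eventually a contraction, while \<open>F m\<close> is
        handled through its own norm.\<close>
      then obtain k where "norm (\<phi> (e k) * b - lmul P b) < min \<epsilon> (\<epsilon> / (norm (F m) + 1))"
        using e[of b] e0 by (metis LIMSEQ_iff min_less_iff_conj order.refl)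
      then have k: "norm (\<phi> (e k) * b - lmul P b) < \<epsilon>" "norm (\<phi> (e k) * b - lmul P b) < \<epsilon> / (norm (F m) + 1)"
        by auto
      have diff: "lmul (F n) (\<phi> (e k) * b) - lmul (F n) b = lmul (F n) (\<phi> (e k) * b - lmul P b)" for n
        using F(2)[of n] by (metis lmul_diff lmul_times)
      have "((\<lambda>x. \<phi> (lmul (g x) (e k)) * b) \<longlongrightarrow> \<phi> (lmul m (e k)) * b) G"
        using g(1) by (intro tendsto_intros star_hom_tendsto[OF hom]) (simp add: limitin_strict)
      then have "((\<lambda>x. lmul (F (g x)) (\<phi> (e k) * b)) \<longlongrightarrow> lmul (F m) (\<phi> (e k) * b)) G"
        by (simp add: lmul_mult F)
      moreover have "\<forall>\<^sub>F x in G. dist (lmul (F (g x)) (\<phi> (e k) * b)) (lmul (F (g x)) b) \<le> \<epsilon>"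
        using g(2)
      proof eventually_elim
        case (elim x)
        have "norm (F (g x)) \<le> 1" using star_hom_norm_le[OF hF, of "g x"] elim by simp
        then show ?case
          using norm_lmul[of "F (g x)" "\<phi> (e k) * b - lmul P b"] k(1)
            mult_right_mono[of "norm (F (g x))" 1 "norm (\<phi> (e k) * b - lmul P b)"]
          by (simp add: dist_norm diff)
      qed
      moreover have "dist (lmul (F m) (\<phi> (e k) * b)) (lmul (F m) b) \<le> \<epsilon>"
      proof -
        have "norm (lmul (F m) (\<phi> (e k) * b - lmul P b)) \<le> norm (F m) * (\<epsilon> / (norm (F m) + 1))"
          by (rule norm_lmul[THEN order_trans]) (intro mult_left_mono less_imp_le[OF k(2)] norm_ge_zero)
        also have "\<dots> \<le> \<epsilon>" using e0 by (intro mult_divide_succ_le) simp_all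
        finally show ?thesis by (simp add: dist_norm diff)
      qed
      ultimately show "\<exists>h l'. (h \<longlongrightarrow> l') G \<and> (\<forall>\<^sub>F x in G. dist (h x) (lmul (F (g x)) b) \<le> \<epsilon>) \<and>
          dist l' (lmul (F m) b) \<le> \<epsilon>" by blast
    qed
    have "((\<lambda>x. lmul (F ((g x)\<^sup>\<star>)) b) \<longlongrightarrow> lmul (F (m\<^sup>\<star>)) b) G" for b
      using g(2) by (intro left strict_adj g(1)) (simp add: norm_adj)
    from tendsto_adj[OF this[of "b\<^sup>\<star>" for b]] have "((\<lambda>x. rmul (F (g x)) b) \<longlongrightarrow> rmul (F m) b) G" for b
      by (simp add: star_hom_adj[OF hF] lmul_adj adj_adj)
    then show ?thesis using left[OF g] by (simp add: limitin_strict adj_adj)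
  qed
  have "continuous_map (subtopology strict_topology (cball 0 1)) strict_topology F"
    unfolding continuous_map_atin
  proof
    fix m :: "'a multiplier"
    let ?T = "subtopology strict_topology (cball 0 1) :: 'a multiplier topology"
    assume m: "m \<in> topspace ?T"
    have "limitin ?T (\<lambda>x. x) m (atin ?T m)"
      using continuous_map_id[of ?T] m unfolding continuous_map_atin id_def by blast
    then have "limitin strict_topology (\<lambda>x. x) m (atin ?T m)" "\<forall>\<^sub>F x in atin ?T m. norm x \<le> 1"
      by (auto simp: limitin_subtopology)
    then show "limitin strict_topology F (F m) (atin ?T m)" by (rule cont)
  qed
  then have spec: "star_hom F \<and> (\<forall>m. P * F m * P = F m) \<and> F 1 = P \<and> (\<forall>a. F (mult_of a) = (mult_of \<circ> \<phi>) a) \<and>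
      continuous_map (subtopology strict_topology (cball 0 1)) strict_topology F"
    by (simp add: hF F F1 Fm)
  have unique: "F' = F" if F': "star_hom F' \<and> (\<forall>m. P * F' m * P = F' m) \<and> F' 1 = P \<and> (\<forall>a. F' (mult_of a) = (mult_of \<circ> \<phi>) a) \<and>
      continuous_map (subtopology strict_topology (cball 0 1)) strict_topology F'" for F'
  proof
    fix m
    from F' have h: "star_hom F'" and fm: "\<And>a. F' (mult_of a) = mult_of (\<phi> a)" by auto
    show "F' m = F m"
    proof (rule eqI_on_range)
      show "F' m * P = F' m" using F' by (metis mult.assoc P_projection(2))
      fix a
      have "mult_of (lmul (F' m) (\<phi> a)) = F' m * F' (mult_of a)" by (simp add: fm mult_mult_of)
      also have "\<dots> = F' (mult_of (lmul m a))" by (simp only: mult_mult_of flip: star_hom_mult[OF h])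
      also have "\<dots> = mult_of (\<phi> (lmul m a))" by (rule fm)
      finally show "lmul (F' m) (\<phi> a) = lmul (F m) (\<phi> a)" by (simp add: F mult_of_inject)
    qed (simp add: F)
  qed
  have "mext = F"
    unfolding multiplier_ext_def by (rule the_equality) (use spec unique in blast)+
  then show "star_hom mext" "P * mext m = mext m" "mext m * P = mext m" "mext 1 = P"
    "lmul (mext m) (\<phi> a) = \<phi> (lmul m a)" "rmul (mext m) (\<phi> a) = \<phi> (rmul m a)"
    by (simp_all add: hF F F1)
qed

lemma uext_mult: "uext (m * n) = uext m * uext n"
proof -
  have "mext m * (1 - P) = 0" "(1 - P) * mext n = 0" "(1 - P) * (1 - P) = 1 - P"
    by (simp_all add: algebra_simps P_ext P_projection)
  then show ?thesis
    by (simp add: unitary_ext_def distrib_left distrib_right star_hom_mult[OF multiplier_ext_hom])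
qed

lemma uext_one: "uext 1 = 1"
  by (simp add: unitary_ext_def ext_one)

lemma uext_adj: "uext (m\<^sup>\<star>) = (uext m)\<^sup>\<star>"
  by (simp add: unitary_ext_def star_hom_adj[OF multiplier_ext_hom] adj_add adj_diff adj_one P_projection)

lemma uext_unitary: "unitary u \<Longrightarrow> unitary (uext u)"
  unfolding unitary_def by (metis uext_adj uext_mult uext_one)

lemma lmul_uext: "lmul (uext m) (\<phi> a) = \<phi> (lmul m a)"
  by (simp add: unitary_ext_def multiplier_ops lmul_ext P_absorb)

lemma rmul_uext: "rmul (uext m) (\<phi> a) = \<phi> (rmul m a)"
  by (simp add: unitary_ext_def multiplier_ops rmul_ext P_absorb)

lemma uext_complement: "uext m * (1 - P) = 1 - P"
  by (simp add: unitary_ext_def algebra_simps P_ext P_projection)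

text \<open>An extension splits along \<open>P\<close>: on the range of \<open>\<phi>\<close> it is
  given by \<open>m\<close>, and on the complement it is the identity.\<close>

lemma uext_eqI:
  assumes "Y * (1 - P) = 1 - P" "\<And>a. lmul Y (\<phi> a) = \<phi> (lmul m a)"
  shows "Y = uext m"
proof -
  have "Y * P = uext m * P"
    by (rule eqI_on_range) (simp_all add: mult.assoc P_projection multiplier_ops P_absorb assms(2) lmul_uext)
  moreover have "Y * (1 - P) = uext m * (1 - P)" by (simp add: assms(1) uext_complement)
  ultimately have "Y * P + Y * (1 - P) = uext m * P + uext m * (1 - P)" by simp
  then show ?thesis by (simp flip: distrib_left)
qed

end

section \<open>Extensions of isomorphisms\<close>

lemma star_iso_extendible:
  fixes f :: "'a::cstar_algebra \<Rightarrow> 'b::cstar_algebra"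
  assumes f: "star_iso f"
  shows "extendible (mult_of \<circ> f)"
  unfolding extendible_def
proof (intro allI impI exI[of _ 1] conjI)
  fix E :: "'a set" assume E: "increasing_approx_unit E"
  note h = star_iso_inv(5)[OF f]
  have "((\<lambda>e. f e * b) \<longlongrightarrow> b) (tail_filter E)" "((\<lambda>e. b * f e) \<longlongrightarrow> b) (tail_filter E)" for b
    using E star_hom_tendsto[OF h, of "\<lambda>e. e * inv f b" "inv f b" "tail_filter E"]
      star_hom_tendsto[OF h, of "\<lambda>e. inv f b * e" "inv f b" "tail_filter E"]
    by (simp_all add: increasing_approx_unit_def star_hom_mult[OF h] star_iso_inv[OF f])
  then show "limitin strict_topology (mult_of \<circ> f) 1 (tail_filter E)"
    by (simp add: limitin_strict lmul_mult_of rmul_mult_of multiplier_ops)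
qed (simp add: projection_def adj_one)

lemma unitary_ext_iso:
  fixes f :: "'a::cstar_algebra \<Rightarrow> 'b::cstar_algebra"
  assumes f: "star_iso f" and sep: "separable_space (euclidean :: 'a topology)"
  shows "unitary_ext (mult_of \<circ> f) m = iso_ext f m"
proof -
  interpret extendible_star_hom f
    by unfold_locales (simp_all add: star_iso_inv[OF f] star_iso_extendible[OF f] sep)
  show ?thesis by (rule iso_ext_eqI[OF f]) (rule lmul_uext)
qed

section \<open>Unitary perturbation of cocycle morphisms\<close>

text \<open>This is \<open>Ad w\<close> on the ideal itself: the value lies in the algebra and not
  in its multiplier algebra.\<close>

definition conjugate :: "'b::cstar_algebra multiplier \<Rightarrow> 'b \<Rightarrow> 'b" where
  "conjugate w b = lmul w (rmul (w\<^sup>\<star>) b)"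

text \<open>The cocycle of a perturbed morphism: if \<open>(\<phi>, u)\<close> is a cocycle morphism
  and \<open>w\<close> is unitary, then \<open>conjugate w \<circ> \<phi>\<close> satisfies the
  identities of a cocycle morphism with \<open>twist \<beta> u w\<close>. It is also what
  \<open>approx_le\<close> compares with the target cocycle.\<close>

definition twist :: "('g \<Rightarrow> 'b::cstar_algebra \<Rightarrow> 'b) \<Rightarrow> ('g \<Rightarrow> 'b multiplier) \<Rightarrow> 'b multiplier \<Rightarrow> 'g \<Rightarrow> 'b multiplier"
  where "twist \<beta> u w g = w * u g * (iso_ext (\<beta> g) w)\<^sup>\<star>"

lemma mult_of_eqD: "mult_of a = mult_of b \<Longrightarrow> a = b"
  by (simp add: mult_of_inject)

lemma mult_of_conjugate: "mult_of (conjugate w b) = w * mult_of b * w\<^sup>\<star>"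
  by (simp add: conjugate_def mult_of_mult mult.assoc flip: mult_mult_of)

lemma Ad_mult_of: "Ad w (mult_of b) = mult_of (conjugate w b)"
  by (simp add: Ad_def mult_of_conjugate)

lemma conjugate_mult: "conjugate (v * w) b = conjugate v (conjugate w b)"
  by (rule mult_of_eqD) (simp add: mult_of_conjugate adj_mult mult.assoc)

lemma conjugate_one: "conjugate 1 b = b"
  by (simp add: conjugate_def adj_one multiplier_ops)

lemma star_iso_conjugate:
  assumes w: "unitary w"
  shows "star_iso (conjugate w)"
proof -
  have "star_hom (conjugate w)"
    unfolding star_hom_def
    by (intro conjI allI; rule mult_of_eqD)
       (simp_all add: mult_of_conjugate mult_of_add mult_of_scaleC mult_of_times mult_of_adj
        distrib_left distrib_right mult_scaleC_left mult_scaleC_right adj_mult adj_adj mult.assoc unitary_cancel[OF w])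
  moreover have "bij (conjugate w)"
    by (rule o_bij[of "conjugate (w\<^sup>\<star>)"])
       (use w in \<open>auto simp: fun_eq_iff conjugate_one unitary_def simp flip: conjugate_mult\<close>)
  ultimately show ?thesis by (simp add: star_iso_def)
qed

lemma iso_ext_conjugate: "unitary w \<Longrightarrow> iso_ext (conjugate w) m = w * m * w\<^sup>\<star>"
  by (rule iso_ext_eqI[OF star_iso_conjugate, symmetric], assumption, rule mult_of_eqD)
     (simp add: mult_of_conjugate mult.assoc unitary_cancel flip: mult_mult_of)

lemma norm_conjugate: "unitary w \<Longrightarrow> norm (conjugate w b) = norm b"
  by (simp add: conjugate_def norm_lmul_unitary norm_rmul_unitary unitary_adj)

lemma conjugate_diff: "conjugate w (a - b) = conjugate w a - conjugate w b"
  by (simp add: conjugate_def lmul_diff rmul_diff)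

lemma dist_conjugate: "unitary w \<Longrightarrow> dist (conjugate w a) (conjugate w b) = dist a b"
  by (simp add: dist_norm norm_conjugate flip: conjugate_diff)

lemma star_iso_comp: "star_iso f \<Longrightarrow> star_iso g \<Longrightarrow> star_iso (f \<circ> g)"
  by (auto simp: star_iso_def star_hom_def bij_comp)

lemma star_hom_comp: "star_hom f \<Longrightarrow> star_hom g \<Longrightarrow> star_hom (f \<circ> g)"
  by (auto simp: star_hom_def)

lemma iso_ext_comp: "star_iso f \<Longrightarrow> star_iso g \<Longrightarrow> iso_ext f (iso_ext g m) = iso_ext (f \<circ> g) m"
  by (rule iso_ext_eqI) (simp_all add: star_iso_comp lmul_iso_ext_apply)

lemma conjugate_iso_ext: "star_iso f \<Longrightarrow> conjugate (iso_ext f w) (f b) = f (conjugate w b)"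
  by (simp add: conjugate_def lmul_iso_ext_apply rmul_iso_ext_apply flip: iso_ext_adj)

lemma strict_conjugate:
  assumes f: "limitin strict_topology f m F" "\<forall>\<^sub>F x in F. unitary (f x)" and b: "(b \<longlongrightarrow> c) F"
  shows "((\<lambda>x. conjugate (f x) (b x)) \<longlongrightarrow> conjugate m c) F"
proof -
  have n: "\<forall>\<^sub>F x in F. norm (f x) \<le> 1" "\<forall>\<^sub>F x in F. norm ((f x)\<^sup>\<star>) \<le> 1"
    using f(2) by (eventually_elim, simp add: norm_unitary_le norm_adj)+
  show ?thesis
    unfolding conjugate_def by (intro strict_lmul[OF f(1) n(1)] strict_rmul[OF strict_adj[OF f(1)] n(2)] b)
qed

lemma continuous_map_strict:
  fixes v :: "'x::topological_space \<Rightarrow> 'b::cstar_algebra multiplier"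
  shows "continuous_map euclidean strict_topology v \<longleftrightarrow> (\<forall>g. limitin strict_topology v (v g) (at g))"
proof -
  have "nhdsin euclidean g = nhds g" for g :: 'x
    by (simp add: nhdsin_def nhds_def)
  then have "atin euclidean g = at g" for g :: 'x
    by (simp add: atin_def at_within_def)
  then show ?thesis by (simp add: continuous_map_atin)
qed

locale twisted_group_action =
  fixes \<beta> :: "'g::topological_group_add \<Rightarrow> 'b::cstar_algebra \<Rightarrow> 'b" and \<vv>
  assumes twisted: "twisted_action \<beta> \<vv>"
begin

lemma iso: "star_iso (\<beta> g)"
  and unitary_twist: "unitary (\<vv> g h)"
  and action_mult: "\<beta> g (\<beta> h b) = conjugate (\<vv> g h) (\<beta> (g + h) b)"
  and action_tendsto: "((\<lambda>g. \<beta> g b) \<longlongrightarrow> \<beta> g b) (at g)"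
proof -
  show "star_iso (\<beta> g)" "unitary (\<vv> g h)"
    using twisted by (auto simp: twisted_action_def)
  have "mult_of (\<beta> g (\<beta> h b)) = Ad (\<vv> g h) (mult_of (\<beta> (g + h) b))"
    using twisted unfolding twisted_action_def by blast
  then show "\<beta> g (\<beta> h b) = conjugate (\<vv> g h) (\<beta> (g + h) b)"
    unfolding Ad_mult_of mult_of_inject .
  have "continuous_on UNIV (\<lambda>g. \<beta> g b)" using twisted unfolding twisted_action_def by blast
  then show "((\<lambda>g. \<beta> g b) \<longlongrightarrow> \<beta> g b) (at g)" by (simp add: continuous_on_def)
qed

lemma iso_ext_action_mult:
  "iso_ext (\<beta> g) (iso_ext (\<beta> h) m) = \<vv> g h * iso_ext (\<beta> (g + h)) m * (\<vv> g h)\<^sup>\<star>"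
proof -
  have "\<beta> g \<circ> \<beta> h = conjugate (\<vv> g h) \<circ> \<beta> (g + h)" by (simp add: fun_eq_iff action_mult)
  then show ?thesis
    by (simp add: iso_ext_comp iso iso_ext_conjugate[symmetric] unitary_twist star_iso_conjugate)
qed

text \<open>Write \<open>a = \<beta> g c\<close>. The extension at \<open>h\<close> acts exactly on
  \<open>\<beta> h c\<close>, giving \<open>\<beta> h (rmul w c)\<close>; being unitary, it leaves
  the error from replacing \<open>\<beta> g c\<close> by \<open>\<beta> h c\<close> unchanged in
  norm. So point-norm continuity is enough.\<close>

lemma action_strict:
  assumes w: "unitary w"
  shows "limitin strict_topology (\<lambda>g. iso_ext (\<beta> g) w) (iso_ext (\<beta> g) w) (at g)"
proof (rule unitary_strict_of_rmul)
  fix a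
  define c where "c = inv (\<beta> g) a"
  have a: "a = \<beta> g c" by (simp add: c_def star_iso_inv[OF iso])
  have "((\<lambda>h. norm (rmul (iso_ext (\<beta> h) w) a - \<beta> h (rmul w c))) \<longlongrightarrow> 0) (at g)"
  proof (rule Lim_transform_eventually)
    show "((\<lambda>h. norm (\<beta> g c - \<beta> h c)) \<longlongrightarrow> 0) (at g)"
      using tendsto_norm_zero[OF LIM_zero[OF action_tendsto[of c g]]] by (simp add: norm_minus_commute)
    have "norm (rmul (iso_ext (\<beta> h) w) (\<beta> g c - \<beta> h c)) = norm (\<beta> g c - \<beta> h c)" for h
      by (rule norm_rmul_unitary[OF iso_ext_unitary[OF iso w]])
    then show "\<forall>\<^sub>F h in at g. norm (\<beta> g c - \<beta> h c) = norm (rmul (iso_ext (\<beta> h) w) a - \<beta> h (rmul w c))"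
      by (simp add: a rmul_diff rmul_iso_ext_apply iso)
  qed
  from tendsto_add[OF tendsto_norm_zero_cancel[OF this] action_tendsto[of "rmul w c" g]]
  show "((\<lambda>h. rmul (iso_ext (\<beta> h) w) a) \<longlongrightarrow> rmul (iso_ext (\<beta> g) w) a) (at g)"
    by (simp add: a rmul_iso_ext_apply iso)
qed (simp_all add: iso_ext_unitary iso w)

lemma twist_unitary: "unitary (u g) \<Longrightarrow> unitary w \<Longrightarrow> unitary (twist \<beta> u w g)"
  by (simp add: twist_def unitary_times unitary_adj iso_ext_unitary iso)

lemma twist_strict:
  assumes "\<And>g. unitary (u g)" "unitary w" "limitin strict_topology u (u g) (at g)"
  shows "limitin strict_topology (twist \<beta> u w) (twist \<beta> u w g) (at g)"
  unfolding twist_def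
  using assms
  by (intro strict_mult[where C = 1 and D = 1] strict_const strict_adj action_strict)
     (simp_all add: norm_unitary_le unitary_times unitary_adj iso_ext_unitary iso)

lemma twist_rmul_continuous:
  assumes "\<And>g. unitary (u g)" "unitary w" "continuous_map euclidean strict_topology u"
  shows "continuous_on K (\<lambda>g. rmul (twist \<beta> u w g) b)"
proof (rule continuous_on_subset[OF _ subset_UNIV])
  show "continuous_on UNIV (\<lambda>g. rmul (twist \<beta> u w g) b)"
    using twist_strict[OF assms(1,2)] assms(3)
    by (auto simp: continuous_on_def continuous_map_strict limitin_strict)
qed

text \<open>A single unitary can serve compactly many elements: cover the compact set by finitely many
  small balls.\<close>

lemma approx_le_id_unitary:
  assumes le: "approx_le \<beta> cocycle_id (f, x)" and f: "star_hom f" and x: "\<And>g. unitary (x g)"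
    and X: "compact X" and K: "compact K" and e: "\<epsilon> > 0"
  obtains s where "unitary s" "\<And>a. a \<in> X \<Longrightarrow> dist (conjugate s (f a)) a < \<epsilon>"
    "\<And>a g. a \<in> X \<Longrightarrow> g \<in> K \<Longrightarrow> dist (rmul (twist \<beta> x s g) a) a < \<epsilon>"
proof -
  obtain F where F: "F \<noteq> bot" "\<forall>\<^sub>F w in F. unitary w"
    "\<And>a. ((\<lambda>w. w * mult_of (f a) * w\<^sup>\<star>) \<longlongrightarrow> mult_of a) F"
    "\<And>b K. compact K \<Longrightarrow> uniform_limit K (\<lambda>w g. mult_of b * (1 - w * x g * (iso_ext (\<beta> g) w)\<^sup>\<star>)) (\<lambda>_. 0) F"
    using le unfolding approx_le_def cocycle_id_def by auto
  obtain T where T: "finite T" "T \<subseteq> X" "X \<subseteq> (\<Union>c\<in>T. ball c (\<epsilon>/3))"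
    using seq_compact_imp_totally_bounded[OF compact_imp_seq_compact[OF X]] e by (metis zero_less_divide_iff zero_less_numeral)
  have "\<forall>\<^sub>F w in F. dist (conjugate w (f c)) c < \<epsilon>/3" for c
  proof -
    have "((\<lambda>w. conjugate w (f c)) \<longlongrightarrow> c) F"
      using F(3)[of c] by (simp add: tendsto_mult_of_iff flip: mult_of_conjugate)
    then show ?thesis using e by (intro tendstoD divide_pos_pos) simp_all
  qed
  moreover have "\<forall>\<^sub>F w in F. \<forall>g\<in>K. dist (rmul (twist \<beta> x w g) c) c < \<epsilon>/3" for c
  proof -
    have eq: "mult_of c * (1 - w * x g * (iso_ext (\<beta> g) w)\<^sup>\<star>) = mult_of (c - rmul (twist \<beta> x w g) c)" for w g
      by (simp add: twist_def right_diff_distrib mult_of_mult mult_of_diff)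
    have "\<forall>\<^sub>F w in F. \<forall>g\<in>K. dist (mult_of (c - rmul (twist \<beta> x w g) c)) 0 < \<epsilon>/3"
      using F(4)[OF K, of c] e unfolding eq by (intro uniform_limitD divide_pos_pos) simp_all
    then show ?thesis by (simp add: norm_mult_of dist_norm norm_minus_commute)
  qed
  ultimately have "\<forall>\<^sub>F w in F. unitary w \<and> (\<forall>c\<in>T. dist (conjugate w (f c)) c < \<epsilon>/3 \<and>
      (\<forall>g\<in>K. dist (rmul (twist \<beta> x w g) c) c < \<epsilon>/3))"
    by (intro eventually_conj F(2) eventually_ball_finite T(1)) (auto intro: eventually_conj)
  then obtain s where s: "unitary s" "\<And>c. c \<in> T \<Longrightarrow> dist (conjugate s (f c)) c < \<epsilon>/3"
    "\<And>c g. c \<in> T \<Longrightarrow> g \<in> K \<Longrightarrow> dist (rmul (twist \<beta> x s g) c) c < \<epsilon>/3"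
    using eventually_happens'[OF F(1)] by blast
  have near: "\<exists>c\<in>T. dist a c < \<epsilon>/3" if "a \<in> X" for a
    using subsetD[OF T(3) that] unfolding UN_iff mem_ball by (simp only: dist_commute)
  show ?thesis
  proof (rule that[OF s(1)])
    fix a assume "a \<in> X"
    then obtain c where c: "c \<in> T" "dist a c < \<epsilon>/3" using near by blast
    have "dist (conjugate s (f a)) (conjugate s (f c)) \<le> dist a c"
      using star_hom_norm_le[OF f, of "a - c"] by (simp add: dist_conjugate[OF s(1)]) (simp add: dist_norm star_hom_diff[OF f])
    then show "dist (conjugate s (f a)) a < \<epsilon>"
      using s(2)[OF c(1)] c(2) dist_triangle[of "conjugate s (f a)" a "conjugate s (f c)"]
        dist_triangle[of "conjugate s (f c)" a c] by (simp add: dist_commute)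
    fix g assume "g \<in> K"
    have "dist (rmul (twist \<beta> x s g) a) (rmul (twist \<beta> x s g) c) = dist a c"
      using norm_rmul_unitary[OF twist_unitary[of x g s, OF x s(1)], of "a - c"] by (simp add: dist_norm rmul_diff)
    then show "dist (rmul (twist \<beta> x s g) a) a < \<epsilon>"
      using s(3)[OF c(1) \<open>g \<in> K\<close>] c(2) dist_triangle[of "rmul (twist \<beta> x s g) a" a "rmul (twist \<beta> x s g) c"]
        dist_triangle[of "rmul (twist \<beta> x s g) c" a c] by (simp add: dist_commute)
  qed
qed

end

locale cocycle_mor = \<alpha>: twisted_group_action \<alpha> \<uu> + \<beta>: twisted_group_action \<beta> \<vv>
  for \<alpha> :: "'g::topological_group_add \<Rightarrow> 'a::cstar_algebra \<Rightarrow> 'a" and \<uu>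
    and \<beta> :: "'g \<Rightarrow> 'b::cstar_algebra \<Rightarrow> 'b" and \<vv> +
  fixes \<phi> :: "'a \<Rightarrow> 'b" and u :: "'g \<Rightarrow> 'b multiplier"
  assumes mor: "cocycle_morphism \<alpha> \<uu> \<beta> \<vv> (\<phi>, u)"
    and separable: "separable_space (euclidean :: 'a topology)"
begin

sublocale extendible_star_hom \<phi>
  using mor separable by unfold_locales (auto simp: cocycle_morphism_def)

lemma u_unitary: "unitary (u g)"
  and u_continuous: "continuous_map euclidean strict_topology u"
  and equivariant: "conjugate (u g) (\<beta> g (\<phi> a)) = \<phi> (\<alpha> g a)"
  and cocycle: "uext (\<uu> g h) = u g * iso_ext (\<beta> g) (u h) * \<vv> g h * (u (g + h))\<^sup>\<star>"
  using mor unfolding cocycle_morphism_def prod.case Ad_mult_of mult_of_inject by blast+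

text \<open>The images of the translates \<open>\<alpha> g (e n)\<close> converge to
  \<open>?Q\<close>, which is therefore absorbed by \<open>P\<close>. By equivariance
  \<open>?Q\<close> also fixes the range of \<open>\<phi>\<close>, so the two agree there.\<close>

lemma P_equivariant: "u g * iso_ext (\<beta> g) P * (u g)\<^sup>\<star> = P" (is "?Q = P")
proof -
  note u = unitary_cancel[OF u_unitary]
  obtain e where e: "\<And>b. (\<lambda>n. \<phi> (e n) * b) \<longlonglongrightarrow> lmul P b" by (rule approx_sequence) blast
  have lim: "(\<lambda>n. \<phi> (\<alpha> g (e n)) * b) \<longlonglongrightarrow> lmul ?Q b" for b
  proof -
    define c where "c = lmul ((u g)\<^sup>\<star>) b"
    have "\<phi> (\<alpha> g (e n)) * b = lmul (u g) (\<beta> g (\<phi> (e n)) * c)" for n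
      by (simp add: c_def conjugate_def rmul_lmul flip: equivariant lmul_mult)
    also have "\<dots> n = lmul (u g) (\<beta> g (\<phi> (e n) * inv (\<beta> g) c))" for n
      by (simp add: star_hom_mult[OF star_iso_inv(5)[OF \<beta>.iso]] star_iso_inv[OF \<beta>.iso])
    finally have "(\<lambda>n. \<phi> (\<alpha> g (e n)) * b) = (\<lambda>n. lmul (u g) (\<beta> g (\<phi> (e n) * inv (\<beta> g) c)))" by blast
    moreover have "(\<lambda>n. lmul (u g) (\<beta> g (\<phi> (e n) * inv (\<beta> g) c))) \<longlonglongrightarrow> lmul (u g) (\<beta> g (lmul P (inv (\<beta> g) c)))"
      by (intro tendsto_lmul star_hom_tendsto[OF star_iso_inv(5)[OF \<beta>.iso]] e)
    ultimately show ?thesis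
      by (simp add: lmul_times lmul_iso_ext[OF \<beta>.iso] c_def)
  qed
  have "P * ?Q = ?Q"
  proof (rule multiplier_eqI_lmul)
    fix b
    show "lmul (P * ?Q) b = lmul ?Q b"
      using LIMSEQ_unique[OF tendsto_lmul[OF lim, of P b] _] lim[of b]
      by (simp add: lmul_mult P_absorb lmul_times)
  qed
  moreover have "?Q\<^sup>\<star> = ?Q"
    by (simp add: adj_mult adj_adj mult.assoc P_projection flip: iso_ext_adj[OF \<beta>.iso])
  ultimately have QP: "?Q * P = ?Q" by (metis adj_mult P_projection(1))
  show "?Q = P"
  proof (rule eqI_on_range[OF QP P_projection(2)])
    fix a
    define a' where "a' = inv (\<alpha> g) a"
    have a: "a = \<alpha> g a'" by (simp add: a'_def star_iso_inv[OF \<alpha>.iso])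
    have "lmul ?Q (\<phi> a) = conjugate (u g) (\<beta> g (lmul P (\<phi> a')))"
    proof -
      have "mult_of (lmul ?Q (\<phi> a)) = u g * (iso_ext (\<beta> g) P * mult_of (\<beta> g (\<phi> a'))) * (u g)\<^sup>\<star>"
        by (simp add: a mult_of_conjugate mult.assoc u flip: equivariant mult_mult_of)
      also have "iso_ext (\<beta> g) P * mult_of (\<beta> g (\<phi> a')) = mult_of (\<beta> g (lmul P (\<phi> a')))"
        by (simp add: mult_mult_of lmul_iso_ext_apply \<beta>.iso)
      also have "u g * \<dots> * (u g)\<^sup>\<star> = mult_of (conjugate (u g) (\<beta> g (lmul P (\<phi> a'))))"
        by (simp only: mult_of_conjugate)
      finally show ?thesis by (simp only: mult_of_inject)
    qed
    then show "lmul ?Q (\<phi> a) = lmul P (\<phi> a)" by (simp add: P_absorb equivariant a)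
  qed
qed

text \<open>Equivariance passes from \<open>\<phi>\<close> to multipliers by
  \<open>uext_eqI\<close>; the condition on the complement of \<open>P\<close> is the invariance
  \<open>P_equivariant\<close>.\<close>

lemma uext_equivariant: "uext (iso_ext (\<alpha> g) m) * u g = u g * iso_ext (\<beta> g) (uext m)"
proof -
  note u = unitary_cancel[OF u_unitary]
  note ext = iso_ext_mult[OF \<beta>.iso] iso_ext_diff[OF \<beta>.iso] iso_ext_one[OF \<beta>.iso]
  let ?Y = "u g * iso_ext (\<beta> g) (uext m) * (u g)\<^sup>\<star>"
  have "?Y = uext (iso_ext (\<alpha> g) m)"
  proof (rule uext_eqI)
    have P: "1 - P = u g * iso_ext (\<beta> g) (1 - P) * (u g)\<^sup>\<star>"
      by (simp add: ext right_diff_distrib left_diff_distrib u P_equivariant)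
    have "?Y * (1 - P) = u g * iso_ext (\<beta> g) (uext m * (1 - P)) * (u g)\<^sup>\<star>"
      by (subst P) (simp only: ext(1) mult.assoc u)
    then show "?Y * (1 - P) = 1 - P" by (simp add: uext_complement flip: P)
    fix a
    define a' where "a' = inv (\<alpha> g) a"
    have a: "a = \<alpha> g a'" by (simp add: a'_def star_iso_inv[OF \<alpha>.iso])
    have "mult_of (lmul ?Y (\<phi> a)) = u g * (iso_ext (\<beta> g) (uext m) * mult_of (\<beta> g (\<phi> a'))) * (u g)\<^sup>\<star>"
      by (simp add: a mult_of_conjugate mult.assoc u flip: equivariant mult_mult_of)
    also have "iso_ext (\<beta> g) (uext m) * mult_of (\<beta> g (\<phi> a')) = mult_of (\<beta> g (\<phi> (lmul m a')))"
      by (simp add: mult_mult_of lmul_iso_ext_apply \<beta>.iso lmul_uext)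
    also have "u g * \<dots> * (u g)\<^sup>\<star> = mult_of (\<phi> (lmul (iso_ext (\<alpha> g) m) a))"
      by (simp add: a lmul_iso_ext_apply \<alpha>.iso equivariant flip: mult_of_conjugate)
    finally show "lmul ?Y (\<phi> a) = \<phi> (lmul (iso_ext (\<alpha> g) m) a)" by (simp only: mult_of_inject)
  qed
  then have "uext (iso_ext (\<alpha> g) m) * u g = ?Y * u g" by simp
  then show ?thesis by (simp add: mult.assoc u)
qed

text \<open>Perturbing two morphisms by \<open>w\<close> and \<open>z\<close> perturbs their
  composition by \<open>z * uext w\<close>. After cancellation it remains to move the extension of
  \<open>iso_ext (\<alpha> g) w\<close> past \<open>u g\<close>, which is
  \<open>uext_equivariant\<close>.\<close>

lemma twist_composition:
  assumes z: "unitary z"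
  shows "z * uext (twist \<alpha> x w g) * z\<^sup>\<star> * twist \<beta> u z g = twist \<beta> (\<lambda>g. uext (x g) * u g) (z * uext w) g"
proof -
  have "uext ((iso_ext (\<alpha> g) w)\<^sup>\<star>) * u g = u g * (iso_ext (\<beta> g) (uext w))\<^sup>\<star>"
    using uext_equivariant[of g "w\<^sup>\<star>"] by (simp add: iso_ext_adj \<alpha>.iso \<beta>.iso uext_adj)
  then have "uext ((iso_ext (\<alpha> g) w)\<^sup>\<star>) * (u g * y) = u g * ((iso_ext (\<beta> g) (uext w))\<^sup>\<star> * y)" for y
    by (simp only: mult.assoc[symmetric])
  then show ?thesis
    by (simp add: twist_def uext_mult mult.assoc unitary_cancel[OF z] iso_ext_mult[OF \<beta>.iso] adj_mult)
qed

lemma conjugate_composition: "conjugate z (\<phi> (conjugate w a)) = conjugate (z * uext w) (\<phi> a)"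
  by (simp add: conjugate_mult) (simp add: conjugate_def lmul_uext rmul_uext flip: uext_adj)

text \<open>On the range of the perturbed homomorphism, \<open>z * uext m * z\<^sup>\<star>\<close>
  acts as its extension should. In this explicit form \<open>multiplier_ext\<close> need not be
  evaluated anew for each perturbation.\<close>

lemma rmul_uext_conjugate:
  assumes z: "unitary z"
  shows "rmul (z * uext m * z\<^sup>\<star>) (conjugate z (\<phi> a)) = conjugate z (\<phi> (rmul m a))"
proof -
  have "mult_of (conjugate z (\<phi> a)) * (z * uext m * z\<^sup>\<star>) = z * (mult_of (\<phi> a) * uext m) * z\<^sup>\<star>"
    by (simp add: mult_of_conjugate mult.assoc unitary_cancel[OF z])
  then show ?thesis
    by (simp add: mult_of_mult rmul_uext mult_of_inject flip: mult_of_conjugate)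
qed

lemma twist_equivariant:
  assumes w: "unitary w"
  shows "conjugate (twist \<beta> u w g) (\<beta> g (conjugate w (\<phi> a))) = conjugate w (\<phi> (\<alpha> g a))"
  by (simp add: twist_def conjugate_mult equivariant flip: conjugate_iso_ext[OF \<beta>.iso])
     (simp add: equivariant conjugate_one unitary_cancel[OF iso_ext_unitary[OF \<beta>.iso w]] flip: conjugate_mult)

lemma twist_cocycle:
  assumes w: "unitary w"
  shows "w * uext (\<uu> g h) * w\<^sup>\<star> =
    twist \<beta> u w g * iso_ext (\<beta> g) (twist \<beta> u w h) * \<vv> g h * (twist \<beta> u w (g + h))\<^sup>\<star>"
proof -
  note v = unitary_cancel[OF \<beta>.unitary_twist]
  note b = unitary_cancel[OF iso_ext_unitary[OF \<beta>.iso w]]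
  note ext = iso_ext_mult[OF \<beta>.iso] iso_ext_adj[OF \<beta>.iso]
  show ?thesis
    by (simp add: twist_def cocycle ext \<beta>.iso_ext_action_mult adj_mult adj_adj mult.assoc b v)
qed

end

section \<open>Limits of unitary perturbations\<close>

text \<open>The open sets \<open>V\<close>, not merely the compact ones around them, cover the
  group, so finitely many of them cover a given compact set. By the Lindelof property a sequence of
  them suffices.\<close>

lemma compact_exhaustion:
  assumes "locally_compact_space (euclidean :: 'g::{second_countable_topology, t2_space} topology)"
  obtains K :: "nat \<Rightarrow> 'g::{second_countable_topology, t2_space} set"
  where "\<And>n. compact (K n)" "mono K" "\<And>C. compact C \<Longrightarrow> \<exists>n. C \<subseteq> K n"
proof -
  have "\<forall>x. \<exists>V C. open V \<and> compact C \<and> (x::'g) \<in> V \<and> V \<subseteq> C"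
    using assms by (auto simp: locally_compact_space_def)
  then obtain V C where VC: "\<And>x. open (V x)" "\<And>x. compact (C x)" "\<And>x. (x::'g) \<in> V x" "\<And>x. V x \<subseteq> C x"
    by metis
  obtain \<V> where F: "\<V> \<subseteq> range V" "countable \<V>" "\<Union>\<V> = \<Union>(range V)"
    using Lindelof[of "range V"] VC(1) by blast
  have all: "\<Union>\<V> = UNIV" using F(3) VC(3) by auto
  then have "\<V> \<noteq> {}" by auto
  then have r: "range (from_nat_into \<V>) = \<V>" using F(2) by (rule range_from_nat_into)
  have "\<forall>n. \<exists>x. from_nat_into \<V> n = V x" using r F(1) by blast
  then obtain p where p: "\<And>n. from_nat_into \<V> n = V (p n)" by metis
  define K where "K n = (\<Union>i\<le>n. C (p i))" for n :: nat
  show ?thesis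
  proof (rule that)
    show "compact (K n)" for n unfolding K_def by (intro compact_UN VC) simp
    show "mono K" unfolding K_def by (intro monoI UN_mono) auto
    fix S :: "'g set" assume S: "compact S"
    have "S \<subseteq> \<Union>((\<lambda>n. V (p n)) ` UNIV)"
      using all r p by auto
    then obtain N where N: "finite N" "S \<subseteq> \<Union>((\<lambda>n. V (p n)) ` N)"
      using compactE_image[OF S, of UNIV "\<lambda>n. V (p n)"] VC(1) by metis
    then obtain n where "\<forall>i\<in>N. i \<le> n" by (auto simp: finite_nat_set_iff_bounded_le)
    then have "S \<subseteq> K n" using N(2) VC(4) unfolding K_def by fastforce
    then show "\<exists>n. S \<subseteq> K n" by blast
  qed
qed

lemma geometric_steps:
  fixes s :: "nat \<Rightarrow> 'a::metric_space"
  assumes "\<And>n. n \<ge> N \<Longrightarrow> dist (s (Suc n)) (s n) \<le> C * (1/2) ^ n" and "N \<le> m" "m \<le> n"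
  shows "dist (s n) (s m) \<le> 2 * C * (1/2) ^ m"
proof -
  have C: "C \<ge> 0"
    using assms(1)[OF order.refl] zero_le_dist[of "s (Suc N)" "s N"]
    by (metis dual_order.trans mult_le_cancel_right_pos zero_less_divide_1_iff zero_less_numeral zero_less_power mult_zero_left linorder_not_le)
  \<comment> \<open>The subtracted term \<open>(1/2) ^ n\<close> is what the induction step
    consumes.\<close>
  have "dist (s n) (s m) \<le> 2 * C * ((1/2) ^ m - (1/2) ^ n)"
    using assms(3)
  proof (induction n rule: dec_induct)
    case (step n)
    then show ?case
      using assms(1)[of n] assms(2) dist_triangle[of "s (Suc n)" "s m" "s n"] by (simp add: algebra_simps)
  qed simp
  also have "\<dots> \<le> 2 * C * (1/2) ^ m" using C by (intro mult_left_mono) simp_all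
  finally show ?thesis .
qed

lemma geometric_tail:
  fixes C :: real assumes "\<epsilon> > 0"
  obtains N where "\<And>n. n \<ge> N \<Longrightarrow> C * (1/2) ^ n < \<epsilon>"
proof -
  have "(\<lambda>n. C * (1/2) ^ n) \<longlonglongrightarrow> 0" by (intro tendsto_mult_right_zero LIMSEQ_realpow_zero) auto
  then have "\<forall>\<^sub>F n in sequentially. C * (1/2) ^ n < \<epsilon>" using assms by (rule order_tendstoD)
  then show ?thesis using that by (auto simp: eventually_sequentially)
qed

lemma convergent_on_dense:
  fixes f :: "nat \<Rightarrow> 'a::metric_space \<Rightarrow> 'b::complete_space"
  assumes "\<And>n a b. dist (f n a) (f n b) \<le> dist a b"
    and x: "\<And>a \<epsilon>. \<epsilon> > 0 \<Longrightarrow> \<exists>j. dist (x j :: 'a) a < \<epsilon>" and "\<And>j::nat. convergent (\<lambda>n. f n (x j))"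
  shows "convergent (\<lambda>n. f n a)"
proof (rule convergent_approx)
  fix \<epsilon> :: real assume "\<epsilon> > 0"
  then obtain j where "dist (x j) a < \<epsilon>" using x by blast
  then have "\<forall>n. dist (f n (x j)) (f n a) \<le> \<epsilon>" using assms(1)[of _ "x j" a] by (meson less_imp_le order_trans)
  then show "\<exists>h. convergent h \<and> (\<forall>n. dist (h n) (f n a) \<le> \<epsilon>)" using assms(3) by blast
qed

lemma eq_on_dense:
  fixes p q :: "'a::metric_space \<Rightarrow> 'b::metric_space"
  assumes p: "\<And>a b. dist (p a) (p b) \<le> dist a b" and q: "\<And>a b. dist (q a) (q b) \<le> dist a b"
    and x: "\<And>a \<epsilon>. \<epsilon> > 0 \<Longrightarrow> \<exists>j. dist (x j) a < \<epsilon>" and eq: "\<And>j::nat. p (x j) = q (x j)"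
  shows "p a = q a"
proof -
  have "dist (p a) (q a) \<le> 0 + \<epsilon>" if pos: "\<epsilon> > 0" for \<epsilon>
  proof -
    obtain j where "dist (x j) a < \<epsilon> / 2" using x[of "\<epsilon> / 2" a] pos by auto
    then show ?thesis
      using p[of "x j" a] q[of "x j" a] eq[of j] dist_triangle3[of "p a" "q a" "p (x j)"] by simp
  qed
  then show ?thesis using field_le_epsilon[of "dist (p a) (q a)" 0] by simp
qed

lemma dist_star_hom: "star_hom f \<Longrightarrow> dist (f a) (f b) \<le> dist a b"
  using star_hom_norm_le[of f "a - b"] by (simp add: dist_norm star_hom_diff)

lemma dist_rmul_unitary: "unitary u \<Longrightarrow> dist (rmul u a) (rmul u b) = dist a b"
  using norm_rmul_unitary[of u "a - b"] by (simp add: dist_norm rmul_diff)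

lemma star_hom_limit:
  assumes f: "\<And>n. star_hom (f n)" and lim: "\<And>a. (\<lambda>n. f n a) \<longlonglongrightarrow> F a"
  shows "star_hom F"
  unfolding star_hom_def
proof (intro conjI allI)
  show "F (a + b) = F a + F b" for a b
    by (rule LIMSEQ_unique[OF lim]) (simp add: star_hom_add[OF f] tendsto_add lim)
  show "F (c *\<^sub>C a) = c *\<^sub>C F a" for c a
    by (rule LIMSEQ_unique[OF lim])
       (simp add: star_hom_scaleC[OF f] bounded_linear.tendsto[OF bounded_linear_scaleC] lim)
  show "F (a * b) = F a * F b" for a b
    by (rule LIMSEQ_unique[OF lim]) (simp add: star_hom_mult[OF f] tendsto_mult lim)
  show "F (a\<^sup>\<star>) = (F a)\<^sup>\<star>" for a
    by (rule LIMSEQ_unique[OF lim]) (simp add: star_hom_adj[OF f] tendsto_adj lim)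
qed

text \<open>Contractions are equicontinuous, so the argument may converge along with the maps. This
  serves iterated images such as \<open>h n (f n (x j))\<close> in the intertwining.\<close>

lemma tendsto_contraction:
  fixes f :: "nat \<Rightarrow> 'a::metric_space \<Rightarrow> 'b::metric_space"
  assumes c: "\<And>n a b. dist (f n a) (f n b) \<le> dist a b" and f: "(\<lambda>n. f n a) \<longlonglongrightarrow> l"
    and b: "b \<longlonglongrightarrow> a"
  shows "(\<lambda>n. f n (b n)) \<longlonglongrightarrow> l"
proof -
  have bound: "dist (f n (b n)) l \<le> dist (b n) a + dist (f n a) l" for n
    using c[of n "b n" a] dist_triangle[of "f n (b n)" l "f n a"] by linarith
  have "(\<lambda>n. dist (b n) a + dist (f n a) l) \<longlonglongrightarrow> 0 + 0"
    by (rule tendsto_add[OF tendsto_dist_iff[THEN iffD1, OF b] tendsto_dist_iff[THEN iffD1, OF f]])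
  then have lim: "(\<lambda>n. dist (b n) a + dist (f n a) l) \<longlonglongrightarrow> 0" by simp
  have "(\<lambda>n. dist (f n (b n)) l) \<longlonglongrightarrow> 0"
    by (rule tendsto_sandwich[OF _ always_eventually[OF allI[OF bound]] tendsto_const lim]) simp
  then show ?thesis by (simp only: tendsto_dist_iff[symmetric])
qed

section \<open>Limits of a sequence of perturbations\<close>

context cocycle_mor
begin

lemma perturb_hom: "unitary w \<Longrightarrow> star_hom (\<lambda>a. conjugate w (\<phi> a))"
  using star_hom_comp[OF star_iso_inv(5)[OF star_iso_conjugate] hom] by (simp add: comp_def)

text \<open>Each perturbation satisfies the equivariance and cocycle identities, and these pass to
  strict limits of bounded products. Continuity of \<open>U\<close> comes from uniform convergence
  of \<open>rmul\<close> on a compact neighbourhood, together with unitarity of the values.\<close>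

lemma perturb_limit:
  assumes w: "\<And>n. unitary (w n)" and F: "star_iso F" and lc: "locally_compact_space (euclidean :: 'g topology)"
    and lim: "\<And>a. (\<lambda>n. conjugate (w n) (\<phi> a)) \<longlonglongrightarrow> F a"
    and U: "\<And>g. limitin strict_topology (\<lambda>n. twist \<beta> u (w n) g) (U g) sequentially"
    and unif: "\<And>b K. compact K \<Longrightarrow>
      uniform_limit K (\<lambda>n g. rmul (twist \<beta> u (w n) g) b) (\<lambda>g. rmul (U g) b) sequentially"
  shows "cocycle_conjugacy \<alpha> \<uu> \<beta> \<vv> (F, U)" "approx_le \<beta> (F, U) (\<phi>, u)"
proof -
  have tw: "unitary (twist \<beta> u (w n) g)" for n g
    by (simp add: \<beta>.twist_unitary u_unitary w)
  have Uu: "unitary (U g)" for g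
    by (rule unitary_strict_limit[OF U]) (simp_all add: tw)
  have local_nbhd: "\<forall>g. \<exists>V K. open V \<and> compact K \<and> (g::'g) \<in> V \<and> V \<subseteq> K"
    using lc by (simp add: locally_compact_space_def)
  have "limitin strict_topology U (U g) (at g)" for g
  proof (rule unitary_strict_of_rmul)
    fix b
    obtain V K where VK: "open V" "compact K" "g \<in> V" "V \<subseteq> K"
      using local_nbhd by meson
    have "continuous_on K (\<lambda>g. rmul (U g) b)"
      by (rule uniform_limit_theorem[OF _ unif[OF VK(2)]])
         (auto intro!: always_eventually \<beta>.twist_rmul_continuous u_unitary w u_continuous)
    then have "continuous_on V (\<lambda>g. rmul (U g) b)" using VK(4) by (rule continuous_on_subset)
    then have "((\<lambda>g. rmul (U g) b) \<longlongrightarrow> rmul (U g) b) (at g within V)"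
      using VK(3) unfolding continuous_on_def by blast
    then show "((\<lambda>g. rmul (U g) b) \<longlongrightarrow> rmul (U g) b) (at g)"
      by (simp only: at_within_open[OF VK(3,1)])
  qed (simp_all add: Uu)
  then have Uc: "continuous_map euclidean strict_topology U" by (simp add: continuous_map_strict)
  have equiv: "conjugate (U g) (\<beta> g (F a)) = F (\<alpha> g a)" for g a
  proof (rule LIMSEQ_unique)
    show "(\<lambda>n. conjugate (twist \<beta> u (w n) g) (\<beta> g (conjugate (w n) (\<phi> a)))) \<longlonglongrightarrow> conjugate (U g) (\<beta> g (F a))"
      by (intro strict_conjugate U star_hom_tendsto[OF star_iso_inv(5)[OF \<beta>.iso]] lim) (simp add: tw)
    show "(\<lambda>n. conjugate (twist \<beta> u (w n) g) (\<beta> g (conjugate (w n) (\<phi> a)))) \<longlonglongrightarrow> F (\<alpha> g a)"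
      by (simp add: twist_equivariant w lim)
  qed
  have coc: "iso_ext F (\<uu> g h) = U g * iso_ext (\<beta> g) (U h) * \<vv> g h * (U (g + h))\<^sup>\<star>" for g h
  proof (rule strict_unique)
    let ?X = "\<lambda>n. w n * uext (\<uu> g h) * (w n)\<^sup>\<star>"
    have Xu: "unitary (?X n)" for n
      by (simp add: unitary_times unitary_adj w uext_unitary \<alpha>.unitary_twist)
    show "limitin strict_topology ?X (iso_ext F (\<uu> g h)) sequentially"
    proof (rule unitary_strict_of_rmul)
      fix b
      define a where "a = inv F b"
      have b: "b = F a" by (simp add: a_def star_iso_inv[OF F])
      \<comment> \<open>On the moving elements \<open>conjugate (w n) (\<phi> a)\<close> the
        multiplier \<open>?X n\<close> is computed exactly; as an isometry it transfers this to
        their limit \<open>F a\<close>.\<close>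
      have "(\<lambda>n. dist (F a) (conjugate (w n) (\<phi> a))) \<longlonglongrightarrow> 0"
        using lim[of a] by (simp add: tendsto_dist_iff[of "\<lambda>n. conjugate (w n) (\<phi> a)"] dist_commute)
      then have "(\<lambda>n. dist (rmul (?X n) b) (conjugate (w n) (\<phi> (rmul (\<uu> g h) a)))) \<longlonglongrightarrow> 0"
        by (simp add: b dist_rmul_unitary[OF Xu] flip: rmul_uext_conjugate[OF w])
      then have "(\<lambda>n. rmul (?X n) b) \<longlonglongrightarrow> F (rmul (\<uu> g h) a)"
        using Lim_transform2[OF lim[of "rmul (\<uu> g h) a"], of "\<lambda>n. rmul (?X n) b"]
        by (simp add: dist_norm tendsto_norm_zero_iff norm_minus_commute)
      then show "(\<lambda>n. rmul (?X n) b) \<longlonglongrightarrow> rmul (iso_ext F (\<uu> g h)) b"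
        by (simp add: b rmul_iso_ext_apply[OF F])
    qed (simp_all add: Xu iso_ext_unitary F \<alpha>.unitary_twist)
    show "limitin strict_topology ?X (U g * iso_ext (\<beta> g) (U h) * \<vv> g h * (U (g + h))\<^sup>\<star>) sequentially"
      unfolding twist_cocycle[OF w]
      by (intro strict_mult[where C = 1 and D = 1] strict_const strict_adj U iso_ext_strict \<beta>.iso)
         (simp_all add: norm_unitary_le unitary_times unitary_adj iso_ext_unitary \<beta>.iso tw \<beta>.unitary_twist)
  qed simp
  show "cocycle_conjugacy \<alpha> \<uu> \<beta> \<vv> (F, U)"
    unfolding cocycle_conjugacy_def cocycle_morphism_def prod.case Ad_mult_of mult_of_inject fst_conv
    using F star_iso_inv(5)[OF F] star_iso_extendible[OF F] Uu Uc
    by (auto simp: equiv unitary_ext_iso[OF F separable] coc)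
  show "approx_le \<beta> (F, U) (\<phi>, u)"
    unfolding approx_le_def prod.case
  proof (intro exI[of _ "filtermap w sequentially"] conjI allI impI)
    show "filtermap w sequentially \<noteq> bot" by (simp add: filtermap_bot_iff)
    show "\<forall>\<^sub>F w in filtermap w sequentially. unitary w" by (simp add: eventually_filtermap w)
    show "((\<lambda>w. w * mult_of (\<phi> a) * w\<^sup>\<star>) \<longlongrightarrow> mult_of (F a)) (filtermap w sequentially)" for a
      using lim[of a] by (simp add: filterlim_filtermap tendsto_mult_of_iff flip: mult_of_conjugate)
    fix b and K :: "'g set" assume K: "compact K"
    have eq: "mult_of b * (U g - w n * u g * (iso_ext (\<beta> g) (w n))\<^sup>\<star>) =
        mult_of (rmul (U g) b - rmul (twist \<beta> u (w n) g) b)" for n g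
      by (simp add: twist_def right_diff_distrib mult_of_mult mult_of_diff)
    show "uniform_limit K (\<lambda>w g. mult_of b * (U g - w * u g * (iso_ext (\<beta> g) w)\<^sup>\<star>)) (\<lambda>_. 0) (filtermap w sequentially)"
      using unif[OF K, of b]
      by (simp add: uniform_limit_iff eventually_filtermap eq norm_mult_of dist_norm norm_minus_commute)
  qed
qed

lemma perturb_convergent:
  assumes w: "\<And>n. unitary (w n)" and x: "\<And>a \<epsilon>. \<epsilon> > 0 \<Longrightarrow> \<exists>j. dist (x j) a < \<epsilon>"
    and step: "\<And>j n. j \<le> n \<Longrightarrow> dist (conjugate (w (Suc n)) (\<phi> (x j))) (conjugate (w n) (\<phi> (x j))) \<le> C * (1/2) ^ n"
  shows "convergent (\<lambda>n. conjugate (w n) (\<phi> a))"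
proof (rule convergent_on_dense[where f = "\<lambda>n a. conjugate (w n) (\<phi> a)" and x = x])
  fix j :: nat
  have "Cauchy (\<lambda>n. conjugate (w n) (\<phi> (x j)))"
  proof (rule CauchyI')
    fix \<epsilon> :: real assume "\<epsilon> > 0"
    then obtain N where N: "\<And>n. n \<ge> N \<Longrightarrow> 2 * C * (1/2) ^ n < \<epsilon>" by (rule geometric_tail[of \<epsilon> "2 * C"]) blast
    have "dist (conjugate (w m) (\<phi> (x j))) (conjugate (w n) (\<phi> (x j))) < \<epsilon>"
      if "m \<ge> max j N" "n > m" for m n
      using geometric_steps[of j "\<lambda>n. conjugate (w n) (\<phi> (x j))", OF step, of m n] N[of m] that
      by (simp add: dist_commute)
    then show "\<exists>M. \<forall>m\<ge>M. \<forall>n>m. dist (conjugate (w m) (\<phi> (x j))) (conjugate (w n) (\<phi> (x j))) < \<epsilon>" by blast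
  qed
  then show "convergent (\<lambda>n. conjugate (w n) (\<phi> (x j)))" by (rule Cauchy_convergent)
qed (use x dist_star_hom[OF perturb_hom[OF w]] in auto)

text \<open>The steps control the cocycle on the moving elements
  \<open>conjugate (w n) (\<phi> (x j))\<close>. A fixed \<open>b = F a\<close> is within
  \<open>\<epsilon> / 4\<close> of them for large \<open>n\<close>, and since the twisted cocycles
  act isometrically this error is the same for all \<open>g\<close>.\<close>

lemma perturb_uniformly_Cauchy:
  assumes w: "\<And>n. unitary (w n)" and x: "\<And>a \<epsilon>. \<epsilon> > 0 \<Longrightarrow> \<exists>j. dist (x j) a < \<epsilon>"
    and lim: "\<And>a. (\<lambda>n. conjugate (w n) (\<phi> a)) \<longlonglongrightarrow> F a" and F: "star_hom F" "surj F"
    and K: "mono K" "C \<subseteq> K n0"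
    and step: "\<And>j n g. j \<le> n \<Longrightarrow> g \<in> K n \<Longrightarrow>
      dist (rmul (twist \<beta> u (w (Suc n)) g) (conjugate (w (Suc n)) (\<phi> (x j))))
           (rmul (twist \<beta> u (w n) g) (conjugate (w n) (\<phi> (x j)))) \<le> D * (1/2) ^ n"
  shows "uniformly_Cauchy_on C (\<lambda>n g. rmul (twist \<beta> u (w n) g) b)"
  unfolding uniformly_Cauchy_on_def
proof (intro allI impI)
  fix \<epsilon> :: real assume e: "\<epsilon> > 0"
  obtain a where b: "b = F a" using F(2) by blast
  obtain j where j: "dist (x j) a < \<epsilon> / 8" using x[of "\<epsilon> / 8"] e by auto
  let ?f = "\<lambda>n. conjugate (w n) (\<phi> (x j))"
  let ?r = "\<lambda>n g. rmul (twist \<beta> u (w n) g)"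
  obtain N1 where N1: "\<And>n. n \<ge> N1 \<Longrightarrow> dist (?f n) (F (x j)) < \<epsilon> / 8"
    using metric_LIMSEQ_D[OF lim[of "x j"], of "\<epsilon> / 8"] e by auto
  have "\<epsilon> / 8 > 0" using e by simp
  then obtain N2 where N2: "\<And>n. n \<ge> N2 \<Longrightarrow> 2 * D * (1/2) ^ n < \<epsilon> / 8" by (rule geometric_tail) blast
  \<comment> \<open>Beyond \<open>M\<close> the steps apply (\<open>j\<close> and
    \<open>n0\<close>), the moving elements are near their limit (\<open>N1\<close>), and the
    remaining steps are small (\<open>N2\<close>).\<close>
  define M where "M = max (max j n0) (max N1 N2)"
  have near: "dist (?r n g b) (?r n g (?f n)) < \<epsilon> / 4" if "n \<ge> M" for n g
  proof -
    have "dist (?r n g b) (?r n g (?f n)) = dist b (?f n)"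
      by (rule dist_rmul_unitary[OF \<beta>.twist_unitary[OF u_unitary w]])
    also have "\<dots> \<le> dist (F a) (F (x j)) + dist (?f n) (F (x j))"
      unfolding b by (rule dist_triangle2)
    also have "\<dots> < \<epsilon> / 8 + \<epsilon> / 8"
      using N1[of n] that j dist_star_hom[OF F(1), of a "x j"]
      by (intro add_strict_mono) (auto simp: M_def dist_commute)
    finally show ?thesis by simp
  qed
  have steps: "dist (?r n g (?f n)) (?r M g (?f M)) < \<epsilon> / 8" if "n \<ge> M" "g \<in> C" for n g
  proof -
    have "g \<in> K i" if "i \<ge> M" for i
      using \<open>g \<in> C\<close> K monoD[OF K(1), of n0 i] that by (auto simp: M_def)
    then have "dist (?r n g (?f n)) (?r M g (?f M)) \<le> 2 * D * (1/2) ^ M"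
      using that(1) by (intro geometric_steps[of M "\<lambda>n. ?r n g (?f n)"] step) (auto simp: M_def)
    also have "\<dots> < \<epsilon> / 8" by (rule N2) (simp add: M_def)
    finally show ?thesis .
  qed
  have "dist (?r m g b) (?r n g b) < \<epsilon>" if "g \<in> C" "m \<ge> M" "n \<ge> M" for g m n
    using e near[of m g] near[of n g] steps[of m g] steps[of n g] that
      dist_triangle[of "?r m g b" "?r n g b" "?r m g (?f m)"]
      dist_triangle[of "?r m g (?f m)" "?r n g b" "?r n g (?f n)"]
      dist_triangle2[of "?r m g (?f m)" "?r n g (?f n)" "?r M g (?f M)"]
    by (simp add: dist_commute)
  then show "\<exists>M. \<forall>x\<in>C. \<forall>m\<ge>M. \<forall>n\<ge>M. dist (?r m x b) (?r n x b) < \<epsilon>" by blast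
qed

text \<open>The elements on which the next composition must be close to the identity. Products with
  the cocycle over \<open>K\<close> are included because the cocycle estimate applies that
  composition to them; continuity of the cocycle keeps the set compact.\<close>

definition orbit :: "(nat \<Rightarrow> 'a) \<Rightarrow> 'b multiplier \<Rightarrow> nat \<Rightarrow> 'g set \<Rightarrow> 'b set" where
  "orbit x w n K = (\<lambda>j. conjugate w (\<phi> (x j))) ` {..n} \<union>
     (\<Union>j\<le>n. (\<lambda>g. rmul (twist \<beta> u w g) (conjugate w (\<phi> (x j)))) ` K)"

lemma orbitI:
  "j \<le> n \<Longrightarrow> conjugate w (\<phi> (x j)) \<in> orbit x w n K"
  "j \<le> n \<Longrightarrow> g \<in> K \<Longrightarrow> rmul (twist \<beta> u w g) (conjugate w (\<phi> (x j))) \<in> orbit x w n K"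
  by (auto simp: orbit_def)

lemma compact_orbit: "unitary w \<Longrightarrow> compact K \<Longrightarrow> compact (orbit x w n K)"
  unfolding orbit_def
  by (intro compact_Un compact_UN compact_continuous_image
      \<beta>.twist_rmul_continuous u_unitary u_continuous) (simp_all add: finite_imp_compact)

text \<open>Closeness to the pair \<open>(id, 1)\<close> of a composition: first
  \<open>(\<theta>, x)\<close> perturbed by \<open>w\<close>, then \<open>(\<phi>, u)\<close>
  perturbed by \<open>z\<close>. The second clause concerns the composed cocycle.\<close>

definition near_id :: "('b \<Rightarrow> 'a) \<Rightarrow> ('g \<Rightarrow> 'a multiplier) \<Rightarrow> 'a multiplier \<Rightarrow> 'b multiplier \<Rightarrow> 'b set \<Rightarrow> 'g set \<Rightarrow> real \<Rightarrow> bool"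
  where "near_id \<theta> x w z X K \<epsilon> \<longleftrightarrow> (\<forall>b\<in>X. dist (conjugate z (\<phi> (conjugate w (\<theta> b)))) b < \<epsilon> \<and>
    (\<forall>g\<in>K. dist (rmul (z * uext (twist \<alpha> x w g) * z\<^sup>\<star> * twist \<beta> u z g) b) b < \<epsilon>))"

lemma near_id_mono: "near_id \<theta> x w z X K \<epsilon> \<Longrightarrow> X' \<subseteq> X \<Longrightarrow> K' \<subseteq> K \<Longrightarrow> \<epsilon> \<le> \<epsilon>' \<Longrightarrow> near_id \<theta> x w z X' K' \<epsilon>'"
  unfolding near_id_def by (meson less_le_trans subsetD)

lemma near_id_exists:
  assumes le: "approx_le \<beta> cocycle_id ((\<phi>, u) \<circ>\<^sub>c (\<theta>, x))" and \<theta>: "star_hom \<theta>" and x: "\<And>g. unitary (x g)"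
    and w: "unitary w" and X: "compact X" and K: "compact K" and e: "\<epsilon> > 0"
  obtains z where "unitary z" "near_id \<theta> x w z X K \<epsilon>"
proof -
  have "approx_le \<beta> cocycle_id (\<phi> \<circ> \<theta>, \<lambda>g. uext (x g) * u g)"
    using le by (simp add: cocycle_comp_def)
  then obtain s where s: "unitary s" "\<And>b. b \<in> X \<Longrightarrow> dist (conjugate s ((\<phi> \<circ> \<theta>) b)) b < \<epsilon>"
    "\<And>b g. b \<in> X \<Longrightarrow> g \<in> K \<Longrightarrow> dist (rmul (twist \<beta> (\<lambda>g. uext (x g) * u g) s g) b) b < \<epsilon>"
    by (rule \<beta>.approx_le_id_unitary[OF _ star_hom_comp[OF hom \<theta>] _ X K e])
       (simp_all add: unitary_times uext_unitary u_unitary x)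
  let ?z = "s * (uext w)\<^sup>\<star>"
  have z: "unitary ?z" by (simp add: unitary_times unitary_adj uext_unitary w s)
  have sz: "?z * uext w = s" by (simp add: mult.assoc unitary_cancel[OF uext_unitary[OF w]])
  have "near_id \<theta> x w ?z X K \<epsilon>"
    unfolding near_id_def twist_composition[OF z] conjugate_composition sz using s by simp
  then show ?thesis using z that by blast
qed

end

text \<open>In one step of the intertwining, \<open>f\<close>, \<open>h\<close>, \<open>f'\<close> are consecutive perturbations, and \<open>f'\<close> is
  close to \<open>f' \<circ> h \<circ> f\<close>, which is close to \<open>f\<close>.\<close>

lemma intertwining_step_hom:
  assumes "star_hom f'" "dist (h (f x)) x < \<epsilon>" "dist (f' (h (f x))) (f x) < \<epsilon>"
  shows "dist (f' x) (f x) \<le> 2 * \<epsilon>"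
  using assms(2,3) dist_star_hom[OF assms(1), of x "h (f x)"] dist_triangle[of "f' x" "f x" "f' (h (f x))"]
  by (simp add: dist_commute)

text \<open>Put \<open>c = rmul U (f x)\<close>. By \<open>A\<close>, \<open>rmul (hp U) x\<close>
  is near \<open>h c\<close>, and \<open>rmul V\<close> sends it near \<open>x\<close>. Undoing
  \<open>V\<close> by its adjoint gives the second claim. Otherwise \<open>x\<close> is near
  \<open>rmul V (h c)\<close>; under \<open>f'\<close> the latter becomes
  \<open>rmul (fp V) (f' (h c))\<close>, which is near \<open>rmul (fp V) c\<close> by
  \<open>B\<close>, and \<open>rmul U'\<close> brings this near \<open>c\<close>. The errors grow
  from 2 to 3 to 4 times \<open>\<epsilon>\<close>.\<close>

lemma intertwining_step_cocycle:
  assumes f': "star_hom f'"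
    and hp: "\<And>m b. rmul (hp m) (h b) = h (rmul m b)" and fp: "\<And>m a. rmul (fp m) (f' a) = f' (rmul m a)"
    and unitary: "unitary (hp U)" "unitary V" "unitary U'" "unitary (fp V)"
    and A: "dist (h (f x)) x < \<epsilon>" "dist (rmul (hp U * V) x) x < \<epsilon>"
    and B: "dist (f' (h (rmul U (f x)))) (rmul U (f x)) < \<epsilon>"
      "dist (rmul (fp V * U') (rmul U (f x))) (rmul U (f x)) < \<epsilon>"
  shows "dist (rmul U' (f' x)) (rmul U (f x)) \<le> 4 * \<epsilon>"
    and "dist (rmul (V\<^sup>\<star>) x) (h (rmul U (f x))) \<le> 2 * \<epsilon>"
proof -
  define c where "c = rmul U (f x)"
  have 1: "dist (rmul (hp U) x) (h c) < \<epsilon>"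
    using A(1) dist_rmul_unitary[OF unitary(1), of x "h (f x)"] by (simp add: c_def hp dist_commute)
  have 2: "dist (rmul V (rmul (hp U) x)) x < \<epsilon>" using A(2) by (simp add: rmul_times)
  have "dist (rmul (V\<^sup>\<star>) x) (rmul (hp U) x) < \<epsilon>"
    using 2 dist_rmul_unitary[OF unitary_adj[OF unitary(2)], of x "rmul V (rmul (hp U) x)"]
    by (simp add: unitary_lmul_cancel[OF unitary(2)] dist_commute)
  then show "dist (rmul (V\<^sup>\<star>) x) (h (rmul U (f x))) \<le> 2 * \<epsilon>"
    using 1 dist_triangle[of "rmul (V\<^sup>\<star>) x" "h c" "rmul (hp U) x"] by (simp add: c_def)
  have "dist x (rmul V (h c)) \<le> 2 * \<epsilon>"
    using 1 2 dist_rmul_unitary[OF unitary(2), of "rmul (hp U) x" "h c"]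
      dist_triangle[of x "rmul V (h c)" "rmul V (rmul (hp U) x)"] by (simp add: dist_commute)
  then have "dist (f' x) (rmul (fp V) (f' (h c))) \<le> 2 * \<epsilon>"
    using dist_star_hom[OF f', of x "rmul V (h c)"] by (simp add: fp)
  moreover have "dist (rmul (fp V) (f' (h c))) (rmul (fp V) c) < \<epsilon>"
    using B(1) by (simp add: c_def dist_rmul_unitary[OF unitary(4)])
  ultimately have "dist (f' x) (rmul (fp V) c) \<le> 3 * \<epsilon>"
    using dist_triangle[of "f' x" "rmul (fp V) c" "rmul (fp V) (f' (h c))"] by simp
  then have "dist (rmul U' (f' x)) (rmul (fp V * U') c) \<le> 3 * \<epsilon>"
    using dist_rmul_unitary[OF unitary(3), of "f' x" "rmul (fp V) c"] by (simp add: rmul_times)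
  then show "dist (rmul U' (f' x)) (rmul U (f x)) \<le> 4 * \<epsilon>"
    using B(2) dist_triangle[of "rmul U' (f' x)" c "rmul (fp V * U') c"] by (simp add: c_def)
qed

section \<open>The two-sided intertwining\<close>

lemma tendsto_of_dist:
  fixes s t :: "nat \<Rightarrow> 'a::metric_space"
  assumes "\<And>n. n \<ge> N \<Longrightarrow> dist (s n) (t n) \<le> C * (1/2) ^ n" and t: "t \<longlonglongrightarrow> l"
  shows "s \<longlonglongrightarrow> l"
proof -
  have lim: "(\<lambda>n. C * (1/2) ^ n) \<longlonglongrightarrow> 0" by (intro tendsto_mult_right_zero LIMSEQ_realpow_zero) auto
  have "(\<lambda>n. dist (s n) (t n)) \<longlonglongrightarrow> 0"
    by (rule tendsto_sandwich[OF _ _ tendsto_const lim])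
       (use assms(1) in \<open>auto simp: eventually_sequentially\<close>)
  from tendsto_add[OF this tendsto_dist_iff[THEN iffD1, OF t]]
  have lim: "(\<lambda>n. dist (s n) (t n) + dist (t n) l) \<longlonglongrightarrow> 0" by simp
  have "(\<lambda>n. dist (s n) l) \<longlonglongrightarrow> 0"
    by (rule tendsto_sandwich[OF _ always_eventually tendsto_const lim]) (simp_all add: dist_triangle)
  then show ?thesis by (rule tendsto_dist_iff[THEN iffD2])
qed

locale intertwining =
  AB: cocycle_mor \<alpha> \<uu> \<beta> \<vv> \<phi> u + BA: cocycle_mor \<beta> \<vv> \<alpha> \<uu> \<psi> v
  for \<alpha> :: "'g::{topological_group_add, t2_space, second_countable_topology} \<Rightarrow> 'a::cstar_algebra \<Rightarrow> 'a"
    and \<uu> and \<beta> :: "'g \<Rightarrow> 'b::cstar_algebra \<Rightarrow> 'b" and \<vv> and \<phi> u \<psi> v +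
  assumes id_A: "approx_le \<alpha> cocycle_id ((\<psi>, v) \<circ>\<^sub>c (\<phi>, u))"
    and id_B: "approx_le \<beta> cocycle_id ((\<phi>, u) \<circ>\<^sub>c (\<psi>, v))"
    and lc: "locally_compact_space (euclidean :: 'g topology)"
begin

lemma sequences_exist:
  fixes x :: "nat \<Rightarrow> 'a" and y :: "nat \<Rightarrow> 'b"
  assumes K: "\<And>n. compact (K n)" "mono K"
  obtains w z where "\<And>n. unitary (w n)" "\<And>n. unitary (z n)"
    "\<And>n. BA.near_id \<phi> u (w n) (z n) (x ` {..n}) (K n) ((1/2) ^ n)"
    "\<And>n. AB.near_id \<psi> v (z n) (w (Suc n)) (y ` {..n} \<union> AB.orbit x (w n) n (K n)) (K n) ((1/2) ^ n)"
    "\<And>n. BA.near_id \<phi> u (w (Suc n)) (z (Suc n)) (BA.orbit y (z n) n (K n)) (K n) ((1/2) ^ n)"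
proof -
  \<comment> \<open>Dependent choice asks for an invariant of one pair and a relation between
    consecutive pairs. The unitaries are found in the order \<open>w n\<close>, \<open>z n\<close>,
    \<open>w (Suc n)\<close>, \<open>z (Suc n)\<close>.\<close>
  define good where "good n p \<longleftrightarrow> (case p of (w, z) \<Rightarrow> unitary w \<and> unitary z \<and>
    BA.near_id \<phi> u w z (x ` {..n}) (K n) ((1/2) ^ n))" for n p
  define next_ok where "next_ok n p p' \<longleftrightarrow> (case (p, p') of ((w, z), (w', z')) \<Rightarrow>
    AB.near_id \<psi> v z w' (y ` {..n} \<union> AB.orbit x w n (K n)) (K n) ((1/2) ^ n) \<and>
    BA.near_id \<phi> u w' z' (BA.orbit y z n (K n)) (K n) ((1/2) ^ n))" for n p p'
  note stepA = BA.near_id_exists[OF id_A AB.hom AB.u_unitary]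
  note stepB = AB.near_id_exists[OF id_B BA.hom BA.u_unitary]
  have "\<exists>p. good 0 p"
  proof -
    obtain z where "unitary z" "BA.near_id \<phi> u 1 z (x ` {..0}) (K 0) ((1/2) ^ 0)"
      by (rule stepA[OF unitary_one _ K(1), of "x ` {..0}" "(1/2) ^ 0" 0]) auto
    then show ?thesis using unitary_one unfolding good_def by (intro exI[of _ "(1, z)"]) simp
  qed
  moreover have "\<exists>p'. good (Suc n) p' \<and> next_ok n p p'" if p: "good n p" for n p
  proof -
    obtain w z where wz: "p = (w, z)" "unitary w" "unitary z" using p by (auto simp: good_def)
    have KS: "K n \<subseteq> K (Suc n)" using K(2) by (rule monoD) simp
    obtain w' where w': "unitary w'"
      "AB.near_id \<psi> v z w' (y ` {..n} \<union> AB.orbit x w n (K n)) (K n) ((1/2) ^ n)"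
      by (rule stepB[OF wz(3) _ K(1), of "y ` {..n} \<union> AB.orbit x w n (K n)" "(1/2) ^ n" n])
         (simp_all add: compact_Un finite_imp_compact AB.compact_orbit wz K)
    \<comment> \<open>One choice of \<open>z'\<close> serves both the invariant at
      \<open>Suc n\<close> and closeness on the orbit left by \<open>z\<close>. Hence the union of
      test sets and the stricter data of stage \<open>Suc n\<close>, weakened afterwards.\<close>
    obtain z' where z': "unitary z'"
      "BA.near_id \<phi> u w' z' (x ` {..Suc n} \<union> BA.orbit y z n (K n)) (K (Suc n)) ((1/2) ^ Suc n)"
      by (rule stepA[OF w'(1) _ K(1), of "x ` {..Suc n} \<union> BA.orbit y z n (K n)" "(1/2) ^ Suc n" "Suc n"])
         (simp_all add: compact_Un finite_imp_compact BA.compact_orbit wz K del: atMost_Suc)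
    have "BA.near_id \<phi> u w' z' (x ` {..Suc n}) (K (Suc n)) ((1/2) ^ Suc n)"
      by (rule BA.near_id_mono[OF z'(2)]) auto
    moreover have "BA.near_id \<phi> u w' z' (BA.orbit y z n (K n)) (K n) ((1/2) ^ n)"
      by (rule BA.near_id_mono[OF z'(2) _ KS]) auto
    ultimately show ?thesis
      using w' z'(1) by (intro exI[of _ "(w', z')"]) (simp add: good_def next_ok_def wz(1))
  qed
  ultimately obtain p where p: "\<And>n. good n (p n)" "\<And>n. next_ok n (p n) (p (Suc n))"
    using dependent_nat_choice[of good next_ok] by blast
  show ?thesis
    by (rule that[of "\<lambda>n. fst (p n)" "\<lambda>n. snd (p n)"])
       (use p in \<open>auto simp: good_def next_ok_def split_beta\<close>)
qed

lemma conjugacies_exist: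
  "\<exists>\<Phi> U \<Psi> V.
    cocycle_conjugacy \<alpha> \<uu> \<beta> \<vv> (\<Phi>, U) \<and> cocycle_conjugacy \<beta> \<vv> \<alpha> \<uu> (\<Psi>, V) \<and>
    (\<Psi>, V) = cocycle_inverse (\<Phi>, U) \<and> (\<Phi>, U) = cocycle_inverse (\<Psi>, V) \<and>
    approx_le \<beta> (\<Phi>, U) (\<phi>, u) \<and> approx_le \<alpha> (\<Psi>, V) (\<psi>, v)"
proof -
  obtain x :: "nat \<Rightarrow> 'a" where x: "\<And>a \<epsilon>. \<epsilon> > 0 \<Longrightarrow> \<exists>n. dist (x n) a < \<epsilon>"
    by (rule separable_dense_sequence[OF AB.separable]) blast
  obtain y :: "nat \<Rightarrow> 'b" where y: "\<And>a \<epsilon>. \<epsilon> > 0 \<Longrightarrow> \<exists>n. dist (y n) a < \<epsilon>"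
    by (rule separable_dense_sequence[OF BA.separable]) blast
  obtain K :: "nat \<Rightarrow> 'g set" where K: "\<And>n. compact (K n)" "mono K" "\<And>C. compact C \<Longrightarrow> \<exists>n. C \<subseteq> K n"
    by (rule compact_exhaustion[OF lc]) blast
  obtain w z where w: "\<And>n. unitary (w n)" and z: "\<And>n. unitary (z n)"
    and near: "\<And>n. BA.near_id \<phi> u (w n) (z n) (x ` {..n}) (K n) ((1/2) ^ n)"
    "\<And>n. AB.near_id \<psi> v (z n) (w (Suc n)) (y ` {..n} \<union> AB.orbit x (w n) n (K n)) (K n) ((1/2) ^ n)"
    "\<And>n. BA.near_id \<phi> u (w (Suc n)) (z (Suc n)) (BA.orbit y (z n) n (K n)) (K n) ((1/2) ^ n)"
    by (rule sequences_exist[OF K(1,2), of x y]) blast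
  define f where "f n a = conjugate (w n) (\<phi> a)" for n a
  define h where "h n b = conjugate (z n) (\<psi> b)" for n b
  define U where "U n g = twist \<beta> u (w n) g" for n g
  define V where "V n g = twist \<alpha> v (z n) g" for n g
  have f: "star_hom (f n)" and h: "star_hom (h n)" for n
    unfolding f_def h_def by (rule AB.perturb_hom[OF w], rule BA.perturb_hom[OF z])
  have U: "unitary (U n g)" and V: "unitary (V n g)" for n g
    by (simp_all add: U_def V_def AB.\<beta>.twist_unitary AB.\<alpha>.twist_unitary AB.u_unitary BA.u_unitary w z)
  define fp where "fp n m = w n * AB.uext m * (w n)\<^sup>\<star>" for n m
  define hp where "hp n m = z n * BA.uext m * (z n)\<^sup>\<star>" for n m
  have fp: "rmul (fp n m) (f n a) = f n (rmul m a)" and hp: "rmul (hp n m') (h n b) = h n (rmul m' b)"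
    for n m m' a b
    by (simp_all add: fp_def f_def hp_def h_def AB.rmul_uext_conjugate w BA.rmul_uext_conjugate z)
  have fp_unitary: "unitary (fp n m)" if "unitary m" for n m
    using that by (simp add: fp_def unitary_times unitary_adj w AB.uext_unitary)
  have hp_unitary: "unitary (hp n m)" if "unitary m" for n m
    using that by (simp add: hp_def unitary_times unitary_adj z BA.uext_unitary)
  have near1: "dist (h n (f n a)) a < (1/2) ^ n" "g \<in> K n \<Longrightarrow> dist (rmul (hp n (U n g) * V n g) a) a < (1/2) ^ n"
    if "a \<in> x ` {..n}" for a n g
    using near(1)[of n] that by (auto simp: BA.near_id_def f_def h_def hp_def U_def V_def)
  have near2: "dist (f (Suc n) (h n b)) b < (1/2) ^ n"
      "g \<in> K n \<Longrightarrow> dist (rmul (fp (Suc n) (V n g) * U (Suc n) g) b) b < (1/2) ^ n"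
    if "b \<in> y ` {..n} \<union> AB.orbit x (w n) n (K n)" for b n g
    using near(2)[of n] that by (simp_all only: AB.near_id_def f_def h_def fp_def U_def V_def)
  have near3: "dist (h (Suc n) (f (Suc n) a)) a < (1/2) ^ n"
      "g \<in> K n \<Longrightarrow> dist (rmul (hp (Suc n) (U (Suc n) g) * V (Suc n) g) a) a < (1/2) ^ n"
    if "a \<in> BA.orbit y (z n) n (K n)" for a n g
    using near(3)[of n] that by (simp_all only: BA.near_id_def f_def h_def hp_def U_def V_def)
  have orbA: "f n (x j) \<in> AB.orbit x (w n) n (K n)" "g \<in> K n \<Longrightarrow> rmul (U n g) (f n (x j)) \<in> AB.orbit x (w n) n (K n)"
    if "j \<le> n" for j n g
    using AB.orbitI that by (simp_all add: f_def U_def)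
  have orbB: "h n (y j) \<in> BA.orbit y (z n) n (K n)" "g \<in> K n \<Longrightarrow> rmul (V n g) (h n (y j)) \<in> BA.orbit y (z n) n (K n)"
    if "j \<le> n" for j n g
    using BA.orbitI that by (simp_all add: h_def V_def)
  \<comment> \<open>The consecutive perturbations are \<open>f n\<close>, \<open>h n\<close>,
    \<open>f (Suc n)\<close> here, and \<open>h n\<close>, \<open>f (Suc n)\<close>,
    \<open>h (Suc n)\<close> in \<open>B1\<close> and \<open>B\<close>; this is the source of the
    shifted indices on that side.\<close>
  have A1: "dist (f (Suc n) (x j)) (f n (x j)) \<le> 2 * (1/2) ^ n" if "j \<le> n" for j n
    using that near1(1)[of "x j" n] near2(1)[of "f n (x j)" n] orbA(1)[of j n]
    by (intro intertwining_step_hom[of "f (Suc n)" "h n" "f n"] f) simp_all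
  have A: "dist (rmul (U (Suc n) g) (f (Suc n) (x j))) (rmul (U n g) (f n (x j))) \<le> 4 * (1/2) ^ n"
    "dist (rmul ((V n g)\<^sup>\<star>) (x j)) (h n (rmul (U n g) (f n (x j)))) \<le> 2 * (1/2) ^ n"
    if "j \<le> n" "g \<in> K n" for j n g
    using that
    by (intro intertwining_step_cocycle[of "f (Suc n)" "hp n" "h n" "fp (Suc n)" "U n g" "V n g" "U (Suc n) g" "f n"]
        f hp fp hp_unitary fp_unitary U V near1 near2 orbA UnI2; simp)+
  have B1: "dist (h (Suc n) (y j)) (h n (y j)) \<le> 2 * (1/2) ^ n" if "j \<le> n" for j n
    using that near2(1)[of "y j" n] near3(1)[of "h n (y j)" n] orbB(1)[of j n]
    by (intro intertwining_step_hom[of "h (Suc n)" "f (Suc n)" "h n"] h) simp_all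
  have B: "dist (rmul (V (Suc n) g) (h (Suc n) (y j))) (rmul (V n g) (h n (y j))) \<le> 4 * (1/2) ^ n"
    "dist (rmul ((U (Suc n) g)\<^sup>\<star>) (y j)) (f (Suc n) (rmul (V n g) (h n (y j)))) \<le> 2 * (1/2) ^ n"
    if "j \<le> n" "g \<in> K n" for j n g
    using that
    by (intro intertwining_step_cocycle[of "h (Suc n)" "fp (Suc n)" "f (Suc n)" "hp (Suc n)" "V n g" "U (Suc n) g" "V (Suc n) g" "h n"]
        h hp fp hp_unitary fp_unitary U V near2 near3 orbB UnI1; simp)+
  have "convergent (\<lambda>n. f n a)" for a
    unfolding f_def by (rule AB.perturb_convergent[OF w x]) (use A1 in \<open>auto simp: f_def\<close>)
  then obtain F where F: "\<And>a. (\<lambda>n. f n a) \<longlonglongrightarrow> F a" unfolding convergent_def by metis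
  have "convergent (\<lambda>n. h n b)" for b
    unfolding h_def by (rule BA.perturb_convergent[OF z y]) (use B1 in \<open>auto simp: h_def\<close>)
  then obtain H where H: "\<And>b. (\<lambda>n. h n b) \<longlonglongrightarrow> H b" unfolding convergent_def by metis
  have F_hom: "star_hom F" and H_hom: "star_hom H"
    by (rule star_hom_limit[OF f F], rule star_hom_limit[OF h H])
  have HF: "H (F a) = a" for a
  proof (rule eq_on_dense[where p = "\<lambda>a. H (F a)" and q = "\<lambda>a. a" and x = x])
    show "dist (H (F a)) (H (F b)) \<le> dist a b" for a b
      using dist_star_hom[OF star_hom_comp[OF H_hom F_hom]] by simp
    fix j
    have "(\<lambda>n. h n (f n (x j))) \<longlonglongrightarrow> H (F (x j))"
      by (rule tendsto_contraction[OF dist_star_hom[OF h] H F])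
    moreover have "(\<lambda>n. h n (f n (x j))) \<longlonglongrightarrow> x j"
      by (rule tendsto_of_dist[OF _ tendsto_const, of j _ _ 1]) (use near1(1) in \<open>auto simp: less_imp_le\<close>)
    ultimately show "H (F (x j)) = x j" by (rule LIMSEQ_unique)
  qed (simp_all add: x)
  have FH: "F (H b) = b" for b
  proof (rule eq_on_dense[where p = "\<lambda>b. F (H b)" and q = "\<lambda>b. b" and x = y])
    show "dist (F (H a)) (F (H b)) \<le> dist a b" for a b
      using dist_star_hom[OF star_hom_comp[OF F_hom H_hom]] by simp
    fix j
    have "(\<lambda>n. f (Suc n) (h n (y j))) \<longlonglongrightarrow> F (H (y j))"
      by (rule tendsto_contraction[OF dist_star_hom[OF f] LIMSEQ_Suc[OF F] H])
    moreover have "(\<lambda>n. f (Suc n) (h n (y j))) \<longlonglongrightarrow> y j"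
      by (rule tendsto_of_dist[OF _ tendsto_const, of j _ _ 1]) (use near2(1) in \<open>auto simp: less_imp_le\<close>)
    ultimately show "F (H (y j)) = y j" by (rule LIMSEQ_unique)
  qed (simp_all add: y)
  have bij: "bij F" "bij H" using HF FH by (auto intro!: o_bij simp: fun_eq_iff)
  have iso: "star_iso F" "star_iso H" by (simp_all add: star_iso_def F_hom H_hom bij)
  have inv: "inv F = H" "inv H = F" 
    using HF FH by (simp_all add: inv_unique_comp comp_def id_def)
  have UC_U: "uniformly_Cauchy_on C (\<lambda>n g. rmul (U n g) b)" if C: "C \<subseteq> K n0" for C n0 b
    unfolding U_def
    by (rule AB.perturb_uniformly_Cauchy[OF w x F[unfolded f_def] F_hom bij_is_surj[OF bij(1)] K(2) C])
       (use A(1) in \<open>auto simp: f_def U_def\<close>)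
  have UC_V: "uniformly_Cauchy_on C (\<lambda>n g. rmul (V n g) b)" if C: "C \<subseteq> K n0" for C n0 b
    unfolding V_def
    by (rule BA.perturb_uniformly_Cauchy[OF z y H[unfolded h_def] H_hom bij_is_surj[OF bij(2)] K(2) C])
       (use B(1) in \<open>auto simp: h_def V_def\<close>)
  have point: "\<exists>N. \<forall>n\<ge>N. g \<in> K n" for g
  proof -
    obtain N where "g \<in> K N" using K(3)[of "{g}"] by auto
    then have "g \<in> K n" if "N \<le> n" for n using monoD[OF K(2) that] by blast
    then show ?thesis by blast
  qed
  have conv_U: "convergent (\<lambda>n. rmul (U n g) b)" and conv_V: "convergent (\<lambda>n. rmul (V n g) a)" for g a b
  proof -
    obtain N where N: "{g} \<subseteq> K N" using K(3)[of "{g}"] by auto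
    show "convergent (\<lambda>n. rmul (U n g) b)" "convergent (\<lambda>n. rmul (V n g) a)"
      using uniformly_convergent_imp_convergent[OF Cauchy_uniformly_convergent[OF UC_U[OF N]]]
        uniformly_convergent_imp_convergent[OF Cauchy_uniformly_convergent[OF UC_V[OF N]]] by blast+
  qed
  \<comment> \<open>The second part of \<open>A\<close> replaces the sequence, up to a null
    sequence, by \<open>h n (rmul (U n g) (f n (x j)))\<close>, whose limit
    \<open>tendsto_contraction\<close> gives in two applications.\<close>
  have conv_V': "convergent (\<lambda>n. rmul ((V n g)\<^sup>\<star>) a)" for g a
  proof (rule convergent_on_dense[where f = "\<lambda>n a. rmul ((V n g)\<^sup>\<star>) a" and x = x])
    fix j
    obtain N where N: "\<And>n. n \<ge> N \<Longrightarrow> g \<in> K n" using point by blast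
    obtain l where "(\<lambda>n. rmul (U n g) (F (x j))) \<longlonglongrightarrow> l" using conv_U by (auto simp: convergent_def)
    then have "(\<lambda>n. rmul (U n g) (f n (x j))) \<longlonglongrightarrow> l"
      by (rule tendsto_contraction[rotated, OF _ F]) (simp add: dist_rmul_unitary U)
    then have "(\<lambda>n. h n (rmul (U n g) (f n (x j)))) \<longlonglongrightarrow> H l"
      by (rule tendsto_contraction[OF dist_star_hom[OF h] H])
    then have "(\<lambda>n. rmul ((V n g)\<^sup>\<star>) (x j)) \<longlonglongrightarrow> H l"
      by (rule tendsto_of_dist[rotated, of _ _ "max j N" _ 2]) (use A(2) N in auto)
    then show "convergent (\<lambda>n. rmul ((V n g)\<^sup>\<star>) (x j))" by (auto simp: convergent_def)
  qed (simp_all add: x dist_rmul_unitary unitary_adj V)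
  have conv_U': "convergent (\<lambda>n. rmul ((U n g)\<^sup>\<star>) a)" for g a
  proof (rule convergent_on_dense[where f = "\<lambda>n a. rmul ((U n g)\<^sup>\<star>) a" and x = y])
    fix j
    obtain N where N: "\<And>n. n \<ge> N \<Longrightarrow> g \<in> K n" using point by blast
    obtain l where "(\<lambda>n. rmul (V n g) (H (y j))) \<longlonglongrightarrow> l" using conv_V by (auto simp: convergent_def)
    then have "(\<lambda>n. rmul (V n g) (h n (y j))) \<longlonglongrightarrow> l"
      by (rule tendsto_contraction[rotated, OF _ H]) (simp add: dist_rmul_unitary V)
    then have "(\<lambda>n. f (Suc n) (rmul (V n g) (h n (y j)))) \<longlonglongrightarrow> F l"
      by (rule tendsto_contraction[OF dist_star_hom[OF f] LIMSEQ_Suc[OF F]])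
    then have "(\<lambda>n. rmul ((U (Suc n) g)\<^sup>\<star>) (y j)) \<longlonglongrightarrow> F l"
      by (rule tendsto_of_dist[rotated, of _ _ "max j N" _ 2]) (use B(2) N in auto)
    then show "convergent (\<lambda>n. rmul ((U n g)\<^sup>\<star>) (y j))"
      using LIMSEQ_imp_Suc[of "\<lambda>n. rmul ((U n g)\<^sup>\<star>) (y j)"] by (auto simp: convergent_def)
  qed (simp_all add: y dist_rmul_unitary unitary_adj U)
  have left: "convergent (\<lambda>n. lmul (m n) c)" if m: "\<And>c. convergent (\<lambda>n. rmul ((m n)\<^sup>\<star>) c)"
    for m :: "nat \<Rightarrow> 'c::cstar_algebra multiplier" and c
  proof -
    obtain l where "(\<lambda>n. rmul ((m n)\<^sup>\<star>) (c\<^sup>\<star>)) \<longlonglongrightarrow> l" using m by (auto simp: convergent_def)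
    from tendsto_adj[OF this] show ?thesis by (auto simp: convergent_def rmul_adj adj_adj)
  qed
  have "\<exists>m. limitin strict_topology (\<lambda>n. U n g) m sequentially" for g
    by (rule strict_limit_exists[of "\<lambda>n. U n g" 1]) (auto intro!: norm_unitary_le U conv_U left conv_U')
  then obtain U' where U': "\<And>g. limitin strict_topology (\<lambda>n. U n g) (U' g) sequentially" by metis
  have "\<exists>m. limitin strict_topology (\<lambda>n. V n g) m sequentially" for g
    by (rule strict_limit_exists[of "\<lambda>n. V n g" 1]) (auto intro!: norm_unitary_le V conv_V left conv_V')
  then obtain V' where V': "\<And>g. limitin strict_topology (\<lambda>n. V n g) (V' g) sequentially" by metis
  have lim_U: "(\<lambda>n. rmul (U n g) b) \<longlonglongrightarrow> rmul (U' g) b" and lim_V: "(\<lambda>n. rmul (V n g) a) \<longlonglongrightarrow> rmul (V' g) a" for g a b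
    using U'[of g] V'[of g] by (simp_all add: limitin_strict)
  have unif_U: "uniform_limit C (\<lambda>n g. rmul (U n g) b) (\<lambda>g. rmul (U' g) b) sequentially" if "compact C" for C b
    using Cauchy_uniformly_convergent[OF UC_U] K(3)[OF that] limI[OF lim_U]
    by (auto simp: uniformly_convergent_uniform_limit_iff)
  have unif_V: "uniform_limit C (\<lambda>n g. rmul (V n g) b) (\<lambda>g. rmul (V' g) b) sequentially" if "compact C" for C b
    using Cauchy_uniformly_convergent[OF UC_V] K(3)[OF that] limI[OF lim_V]
    by (auto simp: uniformly_convergent_uniform_limit_iff)
  have U'_unitary: "unitary (U' g)" and V'_unitary: "unitary (V' g)" for g
    by (rule unitary_strict_limit[OF U'], simp_all add: U, rule unitary_strict_limit[OF V'], simp_all add: V)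
  \<comment> \<open>The sequence that proved convergence of the adjoints also computes their limit:
    it is \<open>H (rmul (U' g) (F (x j)))\<close>, the value of
    \<open>rmul (iso_ext H (U' g))\<close> at \<open>x j\<close>.\<close>
  have VU: "V' g = (iso_ext H (U' g))\<^sup>\<star>" for g
  proof -
    have "rmul ((V' g)\<^sup>\<star>) a = rmul (iso_ext H (U' g)) a" for a
    proof (rule eq_on_dense[where p = "rmul ((V' g)\<^sup>\<star>)" and q = "rmul (iso_ext H (U' g))" and x = x])
      fix j
      obtain N where N: "\<And>n. n \<ge> N \<Longrightarrow> g \<in> K n" using point by blast
      have "(\<lambda>n. rmul (U n g) (f n (x j))) \<longlonglongrightarrow> rmul (U' g) (F (x j))"
        by (rule tendsto_contraction[OF _ lim_U F]) (simp add: dist_rmul_unitary U)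
      then have "(\<lambda>n. h n (rmul (U n g) (f n (x j)))) \<longlonglongrightarrow> H (rmul (U' g) (F (x j)))"
        by (rule tendsto_contraction[OF dist_star_hom[OF h] H])
      then have "(\<lambda>n. rmul ((V n g)\<^sup>\<star>) (x j)) \<longlonglongrightarrow> H (rmul (U' g) (F (x j)))"
        by (rule tendsto_of_dist[rotated, of _ _ "max j N" _ 2]) (use A(2) N in auto)
      moreover have "(\<lambda>n. rmul ((V n g)\<^sup>\<star>) (x j)) \<longlonglongrightarrow> rmul ((V' g)\<^sup>\<star>) (x j)"
        using strict_adj[OF V'] by (simp add: limitin_strict)
      ultimately show "rmul ((V' g)\<^sup>\<star>) (x j) = rmul (iso_ext H (U' g)) (x j)"
        by (simp add: rmul_iso_ext iso inv LIMSEQ_unique)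
    qed (simp_all add: x dist_rmul_unitary unitary_adj V'_unitary iso_ext_unitary iso U'_unitary)
    then have "(V' g)\<^sup>\<star> = iso_ext H (U' g)" by (rule multiplier_eqI_rmul)
    then show ?thesis by (metis adj_adj)
  qed
  have "(H, V') = cocycle_inverse (F, U')"
    by (simp add: cocycle_inverse_def inv VU fun_eq_iff)
  moreover have "(F, U') = cocycle_inverse (H, V')"
    using iso_ext_inverse(2)[OF iso(1)]
    by (simp add: cocycle_inverse_def inv VU fun_eq_iff adj_adj iso_ext_adj[OF iso(1)])
  ultimately show ?thesis
    using AB.perturb_limit[OF w iso(1) lc F[unfolded f_def] U'[unfolded U_def] unif_U[unfolded U_def]]
      BA.perturb_limit[OF z iso(2) lc H[unfolded h_def] V'[unfolded V_def] unif_V[unfolded V_def]]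
    by blast
qed

end

theorem corollary3p7:
  fixes \<alpha> :: "'g::{topological_group_add, t2_space, second_countable_topology} \<Rightarrow> 'a::cstar_algebra \<Rightarrow> 'a"
    and \<uu> :: "'g \<Rightarrow> 'g \<Rightarrow> 'a multiplier"
    and \<beta> :: "'g \<Rightarrow> 'b::cstar_algebra \<Rightarrow> 'b"
    and \<vv> :: "'g \<Rightarrow> 'g \<Rightarrow> 'b multiplier"
    and \<phi> :: "'a \<Rightarrow> 'b" and u :: "'g \<Rightarrow> 'b multiplier"
    and \<psi> :: "'b \<Rightarrow> 'a" and v :: "'g \<Rightarrow> 'a multiplier"
  assumes "locally_compact_space (euclidean :: 'g topology)"
    and "separable_space (euclidean :: 'a topology)"
    and "separable_space (euclidean :: 'b topology)"
    and "twisted_action \<alpha> \<uu>" and "twisted_action \<beta> \<vv>"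
    and "cocycle_morphism \<alpha> \<uu> \<beta> \<vv> (\<phi>, u)"
    and "cocycle_morphism \<beta> \<vv> \<alpha> \<uu> (\<psi>, v)"
    and "approx_le \<alpha> cocycle_id ((\<psi>, v) \<circ>\<^sub>c (\<phi>, u))"
    and "approx_le \<beta> cocycle_id ((\<phi>, u) \<circ>\<^sub>c (\<psi>, v))"
  shows "\<exists>\<Phi> U \<Psi> V.
    cocycle_conjugacy \<alpha> \<uu> \<beta> \<vv> (\<Phi>, U) \<and> cocycle_conjugacy \<beta> \<vv> \<alpha> \<uu> (\<Psi>, V) \<and>
    (\<Psi>, V) = cocycle_inverse (\<Phi>, U) \<and> (\<Phi>, U) = cocycle_inverse (\<Psi>, V) \<and>
    approx_le \<beta> (\<Phi>, U) (\<phi>, u) \<and> approx_le \<alpha> (\<Psi>, V) (\<psi>, v)"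
proof -
  interpret intertwining \<alpha> \<uu> \<beta> \<vv> \<phi> u \<psi> v
    using assms by unfold_locales
  show ?thesis by (rule conjugacies_exist)
qed

end
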